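(* Let $t>1$ and let $p(t,n)=1-e^{-t/n}$ for $n\in\mathbb{N}$. Let $\theta=\theta(t)\in(0,1)$ be the unique number in $(0,1)$ with $e^{t\theta}(1-\theta)=1$, let $\varphi(x)=-xt-\ln(1-x)$ for $x\in[0,1)$, so that $\varphi'(\theta)=-t+\frac{1}{1-\theta}>0$, and let $$\sigma=\frac{\sqrt{\theta}}{\varphi'(\theta)\sqrt{1-\theta}}.$$ Let $|\mathcal{C}_{max}|$ denote the size (number of vertices) of the largest connected component of $\mathcal{G}_{n,p(t,n)}$. Then for every $x\in\mathbb{R}$ $$\lim_{n\to\infty}\mathbb{P}_{n,p(t,n)}\left[\frac{|\mathcal{C}_{max}|-\theta n}{\sigma\sqrt{n}}\le x\right]=\Phi(x),$$ where $\Phi$ is the cumulative distribution function of the standard normal distribution.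
   Context: $\mathcal{G}_{n,p}$ is the Erdős–Rényi random graph on the vertex set $\{1,\dots,n\}$ in which each unordered pair of distinct vertices is joined by an edge with probability $p$, independently of all other pairs. $\mathbb{P}_{n,p}$ denotes its law. *)

theory Defs
  imports "HOL-Probability.Probability"
begin

section \<open>Finite simple graphs\<close>

text \<open>
  A simple graph is given by its vertex set \<open>V\<close> and its set \<open>E\<close> of edges, an edge being the
  two-element set of its end vertices. \<open>connected_rel V E\<close> relates two vertices of \<open>V\<close>
  iff they are joined by a (possibly trivial) path.
\<close>

definition all_edges :: "'a set \<Rightarrow> 'a set set" where
  "all_edges V = {e. e \<subseteq> V \<and> card e = 2}"

definition adj_rel :: "'a set \<Rightarrow> 'a set set \<Rightarrow> ('a \<times> 'a) set" where
  "adj_rel V E = {(u, v). u \<in> V \<and> v \<in> V \<and> u \<noteq> v \<and> {u, v} \<in> E}"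

definition connected_rel :: "'a set \<Rightarrow> 'a set set \<Rightarrow> ('a \<times> 'a) set" where
  "connected_rel V E = {(u, v). u \<in> V \<and> v \<in> V \<and> (u, v) \<in> (adj_rel V E)\<^sup>*}"

definition connected_components :: "'a set \<Rightarrow> 'a set set \<Rightarrow> 'a set set" where
  "connected_components V E = V // connected_rel V E"

lemma equiv_connected_rel: "equiv V (connected_rel V E)"
proof -
  have "sym (adj_rel V E)"
    by (auto simp: sym_def adj_rel_def insert_commute)
  then have "sym ((adj_rel V E)\<^sup>*)"
    by (rule sym_rtrancl)
  then show ?thesis
    by (auto simp: equiv_def refl_on_def sym_def trans_def connected_rel_def)
qed

text \<open>Only meaningful for finite nonempty \<open>V\<close>, as otherwise \<open>Max\<close> is unspecified.\<close>

definition max_component_size :: "'a set \<Rightarrow> 'a set set \<Rightarrow> nat" where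
  "max_component_size V E = Max (card ` connected_components V E)"


section \<open>The Erdos-Renyi random graph\<close>

text \<open>
  The law of the edge set of the random graph on \<open>{1..n}\<close>: one independent Bernoulli variable
  with parameter \<open>p\<close> per unordered pair. It is meant for \<open>0 \<le> p \<le> 1\<close>;
  outside this range \<open>bernoulli_pmf\<close> clamps its parameter.
\<close>

definition erdos_renyi :: "nat \<Rightarrow> real \<Rightarrow> nat set set pmf" where
  "erdos_renyi n p =
     map_pmf (\<lambda>b. {e \<in> all_edges {1..n}. b e})
       (Pi_pmf (all_edges {1..n}) False (\<lambda>_. bernoulli_pmf p))"

definition edge_prob :: "real \<Rightarrow> nat \<Rightarrow> real" where
  "edge_prob t n = 1 - exp (- t / real n)"

lemma edge_prob_in_unit: "t \<ge> 0 \<Longrightarrow> edge_prob t n \<in> {0..1}"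
  by (auto simp: edge_prob_def)


section \<open>The constants\<close>

definition theta :: "real \<Rightarrow> real" where
  "theta t = (THE \<theta>. 0 < \<theta> \<and> \<theta> < 1 \<and> exp (t * \<theta>) * (1 - \<theta>) = 1)"

definition phi :: "real \<Rightarrow> real \<Rightarrow> real" where
  "phi t x = - x * t - ln (1 - x)"

definition clt_sigma :: "real \<Rightarrow> real" where
  "clt_sigma t = sqrt (theta t) / (deriv (phi t) (theta t) * sqrt (1 - theta t))"

lemma theta_aux:
  fixes t :: real
  assumes t: "t > 1"
  shows "\<exists>!\<theta>. 0 < \<theta> \<and> \<theta> < 1 \<and> exp (t * \<theta>) * (1 - \<theta>) = 1"
    and "0 < \<theta> \<Longrightarrow> \<theta> < 1 \<Longrightarrow> exp (t * \<theta>) * (1 - \<theta>) = 1 \<Longrightarrow> 1 - 1 / t < \<theta>"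
proof -
  define h where "h = (\<lambda>x::real. exp (t * x) * (1 - x))"
  define m where "m = 1 - 1 / t"
  have m: "0 < m" "m < 1" using t by (auto simp: m_def)
  have der: "(h has_real_derivative exp (t * x) * (t * (1 - x) - 1)) (at x)" for x
    unfolding h_def by (auto intro!: derivative_eq_intros simp: algebra_simps)
  have cont: "continuous_on A h" for A
    unfolding h_def by (intro continuous_intros)
  have pos: "exp (t * x) * (t * (1 - x) - 1) > 0" if "x < m" for x
  proof -
    have "t * (1 - x) - 1 > 0" using that t by (simp add: m_def field_simps)
    then show ?thesis by simp
  qed
  have neg: "exp (t * x) * (t * (1 - x) - 1) < 0" if "m < x" for x
  proof -
    have "t * (1 - x) - 1 < 0" using that t by (simp add: m_def field_simps)
    then show ?thesis by (simp add: mult_less_0_iff)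
  qed
  have inc: "h a < h b" if "a < b" "b \<le> m" for a b
    by (rule DERIV_pos_imp_increasing_open[OF that(1)])
       (use that der pos cont in \<open>force+\<close>)
  have dec: "h b < h a" if "a < b" "m \<le> a" for a b
    by (rule DERIV_neg_imp_decreasing_open[OF that(1)])
       (use that der neg cont in \<open>force+\<close>)
  have h0: "h 0 = 1" and h1: "h 1 = 0" by (auto simp: h_def)
  have gt: "m < x" if "0 < x" "h x = 1" for x
    using inc[of 0 x] that h0 by (cases "x \<le> m") auto
  have "h m > 1" using inc[of 0 m] h0 m by auto
  then obtain x where x: "m \<le> x" "x \<le> 1" "h x = 1"
    using IVT2'[of h 1 1 m] h1 m cont by auto
  have "x \<noteq> 1" using x h1 by auto
  with x m have ex: "0 < x \<and> x < 1 \<and> h x = 1" by auto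
  have uniq: "y = x" if "0 < y \<and> y < 1 \<and> h y = 1" for y
    using dec[of x y] dec[of y x] gt[of x] gt[of y] that ex by (cases x y rule: linorder_cases) auto
  show "\<exists>!\<theta>. 0 < \<theta> \<and> \<theta> < 1 \<and> exp (t * \<theta>) * (1 - \<theta>) = 1"
    using ex uniq unfolding h_def by blast
  show "1 - 1 / t < \<theta>" if "0 < \<theta>" "\<theta> < 1" "exp (t * \<theta>) * (1 - \<theta>) = 1"
    using gt[of \<theta>] that by (simp add: h_def m_def)
qed

lemma theta_props:
  assumes "t > 1"
  shows "0 < theta t" "theta t < 1" "exp (t * theta t) * (1 - theta t) = 1"
  using theI'[OF theta_aux(1)[OF assms]] by (auto simp: theta_def)

lemma deriv_phi:
  assumes "x < 1"
  shows "deriv (phi t) x = - t + 1 / (1 - x)"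
proof (rule DERIV_imp_deriv)
  show "(phi t has_real_derivative - t + 1 / (1 - x)) (at x)"
    unfolding phi_def using assms
    by (auto intro!: derivative_eq_intros simp: field_simps)
qed

lemma deriv_phi_theta_pos:
  assumes "t > 1"
  shows "deriv (phi t) (theta t) > 0"
  using theta_aux(2)[OF assms theta_props[OF assms]] theta_props(2)[OF assms] assms
  by (simp add: deriv_phi field_simps)

end

theory Submission
  imports Defs "HOL-Complex_Analysis.Great_Picard" "HOL-Real_Asymp.Real_Asymp"
begin

text \<open>
  Let \<open>C\<close> be the component of a fixed vertex and \<open>X = |C| / n\<close>. For fixed \<open>p\<close> the law of \<open>|C|\<close> on \<open>n - m\<close>
  vertices has an explicit density \<open>G\<^sub>m\<close> with respect to its law on \<open>n\<close> vertices, because the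
  probability that a given set of \<open>k\<close> vertices spans a connected graph does not depend on \<open>n\<close>. Hence
  \<open>E G\<^sub>m(|C|) = 1\<close> for every \<open>m < n\<close>, where \<open>G\<^sub>m(|C|)\<close> is approximately \<open>exp (- m * phi t X)\<close>.
  The cases \<open>m = 1, 2\<close> show by a second moment argument that \<open>phi t X\<close> is close to 0, so that \<open>X\<close> is close
  to \<open>0\<close> or to \<open>\<theta>\<close>. Taking \<open>m\<close> of order \<open>n\<close> shows that the former has probability \<open>1 - \<theta>\<close>.
  For \<open>m\<close> close to \<open>\<kappa> * sqrt n\<close> one obtains the Laplace transform at \<open>\<kappa> \<ge> 0\<close> of \<open>sqrt n * phi t X\<close> restricted
  to \<open>X\<close> near \<open>\<theta>\<close>; its limit is Gaussian with variance \<open>\<theta> / (1 - \<theta>)\<close>, and linearising \<open>phi t\<close> at \<open>\<theta>\<close> gives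
  the limit law of \<open>|C|\<close>. Removing the size bias of \<open>C\<close> turns this into the expected number of giant
  components of a given size. Outside a giant component the graph is subcritical, so there is
  asymptotically at most one of them.
\<close>

section \<open>Convergence of one-sided Laplace transforms\<close>

text \<open>Only \<open>\<kappa> \<ge> 0\<close> is available because vertices can be deleted but
  not added: sizes above \<open>n\<close> have mass 0 on \<open>n\<close> vertices, so a larger
  graph has no density with respect to the smaller one. Hence the transforms are one-sided, and
  complex analysis is needed before characteristic functions can be used. Deleting vertices keeps
  the edge probability of \<open>n\<close>, so the density is \<open>exp (t * m * k / n)\<close>
  times a ratio of binomials. The factors of that ratio drift, which adds about
  \<open>- m\<^sup>2 / (2 * n) * X / (1 - X)\<close> to its logarithm; for \<open>m\<close> near
  \<open>\<kappa> * sqrt n\<close> and \<open>X\<close> near \<open>\<theta>\<close> this is the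
  origin of the variance. The mean of the density is known only over all sizes. To isolate sizes
  near \<open>\<theta> * n\<close> one subtracts the small sizes, where the density is close to 1,
  and discards the atypical ones. The obstacle is that the density is not uniformly bounded there,
  so small probability does not by itself give a small contribution; the remedy is that the square
  of the density for \<open>m\<close> is at most a constant times the density for
  \<open>2 * m\<close> plus a constant. The mass \<open>\<theta>\<close> near
  \<open>\<theta> * n\<close> and the inverse size bias \<open>n / k\<close>, close to
  \<open>1 / \<theta>\<close>, cancel in the end.\<close>

text \<open>The identity theorem needs an accumulation point, inside the half plane, of the set
  where the limit is known.\<close>

lemma one_islimpt_positive_reals: "(1::complex) islimpt (of_real ` {0<..})"
proof -
  have "(\<lambda>n. of_real (1 + 1 / real (Suc n)) :: complex) \<longlonglongrightarrow> of_real (1 + 0)"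
    by (intro tendsto_intros LIMSEQ_Suc[OF lim_1_over_n])
  moreover have "of_real (1 + 1 / real (Suc n)) \<in> (of_real ` {0<..} - {1} :: complex set)" for n
    by (auto simp del: of_real_add of_nat_Suc intro!: imageI simp: add_pos_pos)
  ultimately show ?thesis
    unfolding islimpt_sequential by (intro exI[of _ "\<lambda>n. of_real (1 + 1 / real (Suc n))"]) auto
qed

text \<open>Montel's theorem and the identity theorem spread the convergence from the positive real axis to
  the open right half plane.\<close>

lemma finite_mgf_limit_half_plane:
  fixes p :: "nat \<Rightarrow> 'a pmf" and Y :: "nat \<Rightarrow> 'a \<Rightarrow> real"
  assumes fin: "\<And>n. finite (set_pmf (p n))"
    and lim: "\<And>s. s \<ge> 0 \<Longrightarrow> (\<lambda>n. \<Sum>k\<in>set_pmf (p n). pmf (p n) k * exp (- s * Y n k)) \<longlonglongrightarrow> exp (s\<^sup>2 / 2)"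
    and z: "Re z > 0"
  shows "(\<lambda>n. \<Sum>k\<in>set_pmf (p n). of_real (pmf (p n) k) * exp (- z * of_real (Y n k))) \<longlonglongrightarrow> exp (z\<^sup>2 / 2)"
proof -
  define S where "S = {z. Re z > 0}"
  define F where "F = (\<lambda>n z. \<Sum>k\<in>set_pmf (p n). of_real (pmf (p n) k) * exp (- z * complex_of_real (Y n k)))"
  define M where "M = (\<lambda>n s. \<Sum>k\<in>set_pmf (p n). pmf (p n) k * exp (- s * Y n k))"
  have S: "open S" "connected S"
    unfolding S_def by (auto intro!: convex_connected open_halfspace_Re_gt convex_halfspace_Re_gt)
  have hol: "F n holomorphic_on A" for n A
    unfolding F_def by (intro holomorphic_intros)
  have FM: "norm (F n z) \<le> M n (Re z)" for n z
    unfolding F_def M_def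
    by (intro order_trans[OF norm_sum] sum_mono) (simp add: norm_mult)
  have M0: "M n 0 = 1" for n
    using fin[of n] by (simp add: M_def sum_pmf_eq_1)
  \<comment> \<open>\<open>M n\<close> need not be monotone, as \<open>Y\<close> may take both
    signs. The exponential at \<open>x\<close> is dominated by the sum of those at the endpoints
    \<open>0\<close> and \<open>b\<close>, so convergence at \<open>b\<close> alone bounds all
    \<open>F n\<close> for real parts between \<open>0\<close> and \<open>b\<close>.\<close>
  have Mle: "M n x \<le> 1 + M n b" if "0 \<le> x" "x \<le> b" for n x b
  proof -
    have "M n x \<le> (\<Sum>k\<in>set_pmf (p n). pmf (p n) k * exp (- 0 * Y n k) + pmf (p n) k * exp (- b * Y n k))"
      unfolding M_def
    proof (intro sum_mono)
      fix k
      have "exp (- x * Y n k) \<le> exp (- 0 * Y n k) + exp (- b * Y n k)"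
      proof (cases "Y n k \<ge> 0")
        case True
        then have "exp (- x * Y n k) \<le> exp (- 0 * Y n k)" using that by simp
        then show ?thesis by (smt (verit) exp_ge_zero)
      next
        case False
        then have "exp (- x * Y n k) \<le> exp (- b * Y n k)" using that by (simp add: mult_right_mono_neg)
        then show ?thesis by (smt (verit) exp_ge_zero)
      qed
      then show "pmf (p n) k * exp (- x * Y n k) \<le> pmf (p n) k * exp (- 0 * Y n k) + pmf (p n) k * exp (- b * Y n k)"
        by (metis distrib_left mult_left_mono pmf_nonneg)
    qed
    also have "\<dots> = M n 0 + M n b" by (simp add: M_def sum.distrib)
    finally show ?thesis by (simp add: M0)
  qed
  have bdd: "\<exists>B. \<forall>h\<in>range F. \<forall>z\<in>K. norm (h z) \<le> B" if K: "compact K" "K \<subseteq> S" for K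
  proof -
    obtain b where b: "\<And>z. z \<in> K \<Longrightarrow> norm z \<le> b" "b > 0"
      using compact_imp_bounded[OF K(1)] bounded_pos by blast
    have "convergent (\<lambda>n. M n b)" using lim[of b] b(2) by (auto simp: M_def convergent_def)
    then have "Bseq (\<lambda>n. M n b)" by (rule convergent_imp_Bseq)
    then obtain C where C: "\<And>n. norm (M n b) \<le> C" by (auto simp: Bseq_def)
    have "norm (F n z) \<le> 1 + C" if "z \<in> K" for n z
    proof -
      have "0 \<le> Re z" "Re z \<le> b"
        using K(2) that b(1)[OF that] complex_Re_le_cmod[of z] by (auto simp: S_def)
      from FM[of n z] Mle[OF this, of n] C[of n] show ?thesis by auto
    qed
    then show ?thesis by blast
  qed
  \<comment> \<open>Normal family argument: a subsequence staying \<open>e\<close> away from the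
    claimed limit has a further subsequence with a holomorphic limit \<open>g\<close>, and the
    hypothesis on the real axis identifies \<open>g\<close>.\<close>
  have "(\<lambda>n. F n z) \<longlonglongrightarrow> exp (z\<^sup>2 / 2)"
  proof (rule ccontr)
    assume "\<not> (\<lambda>n. F n z) \<longlonglongrightarrow> exp (z\<^sup>2 / 2)"
    then obtain e where e: "e > 0" "\<not> eventually (\<lambda>n. dist (F n z) (exp (z\<^sup>2 / 2)) < e) sequentially"
      unfolding tendsto_iff by auto
    from not_eventually_sequentiallyD[OF e(2)] obtain s :: "nat \<Rightarrow> nat"
      where s: "strict_mono s" "\<And>n. \<not> dist (F (s n) z) (exp (z\<^sup>2 / 2)) < e" by auto
    have rng: "range (\<lambda>n. F (s n)) \<subseteq> range F" by auto
    have hol': "h holomorphic_on S" if "h \<in> range F" for h using that hol by auto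
    obtain g r where gr: "g holomorphic_on S" "strict_mono (r :: nat \<Rightarrow> nat)"
      "\<And>x. x \<in> S \<Longrightarrow> (\<lambda>n. F (s (r n)) x) \<longlonglongrightarrow> g x"
      by (rule Montel[OF S(1) hol' bdd rng]) (assumption | rule that)+
    have g: "g z - exp (z\<^sup>2 / 2) = 0"
    proof (rule analytic_continuation[of "\<lambda>z. g z - exp (z\<^sup>2 / 2)" S "of_real ` {0<..}" 1])
      show "(\<lambda>z. g z - exp (z\<^sup>2 / 2)) holomorphic_on S"
        using gr(1) by (intro holomorphic_intros) auto
      fix w :: complex assume "w \<in> of_real ` {0<..}"
      then obtain x where x: "w = of_real x" "x > 0" by auto
      have "(\<lambda>n. complex_of_real (M n x)) \<longlonglongrightarrow> of_real (exp (x\<^sup>2 / 2))"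
        using lim[of x] x(2) by (intro tendsto_of_real) (auto simp: M_def)
      moreover have "complex_of_real (M n x) = F n w" for n
        unfolding M_def F_def x by (simp add: exp_of_real [symmetric])
      ultimately have "(\<lambda>n. F n w) \<longlonglongrightarrow> exp (w\<^sup>2 / 2)"
        by (simp add: x exp_of_real [symmetric])
      from LIMSEQ_subseq_LIMSEQ[OF this strict_mono_o[OF s(1) gr(2)]]
      have l1: "(\<lambda>n. F (s (r n)) w) \<longlonglongrightarrow> exp (w\<^sup>2 / 2)" by (simp add: o_def)
      have l2: "(\<lambda>n. F (s (r n)) w) \<longlonglongrightarrow> g w"
        using x by (intro gr) (auto simp: S_def)
      show "g w - exp (w\<^sup>2 / 2) = 0" using LIMSEQ_unique[OF l1 l2] by simp
    next
      show "of_real ` {0<..} \<subseteq> S" "1 \<in> S" "z \<in> S" using z by (auto simp: S_def)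
    qed (rule S one_islimpt_positive_reals)+
    have "(\<lambda>n. F (s (r n)) z) \<longlonglongrightarrow> exp (z\<^sup>2 / 2)"
      using gr(3)[of z] g z by (simp add: S_def)
    then have "eventually (\<lambda>n. dist (F (s (r n)) z) (exp (z\<^sup>2 / 2)) < e) sequentially"
      using e(1) by (auto simp: tendsto_iff)
    then show False using s(2) by (auto simp: eventually_sequentially)
  qed
  then show ?thesis by (simp add: F_def)
qed

text \<open>The imaginary axis is only a boundary of the region of convergence. It is reached because, by the
  Cauchy-Schwarz inequality, shifting the argument by \<open>e\<close> costs at most \<open>E (exp (- e * Y) - 1)\<^sup>2\<close>, which is
  itself a combination of values of the Laplace transform.\<close>

lemma finite_mgf_limit_imp_char_limit:
  fixes p :: "nat \<Rightarrow> 'a pmf" and Y :: "nat \<Rightarrow> 'a \<Rightarrow> real"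
  assumes fin: "\<And>n. finite (set_pmf (p n))"
    and lim: "\<And>s. s \<ge> 0 \<Longrightarrow> (\<lambda>n. \<Sum>k\<in>set_pmf (p n). pmf (p n) k * exp (- s * Y n k)) \<longlonglongrightarrow> exp (s\<^sup>2 / 2)"
  shows "(\<lambda>n. \<Sum>k\<in>set_pmf (p n). of_real (pmf (p n) k) * iexp (u * Y n k)) \<longlonglongrightarrow> of_real (exp (- u\<^sup>2 / 2))"
proof -
  define F where "F = (\<lambda>n z. \<Sum>k\<in>set_pmf (p n). of_real (pmf (p n) k) * exp (- z * complex_of_real (Y n k)))"
  define M where "M = (\<lambda>n s. \<Sum>k\<in>set_pmf (p n). pmf (p n) k * exp (- s * Y n k))"
  define z where "z = - (\<i> * complex_of_real u)"
  \<comment> \<open>\<open>L e\<close> is the limit in \<open>n\<close> of the mean of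
    \<open>(exp (- e * Y) - 1)\<^sup>2\<close>; it vanishes as \<open>e\<close> tends to 0.\<close>
  define L where "L = (\<lambda>e::real. exp ((2*e)\<^sup>2/2) - 2 * exp (e\<^sup>2/2) + 1)"
  have z: "exp (z\<^sup>2 / 2) = of_real (exp (- u\<^sup>2 / 2))"
    by (simp add: z_def power_mult_distrib exp_of_real [symmetric])
  have cs: "(norm (F n (of_real e + z) - F n z))\<^sup>2 \<le> M n (2*e) - 2 * M n e + 1" for n e
  proof -
    have "norm (F n (of_real e + z) - F n z) \<le> (\<Sum>k\<in>set_pmf (p n). pmf (p n) k * \<bar>exp (- e * Y n k) - 1\<bar>)"
    proof -
      have "F n (of_real e + z) - F n z =
         (\<Sum>k\<in>set_pmf (p n). of_real (pmf (p n) k) * (exp (- z * of_real (Y n k)) * (of_real (exp (- e * Y n k) - 1))))"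
        unfolding F_def sum_subtractf [symmetric]
      proof (intro sum.cong refl)
        fix k
        have "exp (- (of_real e + z) * complex_of_real (Y n k)) =
              exp (- z * of_real (Y n k)) * of_real (exp (- e * Y n k))"
          unfolding exp_of_real [symmetric] exp_add [symmetric] by (simp add: algebra_simps)
        then show "of_real (pmf (p n) k) * exp (- (of_real e + z) * complex_of_real (Y n k)) -
              of_real (pmf (p n) k) * exp (- z * of_real (Y n k)) =
              of_real (pmf (p n) k) * (exp (- z * of_real (Y n k)) * (of_real (exp (- e * Y n k) - 1)))"
          by (simp add: right_diff_distrib)
      qed
      also have "norm \<dots> \<le> (\<Sum>k\<in>set_pmf (p n). pmf (p n) k * \<bar>exp (- e * Y n k) - 1\<bar>)"
        by (intro order_trans[OF norm_sum] sum_mono)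
           (simp add: norm_mult z_def del: of_real_diff)
      finally show ?thesis .
    qed
    then have "(norm (F n (of_real e + z) - F n z))\<^sup>2 \<le> (\<Sum>k\<in>set_pmf (p n). pmf (p n) k * \<bar>exp (- e * Y n k) - 1\<bar>)\<^sup>2"
      by (intro power_mono) auto
    also have "\<dots> = (\<Sum>k\<in>set_pmf (p n). sqrt (pmf (p n) k) * (sqrt (pmf (p n) k) * \<bar>exp (- e * Y n k) - 1\<bar>))\<^sup>2"
      by (simp flip: mult.assoc)
    also have "\<dots> \<le> (\<Sum>k\<in>set_pmf (p n). (sqrt (pmf (p n) k))\<^sup>2) * (\<Sum>k\<in>set_pmf (p n). (sqrt (pmf (p n) k) * \<bar>exp (- e * Y n k) - 1\<bar>)\<^sup>2)"
      by (rule Cauchy_Schwarz_ineq_sum)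
    also have "\<dots> = (\<Sum>k\<in>set_pmf (p n). pmf (p n) k * (exp (- e * Y n k) - 1)\<^sup>2)"
      using fin[of n] by (simp add: power_mult_distrib sum_pmf_eq_1)
    also have "\<dots> = M n (2*e) - 2 * M n e + (\<Sum>k\<in>set_pmf (p n). pmf (p n) k)"
    proof -
      have "pmf (p n) k * (exp (- e * Y n k) - 1)\<^sup>2 =
          pmf (p n) k * exp (- (2 * e) * Y n k) - 2 * (pmf (p n) k * exp (- e * Y n k)) + pmf (p n) k" for k
      proof -
        have "exp (- (2 * e) * Y n k) = exp (- e * Y n k) * exp (- e * Y n k)"
          by (simp flip: exp_add)
        then show ?thesis by (simp add: power2_eq_square algebra_simps)
      qed
      then show ?thesis
        by (simp add: M_def sum.distrib sum_subtractf sum_distrib_left)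
    qed
    finally show ?thesis using fin[of n] by (simp add: sum_pmf_eq_1)
  qed
  have Ltends: "(L \<longlongrightarrow> 0) (at_right 0)"
  proof -
    have "(L \<longlongrightarrow> L 0) (at_right 0)"
      unfolding L_def by (intro tendsto_intros) auto
    then show ?thesis by (simp add: L_def)
  qed
  have Etends: "((\<lambda>e. norm (exp ((of_real e + z)\<^sup>2 / 2) - exp (z\<^sup>2 / 2))) \<longlongrightarrow> 0) (at_right 0)"
  proof -
    have "((\<lambda>e. norm (exp ((of_real e + z)\<^sup>2 / 2) - exp (z\<^sup>2 / 2))) \<longlongrightarrow> norm (exp ((of_real 0 + z)\<^sup>2 / 2) - exp (z\<^sup>2 / 2))) (at_right 0)"
      by (intro tendsto_intros) auto
    then show ?thesis by simp
  qed
  have "(\<lambda>n. F n z) \<longlonglongrightarrow> exp (z\<^sup>2 / 2)"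
    unfolding tendsto_iff
  proof (intro allI impI)
    fix d :: real assume d: "d > 0"
    \<comment> \<open>The shift \<open>e\<close> is fixed before \<open>n\<close>. This is
      legitimate because \<open>cs\<close> holds for every \<open>n\<close> and its right-hand side
      converges to \<open>L e\<close>.\<close>
    have "\<forall>\<^sub>F e in at_right 0. L e < (d/3)\<^sup>2 \<and> norm (exp ((of_real e + z)\<^sup>2 / 2) - exp (z\<^sup>2 / 2)) < d/3 \<and> e > 0"
      using d by (intro eventually_conj order_tendstoD(2)[OF Ltends] order_tendstoD(2)[OF Etends])
                 (auto simp: eventually_at_right_less)
    then obtain e where e: "L e < (d/3)\<^sup>2" "norm (exp ((of_real e + z)\<^sup>2 / 2) - exp (z\<^sup>2 / 2)) < d/3" "e > 0"
      using eventually_happens'[OF trivial_limit_at_right_real] by blast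
    have "(\<lambda>n. M n (2*e) - 2 * M n e + 1) \<longlonglongrightarrow> L e"
      unfolding L_def M_def using e by (intro tendsto_intros lim) auto
    from order_tendstoD(2)[OF this e(1)] have ev1: "\<forall>\<^sub>F n in sequentially. M n (2*e) - 2 * M n e + 1 < (d/3)\<^sup>2" .
    have "(\<lambda>n. F n (of_real e + z)) \<longlonglongrightarrow> exp ((of_real e + z)\<^sup>2 / 2)"
      unfolding F_def using e by (intro finite_mgf_limit_half_plane fin lim) (auto simp: z_def)
    then have ev2: "\<forall>\<^sub>F n in sequentially. dist (F n (of_real e + z)) (exp ((of_real e + z)\<^sup>2 / 2)) < d/3"
      using d unfolding tendsto_iff by (metis divide_pos_pos zero_less_numeral)
    from ev1 ev2 show "\<forall>\<^sub>F n in sequentially. dist (F n z) (exp (z\<^sup>2 / 2)) < d"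
    proof eventually_elim
      case (elim n)
      have "(norm (F n (of_real e + z) - F n z))\<^sup>2 < (d/3)\<^sup>2" using cs[of n e] elim by linarith
      then have "norm (F n (of_real e + z) - F n z) < d/3" by (rule power2_less_imp_less) (use d in auto)
      then have a: "dist (F n z) (F n (of_real e + z)) < d/3" by (simp add: dist_norm norm_minus_commute)
      have b: "dist (exp ((of_real e + z)\<^sup>2 / 2)) (exp (z\<^sup>2/2)) < d/3" using e(2) by (simp add: dist_norm)
      show ?case using a b elim(2) dist_triangle[of "F n z" "exp (z\<^sup>2/2)" "F n (of_real e + z)"]
          dist_triangle[of "F n (of_real e + z)" "exp (z\<^sup>2/2)" "exp ((of_real e + z)\<^sup>2 / 2)"] by linarith
    qed
  qed
  then show ?thesis unfolding z F_def by (simp add: z_def mult.assoc)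
qed

lemma isCont_cdf_std_normal: "isCont (cdf std_normal_distribution) x"
proof -
  have N: "real_distribution std_normal_distribution" by (rule real_dist_normal_dist)
  have "absolutely_continuous lborel std_normal_distribution"
    by (intro absolutely_continuousI_density) auto
  moreover have "{x} \<in> null_sets lborel" by auto
  ultimately have "emeasure std_normal_distribution {x} = 0"
    by (auto simp: absolutely_continuous_def)
  then show ?thesis
    by (simp add: finite_borel_measure.isCont_cdf[OF real_distribution.finite_borel_measure_M[OF N]] measure_def)
qed

lemma finite_mgf_limit_imp_normal_limit:
  fixes p :: "nat \<Rightarrow> 'a pmf" and Y :: "nat \<Rightarrow> 'a \<Rightarrow> real"
  assumes fin: "\<And>n. finite (set_pmf (p n))"
    and lim: "\<And>s. s \<ge> 0 \<Longrightarrow> (\<lambda>n. \<Sum>k\<in>set_pmf (p n). pmf (p n) k * exp (- s * Y n k)) \<longlonglongrightarrow> exp (s\<^sup>2 / 2)"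
  shows "(\<lambda>n. measure_pmf.prob (p n) {k. Y n k \<le> x}) \<longlonglongrightarrow> cdf std_normal_distribution x"
proof -
  define D where "D = (\<lambda>n. distr (measure_pmf (p n)) borel (Y n))"
  have D: "real_distribution (D n)" for n
    unfolding D_def by (intro prob_space.real_distribution_distr measure_pmf.prob_space_axioms) auto
  have N: "real_distribution std_normal_distribution"
    by (rule real_dist_normal_dist)
  have "weak_conv_m D std_normal_distribution"
  proof (rule levy_continuity[OF D N])
    fix u
    have "char (D n) u = (\<Sum>k\<in>set_pmf (p n). of_real (pmf (p n) k) * iexp (u * Y n k))" for n
    proof -
      have "char (D n) u = measure_pmf.expectation (p n) (\<lambda>k. iexp (u * Y n k))"
        unfolding D_def char_def by (subst integral_distr) auto
      also have "\<dots> = (\<Sum>k\<in>set_pmf (p n). pmf (p n) k *\<^sub>R iexp (u * Y n k))"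
        by (rule integral_measure_pmf[OF fin]) auto
      finally show ?thesis by (simp add: scaleR_conv_of_real)
    qed
    moreover have "char std_normal_distribution u = of_real (exp (- u\<^sup>2 / 2))"
      by (simp add: char_std_normal_distribution)
    ultimately show "(\<lambda>n. char (D n) u) \<longlonglongrightarrow> char std_normal_distribution u"
      using finite_mgf_limit_imp_char_limit[OF fin lim, of u] by simp
  qed
  moreover note isCont_cdf_std_normal[of x]
  moreover have "cdf (D n) x = measure_pmf.prob (p n) {k. Y n k \<le> x}" for n
    unfolding D_def cdf_def by (subst measure_distr) (auto simp: vimage_def)
  ultimately show ?thesis
    unfolding weak_conv_m_def weak_conv_def by auto
qed

lemma ex_pmf_finite:
  fixes f :: "'a \<Rightarrow> real"
  assumes "finite A" "\<And>x. x \<in> A \<Longrightarrow> f x \<ge> 0" "(\<Sum>x\<in>A. f x) = 1"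
  shows "\<exists>p. set_pmf p \<subseteq> A \<and> (\<forall>x\<in>A. pmf p x = f x)"
proof -
  define g where "g = (\<lambda>x. if x \<in> A then f x else 0)"
  have g: "g x \<ge> 0" for x using assms by (simp add: g_def)
  have "(\<integral>\<^sup>+x. ennreal (g x) \<partial>count_space UNIV) = (\<integral>\<^sup>+x. ennreal (g x) \<partial>count_space A)"
    by (rule nn_integral_count_space_eq) (auto simp: g_def)
  also have "\<dots> = (\<Sum>x\<in>A. ennreal (g x))" using assms by (simp add: nn_integral_count_space_finite)
  also have "\<dots> = ennreal (\<Sum>x\<in>A. g x)" using g by (simp add: sum_ennreal)
  also have "(\<Sum>x\<in>A. g x) = 1" using assms by (simp add: g_def)
  finally have p: "pmf (embed_pmf g) x = g x" for x using g by (intro pmf_embed_pmf) auto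
  then show ?thesis
    by (intro exI[of _ "embed_pmf g"]) (auto simp: set_pmf_eq g_def split: if_splits)
qed

text \<open>Sizes restricted to a neighbourhood of \<open>\<theta> * n\<close> have total mass near
  \<open>\<theta>\<close>, not 1. The weights are normalised by \<open>W n\<close>, whose limit
  \<open>c\<close> is the case \<open>s = 0\<close> of the hypothesis.\<close>

lemma weighted_mgf_limit_imp_normal_limit:
  fixes w Y :: "nat \<Rightarrow> 'a \<Rightarrow> real" and B :: "nat \<Rightarrow> 'a set"
  assumes fin: "\<And>n. finite (B n)" and w: "\<And>n k. w n k \<ge> 0" and c: "c > 0"
    and lim: "\<And>s. s \<ge> 0 \<Longrightarrow> (\<lambda>n. \<Sum>k\<in>B n. w n k * exp (- s * Y n k)) \<longlonglongrightarrow> c * exp (s\<^sup>2 / 2)"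
  shows "(\<lambda>n. \<Sum>k | k \<in> B n \<and> Y n k \<le> x. w n k) \<longlonglongrightarrow> c * cdf std_normal_distribution x"
proof -
  define W where "W = (\<lambda>n. \<Sum>k\<in>B n. w n k)"
  have W: "W \<longlonglongrightarrow> c" using lim[of 0] by (simp add: W_def)
  have Wpos: "eventually (\<lambda>n. W n > 0) sequentially" using order_tendstoD(1)[OF W c] .
  have "\<exists>p. finite (set_pmf p) \<and> (W n > 0 \<longrightarrow> set_pmf p \<subseteq> B n \<and> (\<forall>k\<in>B n. pmf p k = w n k / W n))" for n
  proof (cases "W n > 0")
    case True
    have "(\<Sum>k\<in>B n. w n k / W n) = 1"
      using True by (simp add: W_def sum_divide_distrib [symmetric])
    with ex_pmf_finite[of "B n" "\<lambda>k. w n k / W n"] fin w True show ?thesis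
      by (metis (no_types, lifting) divide_nonneg_pos finite_subset)
  next
    case False
    \<comment> \<open>A dummy law for the finitely many \<open>n\<close> without mass; only the
      finiteness of its support is required.\<close>
    then show ?thesis by (intro exI[of _ "return_pmf undefined"]) auto
  qed
  then obtain p where p: "\<And>n. finite (set_pmf (p n))"
    "\<And>n. W n > 0 \<Longrightarrow> set_pmf (p n) \<subseteq> B n" "\<And>n k. W n > 0 \<Longrightarrow> k \<in> B n \<Longrightarrow> pmf (p n) k = w n k / W n"
    by metis
  have "(\<lambda>n. measure_pmf.prob (p n) {k. Y n k \<le> x}) \<longlonglongrightarrow> cdf std_normal_distribution x"
  proof (rule finite_mgf_limit_imp_normal_limit[OF p(1)])
    fix s :: real assume s: "s \<ge> 0"
    have "(\<lambda>n. (\<Sum>k\<in>B n. w n k * exp (- s * Y n k)) / W n) \<longlonglongrightarrow> c * exp (s\<^sup>2 / 2) / c"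
      using c by (intro tendsto_divide lim W s) auto
    moreover have "eventually (\<lambda>n. (\<Sum>k\<in>B n. w n k * exp (- s * Y n k)) / W n = (\<Sum>k\<in>set_pmf (p n). pmf (p n) k * exp (- s * Y n k))) sequentially"
      using Wpos
    proof eventually_elim
      case (elim n)
      have "(\<Sum>k\<in>set_pmf (p n). pmf (p n) k * exp (- s * Y n k)) = (\<Sum>k\<in>B n. pmf (p n) k * exp (- s * Y n k))"
        using p(2)[OF elim] fin by (intro sum.mono_neutral_left) (auto simp: set_pmf_eq)
      also have "\<dots> = (\<Sum>k\<in>B n. w n k * exp (- s * Y n k) / W n)"
        using p(3)[OF elim] by (intro sum.cong refl) simp
      finally show ?case by (simp add: sum_divide_distrib)
    qed
    ultimately show "(\<lambda>n. \<Sum>k\<in>set_pmf (p n). pmf (p n) k * exp (- s * Y n k)) \<longlonglongrightarrow> exp (s\<^sup>2 / 2)"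
      using c by (simp add: tendsto_cong)
  qed
  from tendsto_mult[OF W this]
  have "(\<lambda>n. W n * measure_pmf.prob (p n) {k. Y n k \<le> x}) \<longlonglongrightarrow> c * cdf std_normal_distribution x" .
  moreover have "eventually (\<lambda>n. W n * measure_pmf.prob (p n) {k. Y n k \<le> x} = (\<Sum>k | k \<in> B n \<and> Y n k \<le> x. w n k)) sequentially"
    using Wpos
  proof eventually_elim
    case (elim n)
    have "measure_pmf.prob (p n) {k. Y n k \<le> x} = measure_pmf.prob (p n) {k. k \<in> B n \<and> Y n k \<le> x}"
      using p(2)[OF elim] by (intro measure_pmf.finite_measure_eq_AE) (auto simp: AE_measure_pmf_iff)
    also have "\<dots> = (\<Sum>k | k \<in> B n \<and> Y n k \<le> x. pmf (p n) k)"
      using fin by (intro measure_measure_pmf_finite) auto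
    also have "\<dots> = (\<Sum>k | k \<in> B n \<and> Y n k \<le> x. w n k / W n)"
      using p(3)[OF elim] by (intro sum.cong refl) auto
    finally show ?case using elim by (simp add: sum_divide_distrib [symmetric])
  qed
  ultimately show ?thesis by (simp add: tendsto_cong)
qed

section \<open>Component sizes of the random graph\<close>

text \<open>The edge law of \<open>erdos_renyi\<close> for an arbitrary ground set, so that edge
  sets can be cut into independent blocks.\<close>

definition random_subset :: "'a set \<Rightarrow> real \<Rightarrow> 'a set pmf" where
  "random_subset F p = map_pmf (\<lambda>b. {e \<in> F. b e}) (Pi_pmf F False (\<lambda>_. bernoulli_pmf p))"

lemma set_pmf_random_subset: "set_pmf (random_subset F p) \<subseteq> Pow F"
  by (auto simp: random_subset_def)

lemma finite_set_pmf_random_subset: "finite F \<Longrightarrow> finite (set_pmf (random_subset F p))"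
  by (meson finite_Pow_iff finite_subset set_pmf_random_subset)

lemma random_subset_Un:
  assumes "finite A" "finite B" "A \<inter> B = {}"
  shows "random_subset (A \<union> B) p =
    map_pmf (\<lambda>(S, T). S \<union> T) (pair_pmf (random_subset A p) (random_subset B p))"
proof -
  have "random_subset (A \<union> B) p =
    map_pmf (\<lambda>(f, g). {e \<in> A \<union> B. if e \<in> A then f e else g e})
      (pair_pmf (Pi_pmf A False (\<lambda>_. bernoulli_pmf p)) (Pi_pmf B False (\<lambda>_. bernoulli_pmf p)))"
    unfolding random_subset_def Pi_pmf_union[OF assms] map_pmf_comp
    by (intro map_pmf_cong refl) auto
  also have "\<dots> = map_pmf (\<lambda>(f, g). {e \<in> A. f e} \<union> {e \<in> B. g e})
      (pair_pmf (Pi_pmf A False (\<lambda>_. bernoulli_pmf p)) (Pi_pmf B False (\<lambda>_. bernoulli_pmf p)))"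
    using assms(3) by (intro map_pmf_cong refl) auto
  also have "\<dots> = map_pmf (\<lambda>(S, T). S \<union> T) (pair_pmf (random_subset A p) (random_subset B p))"
    unfolding random_subset_def map_pair [symmetric] map_pmf_comp by (simp add: case_prod_beta')
  finally show ?thesis .
qed

lemma prob_random_subset_empty:
  assumes "finite F" "0 \<le> p" "p \<le> 1"
  shows "measure_pmf.prob (random_subset F p) {{}} = (1 - p) ^ card F"
proof -
  have "measure_pmf.prob (random_subset F p) {{}} =
     measure_pmf.prob (Pi_pmf F False (\<lambda>_. bernoulli_pmf p)) (Pi F (\<lambda>_. {False}))"
    unfolding random_subset_def measure_map_pmf
    by (intro arg_cong2[where f = measure] refl) (auto simp: Pi_def)
  also have "\<dots> = (\<Prod>x\<in>F. measure_pmf.prob (bernoulli_pmf p) {False})"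
    by (rule measure_Pi_pmf_Pi[OF assms(1)])
  finally show ?thesis using assms(2,3) by (simp add: measure_pmf_single)
qed

lemma prob_pair_pmf_times:
  "measure_pmf.prob (pair_pmf p q) {(x, y). P x \<and> Q y} = measure_pmf.prob p {x. P x} * measure_pmf.prob q {y. Q y}"
proof -
  have "emeasure (pair_pmf p q) {(x, y). P x \<and> Q y} =
      (\<integral>\<^sup>+ x. \<integral>\<^sup>+ y. indicator {x. P x} x * indicator {y. Q y} y \<partial>q \<partial>p)"
    by (subst nn_integral_indicator [symmetric], simp, subst nn_integral_pair_pmf')
       (auto intro!: nn_integral_cong simp: indicator_def)
  also have "\<dots> = emeasure p {x. P x} * emeasure q {y. Q y}"
    by (simp add: nn_integral_cmult nn_integral_multc)
  finally show ?thesis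
    by (simp add: measure_pmf.emeasure_eq_measure flip: ennreal_mult)
qed

section \<open>Splitting a graph along a vertex set and its complement\<close>

definition cross_edges :: "'a set \<Rightarrow> 'a set \<Rightarrow> 'a set set" where
  "cross_edges A D = (\<lambda>(u, v). {u, v}) ` (A \<times> D)"

lemma card_cross_edges:
  assumes "A \<inter> D = {}"
  shows "card (cross_edges A D) = card A * card D"
proof -
  have "inj_on (\<lambda>(u, v). {u, v}) (A \<times> D)"
    using assms by (auto simp: inj_on_def doubleton_eq_iff)
  then show ?thesis
    by (simp add: cross_edges_def card_image card_cartesian_product)
qed

lemma all_edges_Un:
  assumes "A \<inter> D = {}"
  shows "all_edges (A \<union> D) = all_edges A \<union> (cross_edges A D \<union> all_edges D)"
proof (intro equalityI subsetI)
  fix e assume "e \<in> all_edges (A \<union> D)"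
  then obtain u v where "e = {u, v}" "u \<noteq> v" "u \<in> A \<union> D" "v \<in> A \<union> D"
    by (auto simp: all_edges_def card_2_iff)
  then show "e \<in> all_edges A \<union> (cross_edges A D \<union> all_edges D)"
    by (auto simp: all_edges_def cross_edges_def image_iff insert_commute)
next
  fix e assume "e \<in> all_edges A \<union> (cross_edges A D \<union> all_edges D)"
  then show "e \<in> all_edges (A \<union> D)"
    using assms by (auto simp: all_edges_def cross_edges_def card_insert_if)
qed

lemma finite_all_edges: "finite V \<Longrightarrow> finite (all_edges V)"
  by (auto simp: all_edges_def)

lemma connected_components_nonempty: "A \<in> connected_components V E \<Longrightarrow> A \<noteq> {}"
  unfolding connected_components_def by (rule in_quotient_imp_non_empty[OF equiv_connected_rel])

lemma connected_components_subset: "A \<in> connected_components V E \<Longrightarrow> A \<subseteq> V"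
  unfolding connected_components_def by (rule in_quotient_imp_subset[OF equiv_connected_rel])

lemma connected_components_disjoint:
  "A \<in> connected_components V E \<Longrightarrow> B \<in> connected_components V E \<Longrightarrow> A \<noteq> B \<Longrightarrow> A \<inter> B = {}"
  unfolding connected_components_def using quotient_disj[OF equiv_connected_rel] by blast

lemma Union_connected_components: "\<Union> (connected_components V E) = V"
  unfolding connected_components_def by (rule Union_quotient[OF equiv_connected_rel])

lemma finite_connected_components: "finite V \<Longrightarrow> finite (connected_components V E)"
  by (meson connected_components_subset finite_Pow_iff finite_subset PowI subsetI)

lemma component_no_cross_edges:
  assumes A: "A \<in> connected_components (A \<union> D) E" and "A \<inter> D = {}"
  shows "E \<inter> cross_edges A D = {}"
proof (rule ccontr)
  assume "E \<inter> cross_edges A D \<noteq> {}"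
  then obtain u v where uv: "u \<in> A" "v \<in> D" "{u, v} \<in> E" by (auto simp: cross_edges_def)
  then have "(u, v) \<in> adj_rel (A \<union> D) E" using assms(2) by (auto simp: adj_rel_def)
  then have "(u, v) \<in> connected_rel (A \<union> D) E" using uv by (auto simp: connected_rel_def)
  then have "v \<in> A"
    using A uv(1) in_quotient_imp_closed[OF equiv_connected_rel]
    unfolding connected_components_def by metis
  then show False using uv assms(2) by auto
qed

lemma connected_rel_Un:
  assumes "A \<inter> D = {}" "EA \<subseteq> all_edges A" "ED \<subseteq> all_edges D"
  shows "connected_rel (A \<union> D) (EA \<union> ED) = connected_rel A EA \<union> connected_rel D ED"
proof -
  have adj: "adj_rel (A \<union> D) (EA \<union> ED) = adj_rel A EA \<union> adj_rel D ED"
    using assms by (auto simp: adj_rel_def all_edges_def)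
  \<comment> \<open>Stated for arbitrary \<open>A\<close> and \<open>D\<close>, as it is used again
    with their roles exchanged.\<close>
  have path: "(u, v) \<in> (adj_rel A EA)\<^sup>* \<and> v \<in> A"
    if "(u, v) \<in> (adj_rel A EA \<union> adj_rel D ED)\<^sup>*" "u \<in> A" "A \<inter> D = {}" for u v and A D :: "'a set" and EA ED
    using that(1)
  proof (induction rule: rtrancl_induct)
    case base
    then show ?case using that by auto
  next
    case (step y z)
    then have "(y, z) \<in> adj_rel A EA" using that(3) by (auto simp: adj_rel_def)
    then show ?case using step by (auto simp: adj_rel_def intro: rtrancl_into_rtrancl)
  qed
  have mono: "(adj_rel A EA)\<^sup>* \<subseteq> (adj_rel A EA \<union> adj_rel D ED)\<^sup>*" "(adj_rel D ED)\<^sup>* \<subseteq> (adj_rel A EA \<union> adj_rel D ED)\<^sup>*"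
    by (auto intro!: rtrancl_mono)
  show ?thesis
  proof (intro equalityI subrelI)
    fix u v assume "(u, v) \<in> connected_rel (A \<union> D) (EA \<union> ED)"
    then have uv: "u \<in> A \<union> D" "v \<in> A \<union> D" "(u, v) \<in> (adj_rel A EA \<union> adj_rel D ED)\<^sup>*"
      by (auto simp: connected_rel_def adj)
    show "(u, v) \<in> connected_rel A EA \<union> connected_rel D ED"
    proof (cases "u \<in> A")
      case True
      from path[OF uv(3) True assms(1)] True show ?thesis by (auto simp: connected_rel_def)
    next
      case False
      then have "u \<in> D" using uv by auto
      from path[of u v D ED A EA] this uv(3) assms(1) show ?thesis
        by (auto simp: connected_rel_def Un_commute Int_commute)
    qed
  next
    fix u v assume "(u, v) \<in> connected_rel A EA \<union> connected_rel D ED"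
    then show "(u, v) \<in> connected_rel (A \<union> D) (EA \<union> ED)"
      using mono by (auto simp: connected_rel_def adj)
  qed
qed

lemma connected_components_Un:
  assumes "A \<inter> D = {}" "EA \<subseteq> all_edges A" "ED \<subseteq> all_edges D"
  shows "connected_components (A \<union> D) (EA \<union> ED) = connected_components A EA \<union> connected_components D ED"
proof -
  have 1: "(connected_rel A EA \<union> connected_rel D ED) `` {x} = connected_rel A EA `` {x}" if "x \<in> A" for x
    using that assms(1) by (auto simp: connected_rel_def)
  have 2: "(connected_rel A EA \<union> connected_rel D ED) `` {x} = connected_rel D ED `` {x}" if "x \<in> D" for x
    using that assms(1) by (auto simp: connected_rel_def)
  show ?thesis
    unfolding connected_components_def connected_rel_Un[OF assms] quotient_def
    using 1 2 by auto
qed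

text \<open>\<open>Q\<close> keeps track of the other components. A trivial \<open>Q\<close> gives
  the event that \<open>A\<close> is a component; \<open>\<lambda>C. B \<in> C\<close> gives the
  event that \<open>A\<close> and \<open>B\<close> are two distinct components.\<close>

lemma component_split_iff:
  assumes "A \<inter> D = {}" "A \<noteq> {}" "EA \<subseteq> all_edges A" "EC \<subseteq> cross_edges A D" "ED \<subseteq> all_edges D"
  shows "A \<in> connected_components (A \<union> D) (EA \<union> (EC \<union> ED)) \<and> Q (connected_components (A \<union> D) (EA \<union> (EC \<union> ED)) - {A})
    \<longleftrightarrow> A \<in> connected_components A EA \<and> EC = {} \<and> Q (connected_components D ED)"
proof (cases "EC = {}")
  case False
  then show ?thesis
    using component_no_cross_edges[of A D "EA \<union> (EC \<union> ED)"] assms by blast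
next
  case True
  have cc: "connected_components (A \<union> D) (EA \<union> (EC \<union> ED)) = connected_components A EA \<union> connected_components D ED"
    using connected_components_Un[OF assms(1,3,5)] True by simp
  have nA: "A \<notin> connected_components D ED"
    using connected_components_subset[of A D ED] assms(1,2) by auto
  \<comment> \<open>A connected \<open>A\<close> is its only component, so removing \<open>A\<close>
    leaves exactly the components of \<open>D\<close>.\<close>
  have "connected_components A EA = {A}" if "A \<in> connected_components A EA"
  proof -
    have "B = A" if B: "B \<in> connected_components A EA" for B
      using connected_components_disjoint[OF \<open>A \<in> connected_components A EA\<close> B]
        connected_components_subset[OF B] connected_components_nonempty[OF B] by auto
    then show ?thesis using that by auto
  qed
  then show ?thesis using nA True unfolding cc by auto
qed

definition connected_prob :: "real \<Rightarrow> nat \<Rightarrow> real" where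
  "connected_prob p k = measure_pmf.prob (random_subset (all_edges {1..k}) p) {E. {1..k} \<in> connected_components {1..k} E}"

text \<open>The edges inside \<open>A\<close>, across, and inside \<open>D\<close> are independent.
  \<open>A\<close> is a component iff it is connected by its own edges and all
  \<open>card A * card D\<close> cross edges are absent; the graph on \<open>D\<close> is then
  unconstrained.\<close>

lemma prob_component_split:
  assumes "finite A" "finite D" "A \<inter> D = {}" "A \<noteq> {}" "0 \<le> p" "p \<le> 1"
  shows "measure_pmf.prob (random_subset (all_edges (A \<union> D)) p)
      {E. A \<in> connected_components (A \<union> D) E \<and> Q (connected_components (A \<union> D) E - {A})}
    = measure_pmf.prob (random_subset (all_edges A) p) {E. A \<in> connected_components A E}
      * (1 - p) ^ (card A * card D) * measure_pmf.prob (random_subset (all_edges D) p) {E. Q (connected_components D E)}"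
proof -
  let ?R = "\<lambda>F. random_subset F p"
  have fin: "finite (all_edges A)" "finite (cross_edges A D)" "finite (all_edges D)"
    using assms by (auto simp: finite_all_edges cross_edges_def)
  have d1: "cross_edges A D \<inter> all_edges D = {}"
    using assms by (auto simp: cross_edges_def all_edges_def)
  have d2: "all_edges A \<inter> (cross_edges A D \<union> all_edges D) = {}"
  proof -
    have "e \<subseteq> A \<Longrightarrow> e \<subseteq> D \<Longrightarrow> card e \<noteq> 2" for e
    proof -
      assume "e \<subseteq> A" "e \<subseteq> D"
      then have "e = {}" using assms(3) by auto
      then show "card e \<noteq> 2" by simp
    qed
    then show ?thesis using assms by (auto simp: cross_edges_def all_edges_def)
  qed
  have "random_subset (all_edges (A \<union> D)) p =
     map_pmf (\<lambda>(EA, EC, ED). EA \<union> (EC \<union> ED)) (pair_pmf (?R (all_edges A)) (pair_pmf (?R (cross_edges A D)) (?R (all_edges D))))"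
    unfolding all_edges_Un[OF assms(3)] random_subset_Un[OF fin(1) finite_UnI[OF fin(2,3)] d2]
      random_subset_Un[OF fin(2,3) d1]
    by (simp add: pair_map_pmf2 map_pmf_comp case_prod_beta')
  then have "measure_pmf.prob (random_subset (all_edges (A \<union> D)) p)
      {E. A \<in> connected_components (A \<union> D) E \<and> Q (connected_components (A \<union> D) E - {A})} =
    measure_pmf.prob (pair_pmf (?R (all_edges A)) (pair_pmf (?R (cross_edges A D)) (?R (all_edges D))))
      ((\<lambda>(EA, EC, ED). EA \<union> (EC \<union> ED)) -` {E. A \<in> connected_components (A \<union> D) E \<and> Q (connected_components (A \<union> D) E - {A})})"
    by simp
  also have "\<dots> = measure_pmf.prob (pair_pmf (?R (all_edges A)) (pair_pmf (?R (cross_edges A D)) (?R (all_edges D))))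
      {(EA, Z). A \<in> connected_components A EA \<and> Z \<in> {(EC, ED). EC = {} \<and> Q (connected_components D ED)}}"
  proof (rule measure_pmf.finite_measure_eq_AE)
    show "AE x in measure_pmf (pair_pmf (?R (all_edges A)) (pair_pmf (?R (cross_edges A D)) (?R (all_edges D)))).
      (x \<in> (\<lambda>(EA, EC, ED). EA \<union> (EC \<union> ED)) -` {E. A \<in> connected_components (A \<union> D) E \<and> Q (connected_components (A \<union> D) E - {A})}) =
      (x \<in> {(EA, Z). A \<in> connected_components A EA \<and> Z \<in> {(EC, ED). EC = {} \<and> Q (connected_components D ED)}})"
      unfolding AE_measure_pmf_iff
    proof
      fix x assume x: "x \<in> set_pmf (pair_pmf (?R (all_edges A)) (pair_pmf (?R (cross_edges A D)) (?R (all_edges D))))"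
      obtain EA EC ED where xe: "x = (EA, EC, ED)" by (cases x)
      have "EA \<subseteq> all_edges A" "EC \<subseteq> cross_edges A D" "ED \<subseteq> all_edges D"
        using x set_pmf_random_subset[of _ p] unfolding xe by auto
      from component_split_iff[OF assms(3,4) this, of Q]
      show "(x \<in> (\<lambda>(EA, EC, ED). EA \<union> (EC \<union> ED)) -` {E. A \<in> connected_components (A \<union> D) E \<and> Q (connected_components (A \<union> D) E - {A})}) =
      (x \<in> {(EA, Z). A \<in> connected_components A EA \<and> Z \<in> {(EC, ED). EC = {} \<and> Q (connected_components D ED)}})"
        by (simp add: xe)
    qed
  qed auto
  also have "\<dots> = measure_pmf.prob (?R (all_edges A)) {E. A \<in> connected_components A E} *
      (measure_pmf.prob (?R (cross_edges A D)) {{}} * measure_pmf.prob (?R (all_edges D)) {E. Q (connected_components D E)})"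
    unfolding prob_pair_pmf_times Collect_mem_eq by simp
  finally show ?thesis
    using prob_random_subset_empty[OF fin(2) assms(5,6)] card_cross_edges[OF assms(3)] by simp
qed

section \<open>The size of the component of a fixed vertex\<close>

lemma sum_card_subsets:
  fixes g :: "nat \<Rightarrow> real"
  assumes "finite V"
  shows "(\<Sum>A\<in>Pow V. g (card A)) = (\<Sum>k\<le>card V. real (card V choose k) * g k)"
proof -
  have "(\<Sum>A\<in>Pow V. g (card A)) = (\<Sum>k\<le>card V. \<Sum>A\<in>{A \<in> Pow V. card A = k}. g (card A))"
    using assms by (intro sum.group [symmetric]) (auto intro: card_mono)
  also have "\<dots> = (\<Sum>k\<le>card V. real (card V choose k) * g k)"
    using n_subsets[OF assms] by (intro sum.cong refl) auto
  finally show ?thesis .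
qed

lemma sum_card_subsets_containing:
  fixes g :: "nat \<Rightarrow> real"
  assumes "finite V" "v \<in> V"
  shows "(\<Sum>A | A \<subseteq> V \<and> v \<in> A. g (card A)) = (\<Sum>k=1..card V. real ((card V - 1) choose (k - 1)) * g k)"
proof -
  have "(\<Sum>A | A \<subseteq> V \<and> v \<in> A. g (card A)) = (\<Sum>A\<in>Pow (V - {v}). g (card (insert v A)))"
    by (rule sum.reindex_bij_witness[of _ "insert v" "\<lambda>A. A - {v}"])
       (use assms in \<open>auto simp: insert_absorb\<close>)
  also have "\<dots> = (\<Sum>A\<in>Pow (V - {v}). g (Suc (card A)))"
  proof (intro sum.cong refl)
    fix A assume A: "A \<in> Pow (V - {v})"
    then have "finite A" "v \<notin> A" using assms(1) finite_subset[of A V] by auto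
    then show "g (card (insert v A)) = g (Suc (card A))" by simp
  qed
  also have "\<dots> = (\<Sum>k\<le>card V - 1. real ((card V - 1) choose k) * g (Suc k))"
    using sum_card_subsets[of "V - {v}" "\<lambda>k. g (Suc k)"] assms by simp
  also have "\<dots> = (\<Sum>k=1..card V. real ((card V - 1) choose (k - 1)) * g k)"
  proof -
    have "card V > 0" using assms by (auto simp: card_gt_0_iff)
    then show ?thesis
      by (intro sum.reindex_bij_witness[of _ "\<lambda>k. k - 1" Suc]) auto
  qed
  finally show ?thesis .
qed

text \<open>Exactly one set containing \<open>v\<close> is a component, so these events partition
  the probability space.\<close>

lemma sum_prob_component_containing:
  assumes "finite V" "v \<in> V" "0 \<le> p" "p \<le> 1"
  shows "(\<Sum>A | A \<subseteq> V \<and> v \<in> A. measure_pmf.prob (random_subset (all_edges A) p) {E. A \<in> connected_components A E}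
            * (1 - p) ^ (card A * (card V - card A))) = 1"
proof -
  let ?M = "random_subset (all_edges V) p"
  have "measure_pmf.prob (random_subset (all_edges A) p) {E. A \<in> connected_components A E}
            * (1 - p) ^ (card A * (card V - card A)) = measure_pmf.prob ?M {E. A \<in> connected_components V E}"
    if "A \<subseteq> V" "v \<in> A" for A
  proof -
    have V: "A \<union> (V - A) = V" and c: "card (V - A) = card V - card A" and f: "finite A"
      using that assms(1) by (auto simp: card_Diff_subset finite_subset)
    have "A \<noteq> {}" using that by auto
    with prob_component_split[OF f _ _ _ assms(3,4), of "V - A" "\<lambda>_. True"]
    show ?thesis using that assms(1) unfolding V c by auto
  qed
  then have "(\<Sum>A | A \<subseteq> V \<and> v \<in> A. measure_pmf.prob (random_subset (all_edges A) p) {E. A \<in> connected_components A E}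
            * (1 - p) ^ (card A * (card V - card A))) = (\<Sum>A | A \<subseteq> V \<and> v \<in> A. measure_pmf.prob ?M {E. A \<in> connected_components V E})"
    by (intro sum.cong) auto
  also have "\<dots> = measure_pmf.prob ?M (\<Union>A\<in>{A. A \<subseteq> V \<and> v \<in> A}. {E. A \<in> connected_components V E})"
  proof (rule measure_pmf.finite_measure_finite_Union [symmetric])
    show "disjoint_family_on (\<lambda>A. {E. A \<in> connected_components V E}) {A. A \<subseteq> V \<and> v \<in> A}"
      unfolding disjoint_family_on_def
      using connected_components_disjoint[of _ V] by (intro ballI impI equalityI) blast+
  qed (use assms in auto)
  also have "(\<Union>A\<in>{A. A \<subseteq> V \<and> v \<in> A}. {E. A \<in> connected_components V E}) = UNIV"
  proof -
    have "\<exists>A. A \<subseteq> V \<and> v \<in> A \<and> A \<in> connected_components V E" for E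
    proof -
      have "v \<in> \<Union> (connected_components V E)"
        using assms(2) unfolding Union_connected_components .
      then obtain A where "v \<in> A" "A \<in> connected_components V E" by (rule UnionE)
      then show ?thesis using connected_components_subset[of A V E] by (intro exI[of _ A] conjI)
    qed
    then show ?thesis by auto
  qed
  finally show ?thesis by simp
qed

text \<open>By induction on the cardinality: the law of total probability for the component of a fixed vertex
  determines the probability for \<open>A\<close> from those for smaller sets.\<close>

lemma prob_connected_card:
  fixes A :: "nat set"
  assumes "finite A" "A \<noteq> {}" "0 \<le> p" "p \<le> 1"
  shows "measure_pmf.prob (random_subset (all_edges A) p) {E. A \<in> connected_components A E} = connected_prob p (card A)"
  using assms(1,2)
proof (induction "card A" arbitrary: A rule: less_induct)
  case less
  define c where "c = (\<lambda>A :: nat set. measure_pmf.prob (random_subset (all_edges A) p) {E. A \<in> connected_components A E})"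
  \<comment> \<open>The value 0 at \<open>k = n\<close> drops the unknown term of \<open>V\<close>
    itself, so the sum may run over all sets containing \<open>v\<close> and depends on
    \<open>n\<close> only.\<close>
  define g where "g = (\<lambda>n k. (if k = n then 0 else connected_prob p k * (1 - p) ^ (k * (n - k))))"
  have key: "c V = 1 - (\<Sum>k=1..n. real ((n - 1) choose (k - 1)) * g n k)"
    if V: "finite V" "V \<noteq> {}" "card V = n"
      and IH: "\<And>B. B \<subset> V \<Longrightarrow> B \<noteq> {} \<Longrightarrow> c B = connected_prob p (card B)" for V n
  proof -
    obtain v where v: "v \<in> V" using V by auto
    have "1 = (\<Sum>A | A \<subseteq> V \<and> v \<in> A. c A * (1 - p) ^ (card A * (card V - card A)))"
      using sum_prob_component_containing[OF V(1) v assms(3,4)] by (simp add: c_def)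
    also have "\<dots> = c V + (\<Sum>A\<in>{A. A \<subseteq> V \<and> v \<in> A} - {V}. c A * (1 - p) ^ (card A * (card V - card A)))"
      using V v by (subst sum.remove[of _ V]) auto
    also have "(\<Sum>A\<in>{A. A \<subseteq> V \<and> v \<in> A} - {V}. c A * (1 - p) ^ (card A * (card V - card A))) =
        (\<Sum>A\<in>{A. A \<subseteq> V \<and> v \<in> A} - {V}. g n (card A))"
    proof (intro sum.cong refl)
      fix A assume A: "A \<in> {A. A \<subseteq> V \<and> v \<in> A} - {V}"
      then have "A \<subset> V" "A \<noteq> {}" by auto
      moreover from this have "card A < card V" using V psubset_card_mono by blast
      ultimately show "c A * (1 - p) ^ (card A * (card V - card A)) = g n (card A)"
        using IH[of A] V by (simp add: g_def)
    qed
    also have "\<dots> = (\<Sum>A | A \<subseteq> V \<and> v \<in> A. g n (card A))"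
      using V v by (subst (2) sum.remove[of _ V]) (auto simp: g_def)
    also have "\<dots> = (\<Sum>k=1..n. real ((n - 1) choose (k - 1)) * g n k)"
      using sum_card_subsets_containing[OF V(1) v, of "g n"] V by simp
    finally show ?thesis by simp
  qed
  have sub: "c B = connected_prob p (card B)" if "B \<subset> V" "B \<noteq> {}" "finite V" "card V = card A" for B V
  proof -
    have "card B < card A" using psubset_card_mono[OF that(3,1)] that(4) by simp
    moreover have "finite B" using that finite_subset by blast
    ultimately show ?thesis using less(1)[of B] that(2) by (simp add: c_def)
  qed
  \<comment> \<open>\<open>key\<close> for \<open>A\<close> and for \<open>{1..card A}\<close> has
    the same right-hand side, so no graph isomorphism has to be transported.\<close>
  have "{1..card A} \<noteq> {}" using less.prems by (auto simp: card_gt_0_iff Suc_le_eq)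
  then have "c {1..card A} = c A"
    using key[of A "card A"] key[of "{1..card A}" "card A"] sub[of _ A] sub[of _ "{1..card A}"] less.prems by auto
  then show ?case by (simp add: c_def connected_prob_def)
qed

text \<open>The probability that the component of a fixed vertex of the random graph on \<open>n\<close> vertices has size \<open>k\<close>.\<close>

definition comp_size_prob :: "real \<Rightarrow> nat \<Rightarrow> nat \<Rightarrow> real" where
  "comp_size_prob p n k = real ((n - 1) choose (k - 1)) * connected_prob p k * (1 - p) ^ (k * (n - k))"

lemma comp_size_prob_nonneg: "p \<le> 1 \<Longrightarrow> comp_size_prob p n k \<ge> 0"
  by (simp add: comp_size_prob_def connected_prob_def)

lemma sum_comp_size_prob:
  assumes "n \<ge> 1" "0 \<le> p" "p \<le> 1"
  shows "(\<Sum>k=1..n. comp_size_prob p n k) = 1"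
proof -
  have "1 = (\<Sum>A | A \<subseteq> {1..n} \<and> 1 \<in> A. measure_pmf.prob (random_subset (all_edges A) p) {E. A \<in> connected_components A E}
            * (1 - p) ^ (card A * (card {1..n} - card A)))"
    using assms by (intro sum_prob_component_containing [symmetric]) auto
  also have "\<dots> = (\<Sum>A | A \<subseteq> {1..n} \<and> 1 \<in> A. connected_prob p (card A) * (1 - p) ^ (card A * (n - card A)))"
    using assms by (intro sum.cong refl, subst prob_connected_card) (auto intro: finite_subset)
  also have "\<dots> = (\<Sum>k=1..n. comp_size_prob p n k)"
    using sum_card_subsets_containing[of "{1..n}" 1 "\<lambda>k. connected_prob p k * (1 - p) ^ (k * (n - k))"] assms
    by (simp add: comp_size_prob_def mult.assoc)
  finally show ?thesis by simp
qed

text \<open>Size bias: a component with \<open>k\<close> vertices contains the fixed vertex with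
  probability \<open>k / n\<close> by symmetry, so this product is the expected number of components
  of size \<open>k\<close>.\<close>

lemma comp_size_prob_altdef:
  assumes "1 \<le> k" "k \<le> n"
  shows "real n / real k * comp_size_prob p n k = real (n choose k) * (connected_prob p k * (1 - p) ^ (k * (n - k)))"
proof -
  have "k * (n choose k) = n * ((n - 1) choose (k - 1))"
    using assms times_binomial_minus1_eq[of k n] by simp
  then have "real k * real (n choose k) = real n * real ((n - 1) choose (k - 1))"
    by (metis of_nat_mult)
  then show ?thesis using assms by (simp add: comp_size_prob_def field_simps)
qed

lemma sum_subsets_comp_size_prob:
  fixes f :: "nat \<Rightarrow> real"  and V :: "nat set"
  assumes "finite V" "0 \<notin> S"
  shows "(\<Sum>A | A \<subseteq> V \<and> card A \<in> S. connected_prob p (card A) * (1 - p) ^ (card A * (card V - card A)) * f (card A))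
    = (\<Sum>k\<in>S \<inter> {1..card V}. real (card V) / real k * comp_size_prob p (card V) k * f k)"
proof -
  define g where "g = (\<lambda>k. if k \<in> S then connected_prob p k * (1 - p) ^ (k * (card V - k)) * f k else 0)"
  have "(\<Sum>A | A \<subseteq> V \<and> card A \<in> S. connected_prob p (card A) * (1 - p) ^ (card A * (card V - card A)) * f (card A))
     = (\<Sum>A\<in>Pow V. g (card A))"
    unfolding g_def using assms(1) by (intro sum.mono_neutral_cong_left) auto
  also have "\<dots> = (\<Sum>k\<le>card V. real (card V choose k) * g k)"
    by (rule sum_card_subsets[OF assms(1)])
  also have "\<dots> = (\<Sum>k\<in>S \<inter> {1..card V}. real (card V) / real k * comp_size_prob p (card V) k * f k)"
  proof (intro sum.mono_neutral_cong_right ballI)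
    fix k assume "k \<in> {..card V} - S \<inter> {1..card V}"
    then show "real (card V choose k) * g k = 0" using assms(2) by (cases "k = 0") (auto simp: g_def)
  next
    fix k assume "k \<in> S \<inter> {1..card V}"
    then show "real (card V choose k) * g k = real (card V) / real k * comp_size_prob p (card V) k * f k"
      using comp_size_prob_altdef[of k "card V" p] by (simp add: g_def)
  qed auto
  finally show ?thesis .
qed

section \<open>Moments of the number of components with given sizes\<close>

definition num_components :: "nat set \<Rightarrow> 'a set \<Rightarrow> 'a set set \<Rightarrow> nat" where
  "num_components S V E = card {A \<in> connected_components V E. card A \<in> S}"

lemma expectation_num_components:
  fixes V :: "nat set"
  assumes "finite V" "0 \<notin> S" "0 \<le> p" "p \<le> 1"
  shows "measure_pmf.expectation (random_subset (all_edges V) p) (\<lambda>E. real (num_components S V E))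
    = (\<Sum>k\<in>S \<inter> {1..card V}. real (card V) / real k * comp_size_prob p (card V) k)"
proof -
  let ?M = "random_subset (all_edges V) p"
  let ?F = "{A. A \<subseteq> V \<and> card A \<in> S}"
  have int: "integrable ?M f" for f :: "_ \<Rightarrow> real"
    using finite_set_pmf_random_subset[OF finite_all_edges[OF assms(1)]] by (rule integrable_measure_pmf_finite)
  have finF: "finite ?F" using assms(1) by simp
  have "real (num_components S V E) = (\<Sum>A\<in>?F. indicator {E. A \<in> connected_components V E} E)" for E
  proof -
    have "{A \<in> connected_components V E. card A \<in> S} = {A\<in>?F. A \<in> connected_components V E}"
      using connected_components_subset[of _ V E] by auto
    then show ?thesis
      using finF unfolding num_components_def
      by (simp add: indicator_def of_bool_def sum.If_cases Int_def)
  qed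
  then have "measure_pmf.expectation ?M (\<lambda>E. real (num_components S V E)) =
      (\<Sum>A\<in>?F. measure_pmf.prob ?M {E. A \<in> connected_components V E})"
    by (simp add: int)
  also have "\<dots> = (\<Sum>A\<in>?F. connected_prob p (card A) * (1 - p) ^ (card A * (card V - card A)) * 1)"
  proof (intro sum.cong refl)
    fix A assume A: "A \<in> ?F"
    have ne: "A \<noteq> {}" using A assms(2) by auto
    have V: "A \<union> (V - A) = V" and c: "card (V - A) = card V - card A" and f: "finite A"
      using A assms(1) by (auto simp: card_Diff_subset finite_subset)
    from prob_component_split[OF f _ _ ne assms(3,4), of "V - A" "\<lambda>_. True"] prob_connected_card[OF f ne assms(3,4)]
    show "measure_pmf.prob ?M {E. A \<in> connected_components V E} = connected_prob p (card A) * (1 - p) ^ (card A * (card V - card A)) * 1"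
      using assms(1) unfolding V c by auto
  qed
  also have "\<dots> = (\<Sum>k\<in>S \<inter> {1..card V}. real (card V) / real k * comp_size_prob p (card V) k * 1)"
    by (rule sum_subsets_comp_size_prob[OF assms(1,2)])
  finally show ?thesis by simp
qed

text \<open>The integrand counts ordered pairs of distinct components. Given that \<open>A\<close>
  is one of them, the graph on the remaining vertices is again random with the same
  \<open>p\<close>, so the inner sum is the first moment formula on \<open>card V - k\<close>
  vertices.\<close>

lemma expectation_num_component_pairs:
  fixes V :: "nat set"
  assumes "finite V" "0 \<notin> S" "0 \<le> p" "p \<le> 1"
  shows "measure_pmf.expectation (random_subset (all_edges V) p)
      (\<lambda>E. real (num_components S V E) * (real (num_components S V E) - 1))
    = (\<Sum>k\<in>S \<inter> {1..card V}. real (card V) / real k * comp_size_prob p (card V) k *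
        (\<Sum>l\<in>S \<inter> {1..card V - k}. real (card V - k) / real l * comp_size_prob p (card V - k) l))"
proof -
  let ?M = "random_subset (all_edges V) p"
  let ?F = "{A. A \<subseteq> V \<and> card A \<in> S}"
  have int: "integrable ?M f" for f :: "_ \<Rightarrow> real"
    using finite_set_pmf_random_subset[OF finite_all_edges[OF assms(1)]] by (rule integrable_measure_pmf_finite)
  have finF: "finite ?F" using assms(1) by simp
  have eq: "real (num_components S V E) * (real (num_components S V E) - 1) =
     (\<Sum>A\<in>?F. indicator {E. A \<in> connected_components V E} E * real (card {B \<in> connected_components V E - {A}. card B \<in> S}))" for E
  proof -
    let ?K = "{A \<in> connected_components V E. card A \<in> S}"
    have finK: "finite ?K" using finite_connected_components[OF assms(1)] by auto
    have K: "?K = {A\<in>?F. A \<in> connected_components V E}"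
      using connected_components_subset[of _ V E] by auto
    have "(\<Sum>A\<in>?F. indicator {E. A \<in> connected_components V E} E * real (card {B \<in> connected_components V E - {A}. card B \<in> S}))
      = (\<Sum>A\<in>?K. real (card (?K - {A})))"
    proof (intro sum.mono_neutral_cong_right ballI)
      fix A assume "A \<in> ?K"
      show "indicator {E. A \<in> connected_components V E} E * real (card {B \<in> connected_components V E - {A}. card B \<in> S}) = real (card (?K - {A}))"
      proof -
        have "{B \<in> connected_components V E - {A}. card B \<in> S} = ?K - {A}" by auto
        then show ?thesis using \<open>A \<in> ?K\<close> by simp
      qed
    qed (use finF K in auto)
    also have "\<dots> = (\<Sum>A\<in>?K. real (card ?K) - 1)"
    proof (intro sum.cong refl)
      fix A assume A: "A \<in> ?K"
      then have "card ?K > 0" using finK card_gt_0_iff by blast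
      then show "real (card (?K - {A})) = real (card ?K) - 1"
        using A by (subst card_Diff_singleton) (auto simp: of_nat_diff)
    qed
    finally show ?thesis by (simp add: num_components_def)
  qed
  have pairs: "measure_pmf.expectation ?M (\<lambda>E. indicator {E. A \<in> connected_components V E} E * real (card {B \<in> connected_components V E - {A}. card B \<in> S}))
     = connected_prob p (card A) * (1 - p) ^ (card A * (card V - card A)) *
        (\<Sum>l\<in>S \<inter> {1..card V - card A}. real (card V - card A) / real l * comp_size_prob p (card V - card A) l)"
    if A: "A \<in> ?F" for A
  proof -
    have ne: "A \<noteq> {}" using A assms(2) by auto
    have V: "A \<union> (V - A) = V" and c: "card (V - A) = card V - card A" and f: "finite A" "finite (V - A)"
      using A assms(1) by (auto simp: card_Diff_subset finite_subset)
    let ?G = "{B. B \<subseteq> V - A \<and> card B \<in> S}"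
    let ?q = "connected_prob p (card A) * (1 - p) ^ (card A * (card V - card A))"
    let ?N = "random_subset (all_edges (V - A)) p"
    have finG: "finite ?G" using f by simp
    have intN: "integrable ?N f" for f :: "_ \<Rightarrow> real"
      using finite_set_pmf_random_subset[OF finite_all_edges[OF f(2)]] by (rule integrable_measure_pmf_finite)
    have "indicator {E. A \<in> connected_components V E} E * real (card {B \<in> connected_components V E - {A}. card B \<in> S})
       = (\<Sum>B\<in>?G. indicator {E. A \<in> connected_components V E \<and> B \<in> connected_components V E - {A}} E)" for E
    proof (cases "A \<in> connected_components V E")
      case True
      have "{B \<in> connected_components V E - {A}. card B \<in> S} = {B\<in>?G. B \<in> connected_components V E - {A}}"
        using connected_components_subset[of _ V E] connected_components_disjoint[OF True] by blast
      then show ?thesis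
        using finG True by (simp add: indicator_def of_bool_def sum.If_cases Int_def)
    qed simp
    then have "measure_pmf.expectation ?M (\<lambda>E. indicator {E. A \<in> connected_components V E} E * real (card {B \<in> connected_components V E - {A}. card B \<in> S}))
      = (\<Sum>B\<in>?G. measure_pmf.prob ?M {E. A \<in> connected_components V E \<and> B \<in> connected_components V E - {A}})"
      by (simp add: int)
    also have "\<dots> = (\<Sum>B\<in>?G. ?q * measure_pmf.prob ?N {E. B \<in> connected_components (V - A) E})"
      using prob_component_split[OF f _ ne assms(3,4), of "\<lambda>C. B \<in> C" for B] prob_connected_card[OF f(1) ne assms(3,4)]
      unfolding V c by (intro sum.cong refl) auto
    also have "\<dots> = ?q * measure_pmf.expectation ?N (\<lambda>E. real (num_components S (V - A) E))"
    proof -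
      have "real (num_components S (V - A) E) = (\<Sum>B\<in>?G. indicator {E. B \<in> connected_components (V - A) E} E)" for E
      proof -
        have "{B \<in> connected_components (V - A) E. card B \<in> S} = {B\<in>?G. B \<in> connected_components (V - A) E}"
          using connected_components_subset[of _ "V - A" E] by auto
        then show ?thesis
          using finG unfolding num_components_def
          by (simp add: indicator_def of_bool_def sum.If_cases Int_def)
      qed
      then show ?thesis by (simp add: intN sum_distrib_left)
    qed
    finally show ?thesis
      using expectation_num_components[OF f(2) assms(2-4)] c by simp
  qed
  have "measure_pmf.expectation ?M (\<lambda>E. real (num_components S V E) * (real (num_components S V E) - 1)) =
     (\<Sum>A\<in>?F. connected_prob p (card A) * (1 - p) ^ (card A * (card V - card A)) *
        (\<Sum>l\<in>S \<inter> {1..card V - card A}. real (card V - card A) / real l * comp_size_prob p (card V - card A) l))"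
    unfolding eq using pairs by (simp add: int)
  also have "\<dots> = (\<Sum>k\<in>S \<inter> {1..card V}. real (card V) / real k * comp_size_prob p (card V) k *
        (\<Sum>l\<in>S \<inter> {1..card V - k}. real (card V - k) / real l * comp_size_prob p (card V - k) l))"
    by (rule sum_subsets_comp_size_prob[OF assms(1,2)])
  finally show ?thesis .
qed

text \<open>Both sides vanish if there is exactly one component with more than \<open>d\<close> vertices, or none.\<close>

lemma max_component_size_in_indicator:
  assumes "finite V" "V \<noteq> {}" "T \<subseteq> {d<..}"
  shows "\<bar>indicator {E. max_component_size V E \<in> T} E - real (num_components T V E)\<bar>
    \<le> real (num_components {d<..} V E) * (real (num_components {d<..} V E) - 1)"
proof -
  let ?C = "connected_components V E"
  let ?KT = "{A \<in> ?C. card A \<in> T}" and ?K = "{A \<in> ?C. card A \<in> {d<..}}"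
  have fin: "finite ?C" by (rule finite_connected_components[OF assms(1)])
  have ne: "?C \<noteq> {}" using Union_connected_components[of V E] assms(2) by auto
  have "Max (card ` ?C) \<in> card ` ?C" using fin ne by (intro Max_in) auto
  then obtain A where A: "A \<in> ?C" "card A = max_component_size V E"
    unfolding max_component_size_def by (metis imageE)
  have le: "card B \<le> card A" if "B \<in> ?C" for B
    unfolding A(2) max_component_size_def using that fin by (intro Max_ge) auto
  have sub: "?KT \<subseteq> ?K" using assms(3) by auto
  have cardle: "card ?KT \<le> card ?K" using sub fin by (intro card_mono) auto
  consider "card ?K = 0" | "card ?K = 1" | "card ?K \<ge> 2" by linarith
  then show ?thesis
  proof cases
    case 1
    then have "?K = {}" using fin by auto
    then have "A \<notin> ?K" by blast
    then have "max_component_size V E \<notin> T" using A assms(3) by auto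
    then show ?thesis using 1 cardle by (simp add: num_components_def)
  next
    case 2
    then obtain B where B: "?K = {B}" using card_1_singletonE by blast
    have BK: "B \<in> ?K" unfolding B by simp
    have "card B \<le> card A" using le BK by blast
    then have "A \<in> ?K" using BK A(1) by simp
    then have KA: "?K = {A}" using B by auto
    have KT: "?KT = (if card A \<in> T then {A} else {})"
      using sub KA by auto
    have "real (num_components T V E) = indicator {E. max_component_size V E \<in> T} E"
      unfolding num_components_def KT A(2) by simp
    then show ?thesis using 2 by (simp add: num_components_def)
  next
    case 3
    let ?k = "real (card ?K)"
    have "\<bar>indicator {E. max_component_size V E \<in> T} E - real (card ?KT)\<bar> \<le> max 1 (real (card ?KT))"
      by (auto simp: indicator_def)
    also have "\<dots> \<le> ?k" using 3 cardle by auto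
    also have "\<dots> \<le> ?k * (?k - 1)" using 3 mult_left_mono[of 1 "?k - 1" ?k] by simp
    finally show ?thesis by (simp add: num_components_def)
  qed
qed

text \<open>Integrating \<open>max_component_size_in_indicator\<close> replaces the maximum, which
  is not additive, by an expected count; the price is the second factorial moment of the number of
  components larger than \<open>d\<close>.\<close>

lemma prob_max_component_size_approx:
  assumes "n \<ge> 1" "T \<subseteq> {d<..}" "0 \<le> p" "p \<le> 1"
  shows "\<bar>measure_pmf.prob (erdos_renyi n p) {E. max_component_size {1..n} E \<in> T} -
      (\<Sum>k\<in>T \<inter> {1..n}. real n / real k * comp_size_prob p n k)\<bar>
    \<le> (\<Sum>k\<in>{d<..n}. real n / real k * comp_size_prob p n k *
        (\<Sum>l\<in>{d<..n - k}. real (n - k) / real l * comp_size_prob p (n - k) l))"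
proof -
  let ?V = "{1..n}" and ?S = "{d<..}"
  have ER: "erdos_renyi n p = random_subset (all_edges ?V) p"
    by (simp add: erdos_renyi_def random_subset_def)
  let ?M = "random_subset (all_edges ?V) p"
  have int: "integrable ?M f" for f :: "_ \<Rightarrow> real"
    using finite_set_pmf_random_subset[OF finite_all_edges] by (rule integrable_measure_pmf_finite) simp
  have 1: "(\<Sum>k\<in>T \<inter> {1..n}. real n / real k * comp_size_prob p n k) = measure_pmf.expectation ?M (\<lambda>E. real (num_components T ?V E))"
  proof -
    have "0 \<notin> T" using assms(2) by auto
    then show ?thesis using expectation_num_components[of ?V T p] assms(3,4) by simp
  qed
  have "\<bar>measure_pmf.prob ?M {E. max_component_size ?V E \<in> T} - measure_pmf.expectation ?M (\<lambda>E. real (num_components T ?V E))\<bar>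
     = \<bar>measure_pmf.expectation ?M (\<lambda>E. indicator {E. max_component_size ?V E \<in> T} E - real (num_components T ?V E))\<bar>"
    by (subst Bochner_Integration.integral_diff[OF int int]) simp
  also have "\<dots> \<le> measure_pmf.expectation ?M (\<lambda>E. \<bar>indicator {E. max_component_size ?V E \<in> T} E - real (num_components T ?V E)\<bar>)"
    by (rule integral_abs_bound)
  also have "\<dots> \<le> measure_pmf.expectation ?M (\<lambda>E. real (num_components ?S ?V E) * (real (num_components ?S ?V E) - 1))"
    using assms by (intro integral_mono int max_component_size_in_indicator) auto
  also have "\<dots> = (\<Sum>k\<in>?S \<inter> {1..n}. real n / real k * comp_size_prob p n k *
        (\<Sum>l\<in>?S \<inter> {1..n - k}. real (n - k) / real l * comp_size_prob p (n - k) l))"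
    using expectation_num_component_pairs[of ?V ?S p] assms by auto
  finally have *: "\<bar>measure_pmf.prob ?M {E. max_component_size ?V E \<in> T} - measure_pmf.expectation ?M (\<lambda>E. real (num_components T ?V E))\<bar> \<le> (\<Sum>k\<in>?S \<inter> {1..n}. real n / real k * comp_size_prob p n k *
        (\<Sum>l\<in>?S \<inter> {1..n - k}. real (n - k) / real l * comp_size_prob p (n - k) l))" .
  have "?S \<inter> {1..m} = {d<..m}" for m by auto
  with * show ?thesis unfolding ER 1 by simp
qed

section \<open>The change of measure\<close>

text \<open>The likelihood ratio of the component size on \<open>n - m\<close> vertices with respect to \<open>n\<close> vertices.\<close>

definition tilt :: "real \<Rightarrow> nat \<Rightarrow> nat \<Rightarrow> nat \<Rightarrow> real" where
  "tilt p n m k = real ((n - m - 1) choose (k - 1)) / real ((n - 1) choose (k - 1)) / (1 - p) ^ (m * k)"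

lemma tilt_nonneg: "p \<le> 1 \<Longrightarrow> tilt p n m k \<ge> 0"
  by (simp add: tilt_def)

text \<open>\<open>connected_prob p k\<close> cancels in the quotient, and
  \<open>k * (n - k) = k * (n - m - k) + m * k\<close> leaves the power of \<open>1 - p\<close>. For
  \<open>k > n - m\<close> the upper binomial coefficient is 0, which accounts for the missing
  mass.\<close>

lemma comp_size_prob_tilt:
  assumes "p < 1" "m < n" "1 \<le> k" "k \<le> n"
  shows "comp_size_prob p n k * tilt p n m k = (if k \<le> n - m then comp_size_prob p (n - m) k else 0)"
proof (cases "k \<le> n - m")
  case True
  have "k * (n - k) = k * (n - m - k) + m * k"
  proof -
    have "n - k = (n - m - k) + m" using True assms by simp
    then show ?thesis by (metis distrib_left mult.commute)
  qed
  moreover have "(n - 1) choose (k - 1) > 0" using assms by (intro zero_less_binomial) auto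
  ultimately show ?thesis
    using True assms(1) by (simp add: comp_size_prob_def tilt_def power_add field_simps)
next
  case False
  then have "(n - m - 1) choose (k - 1) = 0" using assms by (intro binomial_eq_0) auto
  then show ?thesis using False by (simp add: tilt_def)
qed

lemma sum_comp_size_prob_tilt:
  assumes "0 \<le> p" "p < 1" "m < n"
  shows "(\<Sum>k=1..n. comp_size_prob p n k * tilt p n m k) = 1"
proof -
  have "(\<Sum>k=1..n. comp_size_prob p n k * tilt p n m k) = (\<Sum>k=1..n. if k \<le> n - m then comp_size_prob p (n - m) k else 0)"
    using assms by (intro sum.cong refl comp_size_prob_tilt) auto
  also have "\<dots> = (\<Sum>k=1..n - m. comp_size_prob p (n - m) k)"
    by (intro sum.mono_neutral_cong_right) auto
  also have "\<dots> = 1" using assms by (intro sum_comp_size_prob) auto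
  finally show ?thesis .
qed

text \<open>This form with \<open>k - 1\<close> factors serves for \<open>k\<close> up to a small
  fraction of \<open>n\<close> or for \<open>m\<close> proportional to \<open>n\<close>; the form
  with \<open>m\<close> factors below serves for bounded \<open>m\<close> and for \<open>m\<close>
  of order \<open>sqrt n\<close>.\<close>

lemma binomial_ratio_prod:
  assumes "m < n" "1 \<le> k" "k \<le> n"
  shows "real ((n - m - 1) choose (k - 1)) / real ((n - 1) choose (k - 1)) =
    (\<Prod>i<k - 1. (real n - real m - 1 - real i) / (real n - 1 - real i))"
proof -
  have "real (n - m - 1) = real n - real m - 1" "real (n - 1) = real n - 1" using assms by auto
  then have "real ((n - m - 1) choose (k - 1)) = (\<Prod>i<k - 1. real n - real m - 1 - real i) / fact (k - 1)"
    and "real ((n - 1) choose (k - 1)) = (\<Prod>i<k - 1. real n - 1 - real i) / fact (k - 1)"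
    by (simp_all only: binomial_gbinomial gbinomial_prod_rev atLeast0LessThan)
  then show ?thesis by (simp add: prod_dividef)
qed

lemma binomial_ratio_prod':
  assumes "m < n" "1 \<le> k" "k \<le> n"
  shows "real ((n - m - 1) choose (k - 1)) / real ((n - 1) choose (k - 1)) =
    (\<Prod>i<m. (real n - real k - real i) / (real n - 1 - real i))"
  using assms(1)
proof (induction m)
  case 0
  have "(n - 1) choose (k - 1) > 0" using assms by (intro zero_less_binomial) auto
  then show ?case by simp
next
  case (Suc m)
  define N where "N = n - m - 1"
  have N: "N > 0" "n - Suc m - 1 = N - 1" "real N = real n - 1 - real m" using Suc.prems by (auto simp: N_def of_nat_diff)
  have "(N - (k - 1)) * (N choose (k - 1)) = N * ((N - 1) choose (k - 1))"
    using binomial_absorb_comp by simp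
  then have e: "real (N - (k - 1)) * real (N choose (k - 1)) = real N * real ((N - 1) choose (k - 1))"
    by (metis of_nat_mult)
  have "real ((N - 1) choose (k - 1)) = real (N choose (k - 1)) * ((real n - real k - real m) / real N)"
  proof (cases "k - 1 \<le> N")
    case True
    then have "real (N - (k - 1)) = real n - real k - real m" using assms N(3) by (simp add: of_nat_diff)
    then show ?thesis using e N(1) by (simp only:) (simp add: eq_divide_eq mult_ac)
  next
    case False
    then show ?thesis by (simp add: binomial_eq_0)
  qed
  then have "real ((n - Suc m - 1) choose (k - 1)) / real ((n - 1) choose (k - 1)) =
     real ((n - m - 1) choose (k - 1)) / real ((n - 1) choose (k - 1)) * ((real n - real k - real m) / (real n - 1 - real m))"
    unfolding N(2) N(3) by (simp add: N_def)
  then show ?case using Suc.IH[OF Suc_lessD[OF Suc.prems]] by (simp only: prod.lessThan_Suc)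
qed

lemma sum_quadratic_combination:
  fixes w f g :: "'a \<Rightarrow> real"
  shows "(\<Sum>k\<in>A. w k * (a * f k + b - 2 * (c * g k) + 1)) =
    a * (\<Sum>k\<in>A. w k * f k) + b * (\<Sum>k\<in>A. w k) - 2 * c * (\<Sum>k\<in>A. w k * g k) + (\<Sum>k\<in>A. w k)"
  by (induction A rule: infinite_finite_induct) (auto simp: algebra_simps)

section \<open>Concentration of \<open>h\<close> at the component fraction, and the solutions of
  \<open>h x = 1\<close>\<close>

locale supercritical =
  fixes t :: real
  assumes t_gt_1: "t > 1"
begin

abbreviation \<theta> :: real where "\<theta> \<equiv> theta t"

text \<open>For \<open>x < 1\<close> this is \<open>exp (- phi t x)\<close>; unlike
  \<open>phi t\<close> it extends continuously to \<open>x = 1\<close>.\<close>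

definition h :: "real \<Rightarrow> real" where
  "h x = exp (t * x) * (1 - x)"

definition mu :: "nat \<Rightarrow> nat \<Rightarrow> real" where
  "mu n k = comp_size_prob (edge_prob t n) n k"

abbreviation G :: "nat \<Rightarrow> nat \<Rightarrow> nat \<Rightarrow> real" where
  "G n m k \<equiv> tilt (edge_prob t n) n m k"

lemma theta_pos: "0 < \<theta>" and theta_less_1: "\<theta> < 1" and h_theta: "h \<theta> = 1" and theta_gt: "1 - 1 / t < \<theta>"
  using theta_props[OF t_gt_1] theta_aux(2)[OF t_gt_1] by (auto simp: h_def)

lemma edge_prob: "0 \<le> edge_prob t n" "edge_prob t n < 1"
  using edge_prob_in_unit[of t n] t_gt_1 by (auto simp: edge_prob_def)

lemma mu_nonneg: "mu n k \<ge> 0"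
  unfolding mu_def using edge_prob[of n] by (intro comp_size_prob_nonneg) auto

lemma G_nonneg: "G n m k \<ge> 0"
  using edge_prob[of n] by (intro tilt_nonneg) auto

lemma sum_mu: "n \<ge> 1 \<Longrightarrow> (\<Sum>k=1..n. mu n k) = 1"
  unfolding mu_def using edge_prob[of n] by (intro sum_comp_size_prob) auto

lemma sum_mu_le_1:
  assumes "A \<subseteq> {1..n}" shows "(\<Sum>k\<in>A. mu n k) \<le> 1"
proof (cases "n \<ge> 1")
  case True
  have "(\<Sum>k\<in>A. mu n k) \<le> (\<Sum>k=1..n. mu n k)" using assms mu_nonneg by (intro sum_mono2) auto
  then show ?thesis using sum_mu[OF True] by simp
qed (use assms in auto)

lemma sum_mu_G: "m < n \<Longrightarrow> (\<Sum>k=1..n. mu n k * G n m k) = 1"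
  unfolding mu_def using edge_prob[of n] by (intro sum_comp_size_prob_tilt) auto

lemma sum_mu_G_le_1:
  assumes "A \<subseteq> {1..n}" "m < n" shows "(\<Sum>k\<in>A. mu n k * G n m k) \<le> 1"
proof -
  have "(\<Sum>k\<in>A. mu n k * G n m k) \<le> (\<Sum>k=1..n. mu n k * G n m k)"
    using assms mu_nonneg G_nonneg by (intro sum_mono2) auto
  then show ?thesis using sum_mu_G[OF assms(2)] by simp
qed

lemma one_minus_edge_prob_power: "1 / (1 - edge_prob t n) ^ j = exp (t * real j / real n)"
proof -
  have "(1 - edge_prob t n) ^ j = exp (- (t * real j / real n))"
    by (simp add: edge_prob_def exp_of_nat_mult [symmetric] mult_ac)
  then show ?thesis by (simp add: exp_minus divide_inverse)
qed

lemma G_eq_prod: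
  assumes "m < n" "1 \<le> k" "k \<le> n"
  shows "G n m k = exp (t * real m * real k / real n) * (\<Prod>i<k - 1. (real n - real m - 1 - real i) / (real n - 1 - real i))"
  using binomial_ratio_prod[OF assms] one_minus_edge_prob_power[of n "m * k"]
  by (simp add: tilt_def mult.assoc divide_inverse mult.commute)

lemma G_eq_prod':
  assumes "m < n" "1 \<le> k" "k \<le> n"
  shows "G n m k = exp (t * real m * real k / real n) * (\<Prod>i<m. (real n - real k - real i) / (real n - 1 - real i))"
  using binomial_ratio_prod'[OF assms] one_minus_edge_prob_power[of n "m * k"]
  by (simp add: tilt_def mult.assoc divide_inverse mult.commute)

lemma G_eq_0: "m < n \<Longrightarrow> 1 \<le> k \<Longrightarrow> k > n - m \<Longrightarrow> G n m k = 0"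
  by (simp add: tilt_def binomial_eq_0)

text \<open>With \<open>X = k / n\<close>, the tilt for \<open>m = 1\<close> is exactly
  \<open>n / (n - 1) * h X\<close>, and the tilt for \<open>m = 2\<close> is
  \<open>(h X)\<^sup>2\<close> up to errors of order \<open>1 / n\<close>. Both have mean 1, so
  expanding \<open>(h X - 1)\<^sup>2\<close> leaves only those errors.\<close>

lemma sum_mu_h_square:
  assumes "n \<ge> 3"
  shows "(\<Sum>k=1..n. mu n k * (h (real k / real n) - 1)\<^sup>2) \<le> exp (2 * t) / real n"
proof -
  have n: "real n \<ge> 3" using assms by simp
  have 1: "h (real k / real n) = (real n - 1) / real n * G n 1 k" if "k \<in> {1..n}" for k
    using G_eq_prod'[of 1 n k] that n assms by (simp add: h_def field_simps)
  have 2: "(h (real k / real n))\<^sup>2 \<le> (real n - 1) * (real n - 2) / (real n)\<^sup>2 * G n 2 k + exp (2 * t) / real n"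
    if "k \<in> {1..n}" for k
  proof -
    define E where "E = exp (t * 2 * real k / real n)"
    have E: "(exp (t * (real k / real n)))\<^sup>2 = E" by (simp add: E_def exp_double [symmetric] mult_ac)
    have EE: "E \<le> exp (2 * t)" using that t_gt_1 n unfolding E_def by (simp add: field_simps)
    have "G n 2 k = E * ((real n - real k) / (real n - 1) * ((real n - real k - 1) / (real n - 2)))"
      using G_eq_prod'[of 2 n k] that assms by (simp add: E_def numeral_2_eq_2 algebra_simps)
    then have F1: "(real n - 1) * (real n - 2) / (real n)\<^sup>2 * G n 2 k = E * (real n - real k) * (real n - real k - 1) / (real n)\<^sup>2"
      using n by simp
    have F2: "(h (real k / real n))\<^sup>2 = E * (1 - real k / real n)\<^sup>2"
      unfolding h_def power_mult_distrib E ..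
    have F3: "(1 - real k / real n)\<^sup>2 = (real n - real k)\<^sup>2 / (real n)\<^sup>2"
      using n by (simp add: power_divide [symmetric] diff_divide_distrib)
    \<comment> \<open>The discrepancy is \<open>(n - k)\<^sup>2\<close> against
      \<open>(n - k) * (n - k - 1)\<close>; the remaining term is at most
      \<open>exp (2 * t) / n\<close>.\<close>
    have F4: "E * ((real n - real k)\<^sup>2 / (real n)\<^sup>2) =
        E * (real n - real k) * (real n - real k - 1) / (real n)\<^sup>2 + E * (real n - real k) / (real n)\<^sup>2"
      unfolding times_divide_eq_right add_divide_distrib [symmetric]
      by (intro arg_cong2[where f = "(/)"] refl) (simp add: power2_eq_square algebra_simps)
    have "(h (real k / real n))\<^sup>2 = (real n - 1) * (real n - 2) / (real n)\<^sup>2 * G n 2 k + E * (real n - real k) / (real n)\<^sup>2"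
      unfolding F1 F2 F3 F4 ..
    moreover have "E * (real n - real k) / (real n)\<^sup>2 \<le> exp (2 * t) * real n / (real n)\<^sup>2"
      using that EE by (intro divide_right_mono mult_mono) auto
    ultimately show ?thesis using n by (simp add: power2_eq_square)
  qed
  have "(\<Sum>k=1..n. mu n k * (h (real k / real n) - 1)\<^sup>2) \<le>
    (\<Sum>k=1..n. mu n k * ((real n - 1) * (real n - 2) / (real n)\<^sup>2 * G n 2 k + exp (2 * t) / real n
        - 2 * ((real n - 1) / real n * G n 1 k) + 1))"
  proof (intro sum_mono mult_left_mono mu_nonneg)
    fix k assume k: "k \<in> {1..n}"
    have "(h (real k / real n) - 1)\<^sup>2 = (h (real k / real n))\<^sup>2 - 2 * h (real k / real n) + 1"
      by (simp add: power2_eq_square algebra_simps)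
    then show "(h (real k / real n) - 1)\<^sup>2 \<le> (real n - 1) * (real n - 2) / (real n)\<^sup>2 * G n 2 k + exp (2 * t) / real n
        - 2 * ((real n - 1) / real n * G n 1 k) + 1"
      using 1[OF k] 2[OF k] by linarith
  qed
  also have "\<dots> = (real n - 1) * (real n - 2) / (real n)\<^sup>2 * (\<Sum>k=1..n. mu n k * G n 2 k) + exp (2 * t) / real n * (\<Sum>k=1..n. mu n k)
       - 2 * ((real n - 1) / real n) * (\<Sum>k=1..n. mu n k * G n 1 k) + (\<Sum>k=1..n. mu n k)"
    by (rule sum_quadratic_combination)
  also have "\<dots> = (real n - 1) * (real n - 2) / (real n)\<^sup>2 + exp (2 * t) / real n - 2 * ((real n - 1) / real n) + 1"
  proof -
    have "(\<Sum>k=1..n. mu n k * G n 2 k) = 1" "(\<Sum>k=1..n. mu n k * G n 1 k) = 1" "(\<Sum>k=1..n. mu n k) = 1"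
      using assms by (intro sum_mu_G sum_mu; simp)+
    then show ?thesis by (simp only: mult_1_right)
  qed
  also have "\<dots> = exp (2 * t) / real n - (real n - 2) / (real n)\<^sup>2"
    using n by (simp add: field_simps power2_eq_square)
  also have "\<dots> \<le> exp (2 * t) / real n" using n by simp
  finally show ?thesis .
qed

lemma sum_mu_h_deviation:
  assumes "n \<ge> 3" "r > 0"
  shows "(\<Sum>k | k \<in> {1..n} \<and> \<bar>h (real k / real n) - 1\<bar> > r. mu n k) \<le> exp (2 * t) / (real n * r\<^sup>2)"
proof -
  let ?A = "{k. k \<in> {1..n} \<and> \<bar>h (real k / real n) - 1\<bar> > r}"
  have "r\<^sup>2 * (\<Sum>k\<in>?A. mu n k) = (\<Sum>k\<in>?A. mu n k * r\<^sup>2)"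
    by (simp add: sum_distrib_left mult.commute)
  also have "\<dots> \<le> (\<Sum>k\<in>?A. mu n k * (h (real k / real n) - 1)\<^sup>2)"
  proof (intro sum_mono mult_left_mono mu_nonneg)
    fix k assume "k \<in> ?A"
    then have "\<bar>r\<bar> \<le> \<bar>h (real k / real n) - 1\<bar>" using assms by auto
    then show "r\<^sup>2 \<le> (h (real k / real n) - 1)\<^sup>2" unfolding abs_le_square_iff .
  qed
  also have "\<dots> \<le> (\<Sum>k=1..n. mu n k * (h (real k / real n) - 1)\<^sup>2)"
    by (intro sum_mono2) (auto intro: mult_nonneg_nonneg mu_nonneg)
  also have "\<dots> \<le> exp (2 * t) / real n" by (rule sum_mu_h_square[OF assms(1)])
  finally show ?thesis using assms by (simp add: field_simps)
qed

lemma continuous_on_h: "continuous_on A h"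
  unfolding h_def by (intro continuous_intros)

lemma h_eq_1_iff:
  assumes "0 < x" "x \<le> 1" shows "h x = 1 \<longleftrightarrow> x = \<theta>"
proof
  assume "h x = 1"
  moreover from this have "x \<noteq> 1" by (auto simp: h_def)
  ultimately have "0 < x \<and> x < 1 \<and> exp (t * x) * (1 - x) = 1"
    using assms by (simp add: h_def)
  from the1_equality[OF theta_aux(1)[OF t_gt_1] this] show "x = \<theta>"
    by (simp add: theta_def)
qed (use h_theta in auto)

text \<open>As \<open>h 1 = 0\<close>, a value of at least 1 would give, by the intermediate value
  theorem, a second solution of \<open>h y = 1\<close>.\<close>

lemma h_less_1:
  assumes "\<theta> < x" "x \<le> 1" shows "h x < 1"
proof (rule ccontr)
  assume "\<not> h x < 1"
  moreover have "h 1 \<le> 1" by (simp add: h_def)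
  ultimately obtain y where "x \<le> y" "y \<le> 1" "h y = 1"
    using IVT2'[of h 1 1 x] continuous_on_h assms(2) by auto
  then show False using h_eq_1_iff[of y] assms theta_pos by auto
qed

lemma h_greater_1:
  assumes "0 < x" "x < \<theta>" shows "h x > 1"
proof (rule ccontr)
  assume "\<not> h x > 1"
  then have hx: "h x \<le> 1" by simp
  \<comment> \<open>Near 0 the estimate \<open>exp (t * y) \<ge> 1 + t * y\<close> suffices; this
    supplies the point above 1 from which the intermediate value theorem starts.\<close>
  have small: "h y > 1" if "0 < y" "y < 1 - 1 / t" for y
  proof -
    have "y * t < t - 1" using that t_gt_1 by (simp add: field_simps)
    then have "y * (t - 1 - y * t) > 0" using that by (intro mult_pos_pos) auto
    then have "1 < (1 + t * y) * (1 - y)" by (simp add: algebra_simps)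
    also have "\<dots> \<le> h y"
    proof -
      have "1 / t > 0" using t_gt_1 by simp
      then have "y < 1" using that by linarith
      then show ?thesis unfolding h_def by (intro mult_right_mono exp_ge_add_one_self) auto
    qed
    finally show ?thesis .
  qed
  define y where "y = min x ((1 - 1 / t) / 2)"
  have y: "0 < y" "y < 1 - 1 / t" "y \<le> x" using assms t_gt_1 by (auto simp: y_def min_def field_simps)
  from small[OF y(1,2)] obtain z where "y \<le> z" "z \<le> x" "h z = 1"
    using IVT2'[of h x 1 y] continuous_on_h hx y(3) by auto
  then show False using h_eq_1_iff[of z] assms y theta_less_1 by auto
qed

text \<open>The bound \<open>\<epsilon> \<le> x\<close> keeps away from 0, where \<open>h\<close> is
  1 as well. On the compact rest outside the ball about \<open>\<theta>\<close>,
  \<open>\<bar>h x - 1\<bar>\<close> attains a positive minimum.\<close>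

lemma h_close_1_imp:
  assumes "\<epsilon> > 0"
  obtains \<eta> where "\<eta> > 0" "\<And>x. \<epsilon> \<le> x \<Longrightarrow> x \<le> 1 \<Longrightarrow> \<bar>h x - 1\<bar> \<le> \<eta> \<Longrightarrow> \<bar>x - \<theta>\<bar> < \<epsilon>"
proof -
  define K where "K = {\<epsilon>..1} - ball \<theta> \<epsilon>"
  have K: "compact K" unfolding K_def by (intro compact_diff) auto
  show ?thesis
  proof (cases "K = {}")
    case True
    then have "\<bar>x - \<theta>\<bar> < \<epsilon>" if "\<epsilon> \<le> x" "x \<le> 1" for x
      using that by (auto simp: K_def dist_real_def abs_minus_commute)
    then show ?thesis using that[of 1] by auto
  next
    case False
    have "continuous_on K (\<lambda>x. \<bar>h x - 1\<bar>)" by (intro continuous_intros continuous_on_h)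
    from continuous_attains_inf[OF K False this] obtain y where y: "y \<in> K" "\<And>x. x \<in> K \<Longrightarrow> \<bar>h y - 1\<bar> \<le> \<bar>h x - 1\<bar>"
      by auto
    have "y \<noteq> \<theta>" "0 < y" "y \<le> 1" using y(1) assms by (auto simp: K_def)
    then have pos: "\<bar>h y - 1\<bar> > 0" using h_eq_1_iff[of y] by auto
    show ?thesis
    proof (rule that[of "\<bar>h y - 1\<bar> / 2"])
      fix x assume x: "\<epsilon> \<le> x" "x \<le> 1" "\<bar>h x - 1\<bar> \<le> \<bar>h y - 1\<bar> / 2"
      have "x \<notin> K"
      proof
        assume "x \<in> K"
        from order_trans[OF y(2)[OF this] x(3)] pos show False by simp
      qed
      then show "\<bar>x - \<theta>\<bar> < \<epsilon>" using x by (auto simp: K_def dist_real_def abs_minus_commute)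
    qed (use pos in auto)
  qed
qed

end

section \<open>The fraction of vertices in small components\<close>

lemma sequentially_real_ge: "eventually (\<lambda>n. c \<le> real n) sequentially"
  using filterlim_real_sequentially by (simp add: filterlim_at_top)

context supercritical
begin

definition small :: "real \<Rightarrow> nat \<Rightarrow> nat set" where
  "small \<delta> n = {k \<in> {1..n}. real k \<le> \<delta> * real n}"

definition large :: "real \<Rightarrow> nat \<Rightarrow> nat set" where
  "large \<delta> n = {k \<in> {1..n}. \<delta> * real n < real k}"

lemma small_large: "small \<delta> n \<union> large \<delta> n = {1..n}" "small \<delta> n \<inter> large \<delta> n = {}"
  "finite (small \<delta> n)" "finite (large \<delta> n)" "small \<delta> n \<subseteq> {1..n}" "large \<delta> n \<subseteq> {1..n}"
  by (auto simp: small_def large_def)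

lemma sum_small_large:
  fixes f :: "nat \<Rightarrow> real"
  shows "(\<Sum>k\<in>small \<delta> n. f k) + (\<Sum>k\<in>large \<delta> n. f k) = (\<Sum>k=1..n. f k)"
  using sum.union_disjoint[OF small_large(3,4,2), of f] by (simp add: small_large(1))

text \<open>Here \<open>m\<close> is close to \<open>l * n\<close> with \<open>l < \<theta>\<close>, for which \<open>G n m k\<close> grows exponentially in \<open>k\<close> as long as \<open>k\<close> is
  a small fraction of \<open>n\<close>.\<close>

lemma small_exp_moment:
  assumes l: "0 < l" "l < \<theta>"
  obtains \<delta> a where "\<delta> > 0" "a > 0"
    "eventually (\<lambda>n. (\<Sum>k\<in>small \<delta> n. mu n k * exp (a * real k)) \<le> 1 - l) sequentially"
proof -
  \<comment> \<open>\<open>b\<close> separates \<open>exp (- (t * l))\<close> from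
    \<open>1 - l\<close>; the gap exists because \<open>h l > 1\<close>.\<close>
  define b where "b = (exp (- (t * l)) + (1 - l)) / 2"
  have "exp (- (t * l)) < 1 - l"
    using h_greater_1[OF l] by (simp add: h_def exp_minus field_simps)
  then have b: "exp (- (t * l)) < b" "b < 1 - l" by (auto simp: b_def)
  have b0: "b > 0" using b(1) exp_gt_zero[of "- (t * l)"] by linarith
  \<comment> \<open>Chosen such that \<open>l / (1 - \<delta>) = 1 - b\<close>: for \<open>k\<close>
    up to \<open>\<delta> * n\<close> each factor of the product is then at least
    \<open>b\<close>.\<close>
  define \<delta> where "\<delta> = 1 - l / (1 - b)"
  have \<delta>: "\<delta> > 0" "\<delta> < 1" using b l theta_less_1 by (auto simp: \<delta>_def field_simps)
  \<comment> \<open>The tilt grows at rate \<open>t * l + ln b\<close>. Half of it is kept, the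
    other half absorbs the rounding of \<open>m\<close>.\<close>
  define a where "a = (t * l + ln b) / 2"
  have "ln (exp (- (t * l))) < ln b" using b b0 by (subst ln_less_cancel_iff) auto
  then have a: "a > 0" by (simp add: a_def)
  have ev: "eventually (\<lambda>n. t / a \<le> real n \<and> 1 \<le> real n) sequentially"
    by (intro eventually_conj sequentially_real_ge)
  have "eventually (\<lambda>n. (\<Sum>k\<in>small \<delta> n. mu n k * exp (a * real k)) \<le> 1 - l) sequentially"
    using ev
  proof eventually_elim
    case (elim n)
    then have n: "real n > 0" "t / real n \<le> a" using a by (auto simp: field_simps)
    define m where "m = nat \<lfloor>l * real n\<rfloor>"
    have m: "real m \<le> l * real n" "l * real n - 1 \<le> real m"
      using l n by (auto simp: m_def)
    have "l * real n < 1 * real n" using l theta_less_1 n by (intro mult_strict_right_mono) auto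
    then have mn: "m < n" using m by linarith
    have Gk: "exp (a * real k) \<le> b * G n m k" if k: "k \<in> small \<delta> n" for k
    proof -
      have k1: "1 \<le> k" "k \<le> n" "real k \<le> \<delta> * real n" using k by (auto simp: small_def)
      have fac: "b \<le> (real n - real m - 1 - real i) / (real n - 1 - real i)" if i: "i < k - 1" for i
      proof -
        define N where "N = real n - 1 - real i"
        have N: "N \<ge> (1 - \<delta>) * real n" using i k1 by (simp add: N_def algebra_simps)
        have p: "(1 - \<delta>) * real n > 0" using \<delta> n by simp
        have "real m / N \<le> (l * real n) / ((1 - \<delta>) * real n)"
          using m N p by (intro frac_le) auto
        also have "\<dots> = 1 - b" using n b l by (simp add: \<delta>_def)
        finally have "b \<le> 1 - real m / N" by simp
        also have "\<dots> = (N - real m) / N" using N p by (simp add: field_simps)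
        finally show ?thesis by (simp add: N_def algebra_simps)
      qed
      have "b ^ (k - 1) = (\<Prod>i<k - 1. b)" by simp
      also have "\<dots> \<le> (\<Prod>i<k - 1. (real n - real m - 1 - real i) / (real n - 1 - real i))"
        using b0 fac by (intro prod_mono) auto
      finally have pr: "b ^ (k - 1) \<le> (\<Prod>i<k - 1. (real n - real m - 1 - real i) / (real n - 1 - real i))" .
      have "a + t / real n \<le> 2 * a" using n by simp
      have bexp: "b ^ k = exp (real k * ln b)" using b0 by (simp add: exp_of_nat_mult)
      have "a * real k \<le> (2 * a - t / real n) * real k" using n by (intro mult_right_mono) auto
      also have "\<dots> = real k * ln b + t * (l * real n - 1) * real k / real n"
        using n by (simp add: a_def field_simps)
      also have "\<dots> \<le> real k * ln b + t * real m * real k / real n"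
        using m t_gt_1 n by (intro add_left_mono divide_right_mono mult_right_mono mult_left_mono) auto
      finally have "exp (a * real k) \<le> exp (real k * ln b + t * real m * real k / real n)" by simp
      \<comment> \<open>The product has only \<open>k - 1\<close> factors. The spare
        \<open>b\<close> gives the final bound \<open>b < 1 - l\<close> instead of merely 1.\<close>
      also have "\<dots> = b * (exp (t * real m * real k / real n) * b ^ (k - 1))"
      proof -
        have "b ^ k = b * b ^ (k - 1)" using k1 by (cases k) auto
        then show ?thesis by (simp add: exp_add bexp [symmetric])
      qed
      also have "\<dots> \<le> b * G n m k"
        unfolding G_eq_prod[OF mn k1(1,2)] using b0 pr by (intro mult_left_mono) auto
      finally show ?thesis .
    qed
    have "(\<Sum>k\<in>small \<delta> n. mu n k * exp (a * real k)) \<le> (\<Sum>k\<in>small \<delta> n. mu n k * (b * G n m k))"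
      using Gk mu_nonneg by (intro sum_mono mult_left_mono) auto
    also have "\<dots> = b * (\<Sum>k\<in>small \<delta> n. mu n k * G n m k)" by (simp add: sum_distrib_left mult_ac)
    also have "\<dots> \<le> b * 1"
      using b0 by (intro mult_left_mono sum_mu_G_le_1 small_large mn) auto
    finally show ?case using b by simp
  qed
  then show ?thesis using that \<delta> a by blast
qed

text \<open>Here \<open>m\<close> is close to \<open>l * n\<close> with \<open>l > \<theta>\<close>, for which \<open>G n m k\<close> decays exponentially in \<open>k\<close>, so that large
  components do not contribute.\<close>

lemma small_mass_lower:
  assumes "\<delta> > 0" "\<theta> < l" "l < 1" "\<epsilon> > 0"
  shows "eventually (\<lambda>n. 1 - l - \<epsilon> \<le> (\<Sum>k\<in>small \<delta> n. mu n k)) sequentially"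
proof -
  \<comment> \<open>Strictly between \<open>h l\<close> and 1, so that rounding \<open>m\<close>
    keeps \<open>h (m / n)\<close> below \<open>r\<close> and large sizes contribute at most of
    order \<open>r powr (\<delta> * n)\<close>.\<close>
  define r where "r = (1 + h l) / 2"
  have hl: "0 \<le> h l" "h l < 1" using assms h_less_1[of l] by (auto simp: h_def)
  have r: "0 < r" "r < 1" "h l < r" using hl by (auto simp: r_def)
  define m where "m = (\<lambda>n. nat \<lceil>l * real n\<rceil>)"
  have l0: "l > 0" using assms theta_pos by linarith
  have m: "l * real n \<le> real (m n)" "real (m n) \<le> l * real n + 1" for n
    using l0 of_int_ceiling_le_add_one[of "l * real n"] by (auto simp: m_def)
  have mlim: "(\<lambda>n. real (m n) / real n) \<longlonglongrightarrow> l"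
  proof (rule tendsto_sandwich)
    show "eventually (\<lambda>n. l \<le> real (m n) / real n) sequentially"
      using eventually_gt_at_top[of 0] by eventually_elim (use m in \<open>simp add: field_simps\<close>)
    show "eventually (\<lambda>n. real (m n) / real n \<le> l + 1 / real n) sequentially"
      using eventually_gt_at_top[of 0] by eventually_elim (use m in \<open>simp add: field_simps\<close>)
    have "(\<lambda>n. l + 1 / real n) \<longlonglongrightarrow> l + 0" by (intro tendsto_intros lim_1_over_n)
    then show "(\<lambda>n. l + 1 / real n) \<longlonglongrightarrow> l" by simp
  qed auto
  have "isCont h l" unfolding h_def by (intro continuous_intros)
  from isCont_tendsto_compose[OF this mlim]
  have e1: "eventually (\<lambda>n. h (real (m n) / real n) < r) sequentially"
    using r(3) by (rule order_tendstoD(2))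
  have e2: "eventually (\<lambda>n. real (m n) / real n < 1) sequentially"
    using mlim assms(3) by (rule order_tendstoD(2))
  have e3: "eventually (\<lambda>n. real (m n) / real n < l + \<epsilon> / 2) sequentially"
    using mlim by (rule order_tendstoD(2)) (use assms in auto)
  have "(\<lambda>n. r powr (\<delta> * real n)) \<longlonglongrightarrow> 0"
  proof -
    have "r powr (\<delta> * real n) = (r powr \<delta>) ^ n" for n
      using r by (simp add: powr_powr [symmetric] powr_realpow)
    moreover have "\<bar>r powr \<delta>\<bar> < 1"
      using powr_less_mono2[of \<delta> r 1] r assms(1) by simp
    ultimately show ?thesis by (simp add: LIMSEQ_power_zero)
  qed
  then have e4: "eventually (\<lambda>n. r powr (\<delta> * real n) < \<epsilon> / 2) sequentially"
    by (rule order_tendstoD(2)) (use assms in auto)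
  show ?thesis
    using e1 e2 e3 e4 eventually_gt_at_top[of 0]
  proof eventually_elim
    case (elim n)
    then have n: "real n > 0" and mn: "m n < n" by auto
    define x where "x = real (m n) / real n"
    have x: "l \<le> x" "x < 1" using m[of n] n elim by (auto simp: x_def field_simps)
    have hx: "0 \<le> h x" "h x \<le> 1" "h x < r"
      using x assms h_less_1[of x] elim by (auto simp: h_def x_def)
    \<comment> \<open>Again there are only \<open>k - 1\<close> factors, hence the division by
      \<open>1 - x\<close>. It turns the total mean 1 into the lower bound \<open>1 - x\<close>, up
      to the large sizes, for the mass of the small ones.\<close>
    have Gk: "G n (m n) k \<le> h x ^ k / (1 - x)" if k: "1 \<le> k" "k \<le> n" for k
    proof (cases "k > n - m n")
      case True
      then show ?thesis using G_eq_0[OF mn k(1)] hx x by simp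
    next
      case False
      then have km: "real k + real (m n) \<le> real n" using mn by linarith
      have fac: "0 \<le> (real n - real (m n) - 1 - real i) / (real n - 1 - real i)
          \<and> (real n - real (m n) - 1 - real i) / (real n - 1 - real i) \<le> 1 - x" if i: "i < k - 1" for i
      proof -
        define N where "N = real n - 1 - real i"
        have N: "real (m n) \<le> N" "0 < N" "N \<le> real n" using i km mn by (auto simp: N_def)
        have "x \<le> real (m n) / N" unfolding x_def using N by (intro divide_left_mono) auto
        then have "1 - real (m n) / N \<le> 1 - x" by simp
        moreover have "0 \<le> 1 - real (m n) / N" using N by simp
        moreover have "(real n - real (m n) - 1 - real i) / (real n - 1 - real i) = 1 - real (m n) / N"
          using N(2) by (simp add: N_def field_simps)
        ultimately show ?thesis by simp
      qed
      have "(\<Prod>i<k - 1. (real n - real (m n) - 1 - real i) / (real n - 1 - real i)) \<le> (\<Prod>i<k - 1. 1 - x)"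
        using fac by (intro prod_mono) auto
      then have pr: "(\<Prod>i<k - 1. (real n - real (m n) - 1 - real i) / (real n - 1 - real i)) \<le> (1 - x) ^ (k - 1)"
        by simp
      have "G n (m n) k \<le> exp (t * real (m n) * real k / real n) * (1 - x) ^ (k - 1)"
        unfolding G_eq_prod[OF mn k] using pr by (intro mult_left_mono) auto
      also have "exp (t * real (m n) * real k / real n) = exp (t * x) ^ k"
        by (simp add: x_def exp_of_nat_mult [symmetric] mult_ac)
      also have "exp (t * x) ^ k * (1 - x) ^ (k - 1) = h x ^ k / (1 - x)"
        using k x by (cases k) (auto simp: h_def power_mult_distrib)
      finally show ?thesis .
    qed
    have "1 = (\<Sum>k=1..n. mu n k * G n (m n) k)" by (rule sum_mu_G[OF mn, symmetric])
    also have "\<dots> = (\<Sum>k\<in>small \<delta> n. mu n k * G n (m n) k) + (\<Sum>k\<in>large \<delta> n. mu n k * G n (m n) k)"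
      by (simp add: sum_small_large)
    also have "\<dots> \<le> (\<Sum>k\<in>small \<delta> n. mu n k * (1 / (1 - x))) + (\<Sum>k\<in>large \<delta> n. mu n k * (r powr (\<delta> * real n) / (1 - x)))"
    proof (intro add_mono sum_mono mult_left_mono mu_nonneg)
      fix k assume "k \<in> small \<delta> n"
      then have k: "1 \<le> k" "k \<le> n" by (auto simp: small_def)
      have "h x ^ k \<le> 1" using hx by (intro power_le_one) auto
      then show "G n (m n) k \<le> 1 / (1 - x)" using Gk[OF k] x
        by (smt (verit) divide_right_mono)
    next
      fix k assume "k \<in> large \<delta> n"
      then have k: "1 \<le> k" "k \<le> n" "\<delta> * real n < real k" by (auto simp: large_def)
      have "h x ^ k \<le> r ^ k" using hx by (intro power_mono) auto
      also have "\<dots> = r powr real k" using r by (simp add: powr_realpow)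
      also have "\<dots> \<le> r powr (\<delta> * real n)" using r k by (intro powr_mono') auto
      finally show "G n (m n) k \<le> r powr (\<delta> * real n) / (1 - x)" using Gk[OF k(1,2)] x
        by (smt (verit) divide_right_mono)
    qed
    also have "\<dots> = ((\<Sum>k\<in>small \<delta> n. mu n k) + r powr (\<delta> * real n) * (\<Sum>k\<in>large \<delta> n. mu n k)) / (1 - x)"
      by (simp add: sum_distrib_left sum_divide_distrib add_divide_distrib mult_ac)
    also have "\<dots> \<le> ((\<Sum>k\<in>small \<delta> n. mu n k) + r powr (\<delta> * real n) * 1) / (1 - x)"
      using x sum_mu_le_1[OF small_large(6)] by (intro divide_right_mono add_left_mono mult_left_mono) auto
    finally have "1 - x \<le> (\<Sum>k\<in>small \<delta> n. mu n k) + r powr (\<delta> * real n)"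
      using x by (simp add: field_simps)
    then show ?case using elim unfolding x_def by linarith
  qed
qed

lemma sum_mu_h_deviation_tendsto:
  assumes "\<eta> > 0"
  shows "(\<lambda>n. \<Sum>k | k \<in> {1..n} \<and> \<bar>h (real k / real n) - 1\<bar> > \<eta>. mu n k) \<longlonglongrightarrow> 0"
proof (rule tendsto_sandwich[of "\<lambda>_. 0" _ _ "\<lambda>n. exp (2 * t) / (real n * \<eta>\<^sup>2)"])
  show "eventually (\<lambda>n. (\<Sum>k | k \<in> {1..n} \<and> \<bar>h (real k / real n) - 1\<bar> > \<eta>. mu n k) \<le> exp (2 * t) / (real n * \<eta>\<^sup>2)) sequentially"
    using eventually_ge_at_top[of 3] by eventually_elim (use sum_mu_h_deviation assms in auto)
  show "(\<lambda>n. exp (2 * t) / (real n * \<eta>\<^sup>2)) \<longlonglongrightarrow> 0" using assms by real_asymp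
qed (auto intro!: always_eventually sum_nonneg mu_nonneg)

text \<open>\<open>l\<close> approaches \<open>\<theta>\<close> from above in
  \<open>small_mass_lower\<close> and from below in \<open>small_exp_moment\<close>. The latter only
  provides some cut-off \<open>\<delta>'\<close>; sizes between \<open>\<delta>' * n\<close> and
  \<open>\<delta> * n\<close> are negligible because \<open>h\<close> stays away from 1
  there.\<close>

lemma small_mass_tendsto:
  assumes \<delta>: "0 < \<delta>" "\<delta> < \<theta>"
  shows "(\<lambda>n. \<Sum>k\<in>small \<delta> n. mu n k) \<longlonglongrightarrow> 1 - \<theta>"
proof (rule order_tendstoI)
  fix y assume y: "y < 1 - \<theta>"
  define e where "e = (1 - \<theta> - y) / 3"
  define l where "l = \<theta> + min e ((1 - \<theta>) / 2)"
  have e: "e > 0" using y by (simp add: e_def)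
  have l: "\<theta> < l" "l < 1" "l \<le> \<theta> + e" using e theta_less_1 by (auto simp: l_def min_def field_simps)
  from small_mass_lower[OF \<delta>(1) l(1,2) e]
  show "eventually (\<lambda>n. y < (\<Sum>k\<in>small \<delta> n. mu n k)) sequentially"
    by eventually_elim (use l(3) e in \<open>simp add: e_def field_simps\<close>)
next
  fix y assume y: "1 - \<theta> < y"
  define e where "e = (y - (1 - \<theta>)) / 3"
  define l where "l = \<theta> - min e (\<theta> / 2)"
  have e: "e > 0" using y by (simp add: e_def)
  have l: "0 < l" "l < \<theta>" "\<theta> - e \<le> l" using e theta_pos by (auto simp: l_def min_def)
  from small_exp_moment[OF l(1,2)] obtain \<delta>' a where \<delta>': "\<delta>' > 0" "a > 0"
    "eventually (\<lambda>n. (\<Sum>k\<in>small \<delta>' n. mu n k * exp (a * real k)) \<le> 1 - l) sequentially" by blast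
  obtain \<eta> where \<eta>: "\<eta> > 0" "\<And>x. min \<delta>' (\<theta> - \<delta>) \<le> x \<Longrightarrow> x \<le> 1 \<Longrightarrow> \<bar>h x - 1\<bar> \<le> \<eta> \<Longrightarrow> \<bar>x - \<theta>\<bar> < min \<delta>' (\<theta> - \<delta>)"
    using h_close_1_imp[of "min \<delta>' (\<theta> - \<delta>)"] \<delta> \<delta>'(1) by (metis diff_gt_0_iff_gt min_less_iff_conj)
  from order_tendstoD(2)[OF sum_mu_h_deviation_tendsto[OF \<eta>(1)] e]
  have ev: "eventually (\<lambda>n. (\<Sum>k | k \<in> {1..n} \<and> \<bar>h (real k / real n) - 1\<bar> > \<eta>. mu n k) < e) sequentially" .
  show "eventually (\<lambda>n. (\<Sum>k\<in>small \<delta> n. mu n k) < y) sequentially"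
    using \<delta>'(3) ev eventually_gt_at_top[of 0]
  proof eventually_elim
    case (elim n)
    let ?D = "{k. k \<in> {1..n} \<and> \<bar>h (real k / real n) - 1\<bar> > \<eta>}"
    have sub: "small \<delta> n \<subseteq> small \<delta>' n \<union> ?D"
    proof
      fix k assume k: "k \<in> small \<delta> n"
      show "k \<in> small \<delta>' n \<union> ?D"
      proof (rule ccontr)
        assume "k \<notin> small \<delta>' n \<union> ?D"
        then have "\<delta>' * real n < real k" "\<bar>h (real k / real n) - 1\<bar> \<le> \<eta>" using k by (auto simp: small_def)
        moreover have "real k / real n \<le> \<delta>" "real k / real n \<le> 1" using k elim by (auto simp: small_def field_simps)
        moreover have "\<delta>' \<le> real k / real n" using calculation(1) elim by (simp add: field_simps)
        moreover from calculation have "\<bar>real k / real n - \<theta>\<bar> < \<theta> - \<delta>"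
          using \<eta>(2)[of "real k / real n"] by simp
        ultimately show False by linarith
      qed
    qed
    have "(\<Sum>k\<in>small \<delta> n. mu n k) \<le> (\<Sum>k\<in>small \<delta>' n \<union> ?D. mu n k)"
      using sub small_large(3) mu_nonneg by (intro sum_mono2) auto
    also have "\<dots> \<le> (\<Sum>k\<in>small \<delta>' n. mu n k) + (\<Sum>k\<in>?D. mu n k)"
      using mu_nonneg small_large(3) by (subst sum.union_inter [symmetric]) (auto intro: sum_nonneg)
    also have "(\<Sum>k\<in>small \<delta>' n. mu n k) \<le> (\<Sum>k\<in>small \<delta>' n. mu n k * exp (a * real k))"
      using mult_left_mono[OF _ mu_nonneg, of 1] \<delta>'(2) by (intro sum_mono) simp
    finally have "(\<Sum>k\<in>small \<delta> n. mu n k) < 1 - l + e" using elim by linarith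
    also have "\<dots> \<le> 1 - \<theta> + 2 * e" using l by simp
    also have "\<dots> < y" using e by (simp add: e_def field_simps)
    finally show ?case .
  qed
qed

end

section \<open>The Laplace transform of the size of a giant component\<close>

lemma one_minus_ge_exp:
  fixes x :: real
  assumes "0 \<le> x" "x \<le> 1 / 2" shows "exp (- 2 * x) \<le> 1 - x"
proof -
  have "(1 + 2 * x) * (1 - x) = 1 + x * (1 - 2 * x)" by (simp add: algebra_simps)
  also have "\<dots> \<ge> 1" using assms by simp
  finally have "1 \<le> (1 + 2 * x) * (1 - x)" .
  also have "\<dots> \<le> exp (2 * x) * (1 - x)"
    using assms by (intro mult_right_mono exp_ge_add_one_self) auto
  finally show ?thesis by (simp add: exp_minus field_simps)
qed

lemma prod_lessThan_add:
  fixes f :: "nat \<Rightarrow> 'a :: comm_monoid_mult"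
  shows "(\<Prod>i<m + j. f i) = (\<Prod>i<m. f i) * (\<Prod>i<j. f (m + i))"
  by (induction j) (simp_all add: mult_ac)

lemma sum_linear_combination:
  fixes w g :: "'a \<Rightarrow> real"
  shows "(\<Sum>k\<in>A. w k * ((c * g k + e) / l + d)) =
    c / l * (\<Sum>k\<in>A. w k * g k) + e / l * (\<Sum>k\<in>A. w k) + d * (\<Sum>k\<in>A. w k)"
  by (induction A rule: infinite_finite_induct) (auto simp: algebra_simps add_divide_distrib)

text \<open>The Weierstrass product inequality.\<close>

lemma one_minus_sum_le_prod:
  fixes x :: "nat \<Rightarrow> real"
  assumes "\<And>i. i < m \<Longrightarrow> 0 \<le> x i \<and> x i \<le> 1"
  shows "1 - (\<Sum>i<m. x i) \<le> (\<Prod>i<m. 1 - x i)"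
  using assms
proof (induction m)
  case (Suc m)
  have "(\<Prod>i<m. 1 - x i) \<le> 1" using Suc.prems by (intro prod_le_1) auto
  then have "(\<Prod>i<m. 1 - x i) * x m \<le> 1 * x m" using Suc.prems by (intro mult_right_mono) auto
  then show ?case using Suc by (simp add: algebra_simps)
qed simp

text \<open>Fixes one cut-off between small and giant sizes together with a rate for which small
  sizes have a bounded exponential moment.\<close>

locale supercritical_cut = supercritical +
  fixes \<delta> a :: real
  assumes \<delta>_pos: "0 < \<delta>" and \<delta>_less: "\<delta> < \<theta>" and a_pos: "0 < a"
    and exp_moment: "eventually (\<lambda>n. (\<Sum>k\<in>small \<delta> n. mu n k * exp (a * real k)) \<le> 1) sequentially"

lemma (in supercritical) ex_supercritical_cut: "\<exists>\<delta> a. supercritical_cut t \<delta> a"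
proof -
  obtain \<delta> a where *: "\<delta> > 0" "a > 0"
    "eventually (\<lambda>n. (\<Sum>k\<in>small \<delta> n. mu n k * exp (a * real k)) \<le> 1 - \<theta> / 2) sequentially"
    using small_exp_moment[of "\<theta> / 2"] theta_pos by auto
  \<comment> \<open>Lowering the cut-off removes only nonnegative terms, so the moment bound
    survives.\<close>
  define \<delta>' where "\<delta>' = min \<delta> (\<theta> / 2)"
  have \<delta>': "0 < \<delta>'" "\<delta>' < \<theta>" "\<delta>' \<le> \<delta>" using * theta_pos by (auto simp: \<delta>'_def min_def)
  have "eventually (\<lambda>n. (\<Sum>k\<in>small \<delta>' n. mu n k * exp (a * real k)) \<le> 1) sequentially"
    using *(3)
  proof eventually_elim
    case (elim n)
    have "small \<delta>' n \<subseteq> small \<delta> n"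
      using order_trans[OF _ mult_right_mono[OF \<delta>'(3), of "real n"]] by (auto simp: small_def)
    then have "(\<Sum>k\<in>small \<delta>' n. mu n k * exp (a * real k)) \<le> (\<Sum>k\<in>small \<delta> n. mu n k * exp (a * real k))"
      by (intro sum_mono2 small_large) (auto intro: mult_nonneg_nonneg mu_nonneg)
    then show ?case using elim theta_pos by linarith
  qed
  then have "supercritical_cut t \<delta>' a"
    by unfold_locales (use \<delta>' * in auto)
  then show ?thesis by blast
qed

context supercritical_cut
begin

section \<open>Tilts with \<open>m\<close> of order \<open>sqrt n\<close> on small sizes\<close>

definition ms :: "real \<Rightarrow> nat \<Rightarrow> nat" where
  "ms \<kappa> n = nat \<lfloor>\<kappa> * sqrt (real n)\<rfloor>"

lemma ms_bounds:
  assumes "\<kappa> \<ge> 0"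
  shows "real (ms \<kappa> n) \<le> \<kappa> * sqrt (real n)" "\<kappa> * sqrt (real n) - 1 \<le> real (ms \<kappa> n)"
  using assms by (auto simp: ms_def)

lemma ms_le_eventually:
  assumes "\<kappa> \<ge> 0" "c > 0"
  shows "eventually (\<lambda>n. real (ms \<kappa> n) \<le> c * real n) sequentially"
  using sequentially_real_ge[of "(\<kappa> / c)\<^sup>2"]
proof eventually_elim
  case (elim n)
  have "\<kappa> / c \<le> sqrt (real n)" using elim by (rule real_le_rsqrt)
  then have "\<kappa> * sqrt (real n) \<le> c * sqrt (real n) * sqrt (real n)"
    using assms by (intro mult_right_mono) (auto simp: field_simps)
  also have "\<dots> = c * real n" by (simp add: mult.assoc)
  finally show ?case using ms_bounds(1)[OF assms(1), of n] by linarith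
qed

lemma ms_square_le:
  assumes "\<kappa> \<ge> 0" shows "(real (ms \<kappa> n))\<^sup>2 \<le> \<kappa>\<^sup>2 * real n"
proof -
  have "(real (ms \<kappa> n))\<^sup>2 \<le> (\<kappa> * sqrt (real n))\<^sup>2"
    using ms_bounds(1)[OF assms] by (intro power_mono) auto
  then show ?thesis by (simp add: power_mult_distrib)
qed

lemma ms_div_sqrt_tendsto:
  assumes "\<kappa> \<ge> 0" shows "(\<lambda>n. real (ms \<kappa> n) / sqrt (real n)) \<longlonglongrightarrow> \<kappa>"
proof (rule tendsto_sandwich)
  show "eventually (\<lambda>n. \<kappa> - 1 / sqrt (real n) \<le> real (ms \<kappa> n) / sqrt (real n)) sequentially"
    using eventually_gt_at_top[of 0]
  proof eventually_elim
    case (elim n)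
    then show ?case
      using divide_right_mono[OF ms_bounds(2)[OF assms, of n], of "sqrt (real n)"] by (simp add: diff_divide_distrib)
  qed
  show "eventually (\<lambda>n. real (ms \<kappa> n) / sqrt (real n) \<le> \<kappa>) sequentially"
    using eventually_gt_at_top[of 0]
  proof eventually_elim
    case (elim n)
    then show ?case
      using divide_right_mono[OF ms_bounds(1)[OF assms, of n], of "sqrt (real n)"] by simp
  qed
  show "(\<lambda>n. \<kappa> - 1 / sqrt (real n)) \<longlonglongrightarrow> \<kappa>" by real_asymp
qed auto

text \<open>For \<open>m\<close> of order \<open>sqrt n\<close> both the exponent
  \<open>t * m * k / n\<close> and the loss in the product are of order \<open>k / sqrt n\<close>.
  The factor \<open>k\<close>, possibly of order \<open>n\<close>, is paid for by
  \<open>exp (a * k)\<close>, whose mean is bounded.\<close>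

lemma G_small_bound:
  assumes "\<kappa> \<ge> 0"
  obtains C where "eventually (\<lambda>n. \<forall>k\<in>small \<delta> n. \<bar>G n (ms \<kappa> n) k - 1\<bar> \<le> C / sqrt (real n) * exp (a * real k)) sequentially"
proof -
  define c where "c = 1 - \<theta>"
  have c: "c > 0" using theta_less_1 by (simp add: c_def)
  \<comment> \<open>The first summand comes from the exponential factor, the second from the
    product.\<close>
  define C where "C = 2 * t * \<kappa> / a + \<kappa> / (c * a)"
  \<comment> \<open>From here on the exponent is at most \<open>a * k / 2\<close>, and the other
    half of \<open>a * k\<close> absorbs the factor \<open>k\<close>.\<close>
  have ev: "eventually (\<lambda>n. (2 * t * \<kappa> / a)\<^sup>2 \<le> real n) sequentially" by (rule sequentially_real_ge)
  have "eventually (\<lambda>n. \<forall>k\<in>small \<delta> n. \<bar>G n (ms \<kappa> n) k - 1\<bar> \<le> C / sqrt (real n) * exp (a * real k)) sequentially"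
    using ev ms_le_eventually[OF assms c] eventually_gt_at_top[of 0]
  proof eventually_elim
    case (elim n)
    define m where "m = ms \<kappa> n"
    define s where "s = sqrt (real n)"
    have n: "real n > 0" "s > 0" "s * s = real n" using elim by (auto simp: s_def)
    have ms: "real m \<le> \<kappa> * s" using ms_bounds(1)[OF assms] by (simp add: m_def s_def)
    have sb: "2 * t * \<kappa> / a \<le> s" unfolding s_def using elim(1) by (rule real_le_rsqrt)
    have mc: "real m \<le> c * real n" using elim by (simp add: m_def)
    show ?case
    proof
      fix k assume "k \<in> small \<delta> n"
      then have k: "1 \<le> k" "k \<le> n" "real k \<le> \<delta> * real n" by (auto simp: small_def)
      have "\<delta> * real n < \<theta> * real n" using \<delta>_less n by simp
      then have kc: "real k \<le> \<theta> * real n" using k by linarith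
      have "c * real n < 1 * real n" using theta_pos n unfolding c_def by (intro mult_strict_right_mono) auto
      then have mn: "m < n" using mc by linarith
      define P where "P = (\<Prod>i<k - 1. (real n - real m - 1 - real i) / (real n - 1 - real i))"
      have GP: "G n m k = exp (t * real m * real k / real n) * P"
        unfolding P_def using mn k by (intro G_eq_prod) auto
      have fac: "(real n - real m - 1 - real i) / (real n - 1 - real i) = 1 - real m / (real n - 1 - real i)
           \<and> 0 \<le> real m / (real n - 1 - real i) \<and> real m / (real n - 1 - real i) \<le> 1
           \<and> real m / (real n - 1 - real i) \<le> \<kappa> / (c * s)" if i: "i < k - 1" for i
      proof -
        define N where "N = real n - 1 - real i"
        have N: "N \<ge> c * real n" using i k kc by (simp add: N_def c_def algebra_simps)
        have N0: "N > 0" using N c n by (smt (verit) mult_pos_pos)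
        have "real m / N \<le> \<kappa> * s / (c * real n)"
          using ms N c n assms by (intro frac_le) auto
        also have "\<dots> = \<kappa> / (c * s)" unfolding n(3) [symmetric] using n(2) by simp
        finally have "real m / N \<le> \<kappa> / (c * s)" .
        moreover have "real m / N \<le> 1" using N N0 mc by simp
        moreover have "(real n - real m - 1 - real i) / N = 1 - real m / N"
          using N0 by (simp add: N_def field_simps)
        ultimately show ?thesis using N0 by (simp add: N_def)
      qed
      have P1: "P \<le> 1" "P \<ge> 0" unfolding P_def using fac by (auto intro!: prod_le_1 prod_nonneg)
      have P2: "1 - P \<le> real k * (\<kappa> / (c * s))"
      proof -
        have "1 - (\<Sum>i<k - 1. real m / (real n - 1 - real i)) \<le> (\<Prod>i<k - 1. 1 - real m / (real n - 1 - real i))"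
          using fac by (intro one_minus_sum_le_prod) auto
        also have "\<dots> = P" unfolding P_def using fac by (intro prod.cong refl) auto
        finally have "1 - P \<le> (\<Sum>i<k - 1. real m / (real n - 1 - real i))" by simp
        also have "\<dots> \<le> (\<Sum>i<k - 1. \<kappa> / (c * s))" using fac by (intro sum_mono) auto
        also have "\<dots> = real (k - 1) * (\<kappa> / (c * s))" by simp
        also have "\<dots> \<le> real k * (\<kappa> / (c * s))"
          using assms c n by (intro mult_right_mono) auto
        finally show ?thesis .
      qed
      define y where "y = t * real m * real k / real n"
      have y0: "y \<ge> 0" using t_gt_1 by (simp add: y_def)
      have "y \<le> t * (\<kappa> * s) * real k / real n"
        unfolding y_def using ms t_gt_1 by (intro divide_right_mono mult_right_mono mult_left_mono) auto
      also have "\<dots> = t * \<kappa> / s * real k" unfolding n(3) [symmetric] using n(2) by simp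
      finally have y1: "y \<le> t * \<kappa> / s * real k" .
      have "t * \<kappa> / s \<le> a / 2" using sb n a_pos by (simp add: field_simps)
      then have "t * \<kappa> / s * real k \<le> a / 2 * real k" by (rule mult_right_mono) simp
      from order_trans[OF y1 this] have y2: "y \<le> a * real k / 2" by simp
      have "a * real k / 2 \<le> exp (a * real k / 2)" "a * real k \<le> exp (a * real k)"
        using exp_ge_add_one_self[of "a * real k / 2"] exp_ge_add_one_self[of "a * real k"] by linarith+
      then have kexp: "real k \<le> 2 / a * exp (a * real k / 2)" "real k \<le> 1 / a * exp (a * real k)"
        using a_pos by (auto simp: field_simps)
      have "exp y - 1 \<le> y * exp y"
        using exp_ge_add_one_self[of "- y"] by (simp add: exp_minus field_simps)
      also have "\<dots> \<le> (t * \<kappa> / s * real k) * exp (a * real k / 2)"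
        using y0 y1 y2 by (intro mult_mono) auto
      also have "\<dots> \<le> (t * \<kappa> / s * (2 / a * exp (a * real k / 2))) * exp (a * real k / 2)"
        using kexp assms t_gt_1 n by (intro mult_right_mono mult_left_mono) auto
      also have "\<dots> = 2 * t * \<kappa> / a / s * exp (a * real k)"
        by (simp add: exp_add [symmetric] mult_ac)
      finally have up: "exp y - 1 \<le> 2 * t * \<kappa> / a / s * exp (a * real k)" .
      have "real k * (\<kappa> / (c * s)) \<le> (1 / a * exp (a * real k)) * (\<kappa> / (c * s))"
        using kexp assms c n by (intro mult_right_mono) auto
      also have "\<dots> = \<kappa> / (c * a) / s * exp (a * real k)" by (simp add: mult_ac)
      finally have lo: "1 - P \<le> \<kappa> / (c * a) / s * exp (a * real k)" using P2 by linarith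
      have C: "C / s * exp (a * real k) = 2 * t * \<kappa> / a / s * exp (a * real k) + \<kappa> / (c * a) / s * exp (a * real k)"
        by (simp add: C_def add_divide_distrib distrib_right)
      have nn: "0 \<le> 2 * t * \<kappa> / a / s * exp (a * real k)" "0 \<le> \<kappa> / (c * a) / s * exp (a * real k)"
        using assms t_gt_1 a_pos n c by auto
      have "G n m k \<le> exp y * 1" unfolding GP y_def using P1 by (intro mult_left_mono) auto
      moreover have "1 * P \<le> G n m k" unfolding GP y_def [symmetric] using P1 y0 by (intro mult_right_mono) auto
      ultimately show "\<bar>G n (ms \<kappa> n) k - 1\<bar> \<le> C / sqrt (real n) * exp (a * real k)"
        using up lo C nn unfolding m_def s_def by linarith
    qed
  qed
  then show ?thesis by (rule that)
qed

lemma small_G_tendsto: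
  assumes "\<kappa> \<ge> 0"
  shows "(\<lambda>n. \<Sum>k\<in>small \<delta> n. mu n k * G n (ms \<kappa> n) k) \<longlonglongrightarrow> 1 - \<theta>"
proof -
  obtain C where C: "eventually (\<lambda>n. \<forall>k\<in>small \<delta> n. \<bar>G n (ms \<kappa> n) k - 1\<bar> \<le> C / sqrt (real n) * exp (a * real k)) sequentially"
    using G_small_bound[OF assms] by blast
  have "(\<lambda>n. (\<Sum>k\<in>small \<delta> n. mu n k * G n (ms \<kappa> n) k) - (\<Sum>k\<in>small \<delta> n. mu n k)) \<longlonglongrightarrow> 0"
  proof (rule Lim_null_comparison)
    show "eventually (\<lambda>n. norm ((\<Sum>k\<in>small \<delta> n. mu n k * G n (ms \<kappa> n) k) - (\<Sum>k\<in>small \<delta> n. mu n k)) \<le> \<bar>C\<bar> / sqrt (real n)) sequentially"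
      using C exp_moment
    proof eventually_elim
      case (elim n)
      have "norm ((\<Sum>k\<in>small \<delta> n. mu n k * G n (ms \<kappa> n) k) - (\<Sum>k\<in>small \<delta> n. mu n k)) =
        \<bar>\<Sum>k\<in>small \<delta> n. mu n k * (G n (ms \<kappa> n) k - 1)\<bar>"
        by (simp add: sum_subtractf right_diff_distrib)
      also have "\<dots> \<le> (\<Sum>k\<in>small \<delta> n. \<bar>mu n k * (G n (ms \<kappa> n) k - 1)\<bar>)" by (rule sum_abs)
      also have "\<dots> \<le> (\<Sum>k\<in>small \<delta> n. \<bar>C\<bar> / sqrt (real n) * (mu n k * exp (a * real k)))"
      proof (intro sum_mono)
        fix k assume k: "k \<in> small \<delta> n"
        have "\<bar>mu n k * (G n (ms \<kappa> n) k - 1)\<bar> = mu n k * \<bar>G n (ms \<kappa> n) k - 1\<bar>"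
          using mu_nonneg by (simp add: abs_mult)
        also have "\<dots> \<le> mu n k * (C / sqrt (real n) * exp (a * real k))"
          using elim(1) k by (intro mult_left_mono mu_nonneg) auto
        also have "\<dots> \<le> mu n k * (\<bar>C\<bar> / sqrt (real n) * exp (a * real k))"
          by (intro mult_left_mono mult_right_mono divide_right_mono mu_nonneg) auto
        finally show "\<bar>mu n k * (G n (ms \<kappa> n) k - 1)\<bar> \<le> \<bar>C\<bar> / sqrt (real n) * (mu n k * exp (a * real k))"
          by (simp add: mult_ac)
      qed
      also have "\<dots> = \<bar>C\<bar> / sqrt (real n) * (\<Sum>k\<in>small \<delta> n. mu n k * exp (a * real k))"
        by (simp add: sum_distrib_left)
      also have "\<dots> \<le> \<bar>C\<bar> / sqrt (real n) * 1" using elim(2) by (intro mult_left_mono) auto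
      finally show ?case by simp
    qed
    show "(\<lambda>n. \<bar>C\<bar> / sqrt (real n)) \<longlonglongrightarrow> 0" by real_asymp
  qed
  from tendsto_add[OF this small_mass_tendsto[OF \<delta>_pos \<delta>_less]] show ?thesis by simp
qed

lemma ms_less_eventually:
  assumes "\<kappa> \<ge> 0" shows "eventually (\<lambda>n. ms \<kappa> n < n) sequentially"
  using ms_le_eventually[OF assms, of "1/2", simplified] eventually_gt_at_top[of 0]
  by eventually_elim simp

lemma large_G_tendsto:
  assumes "\<kappa> \<ge> 0"
  shows "(\<lambda>n. \<Sum>k\<in>large \<delta> n. mu n k * G n (ms \<kappa> n) k) \<longlonglongrightarrow> \<theta>"
proof -
  have "(\<lambda>n. 1 - (\<Sum>k\<in>small \<delta> n. mu n k * G n (ms \<kappa> n) k)) \<longlonglongrightarrow> 1 - (1 - \<theta>)"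
    by (intro tendsto_intros small_G_tendsto assms)
  moreover have "eventually (\<lambda>n. 1 - (\<Sum>k\<in>small \<delta> n. mu n k * G n (ms \<kappa> n) k) = (\<Sum>k\<in>large \<delta> n. mu n k * G n (ms \<kappa> n) k)) sequentially"
    using ms_less_eventually[OF assms]
  proof eventually_elim
    case (elim n)
    from sum_mu_G[OF this] sum_small_large[where \<delta> = \<delta> and n = n and f = "\<lambda>k. mu n k * G n (ms \<kappa> n) k"]
    show ?case by simp
  qed
  ultimately show ?thesis by (simp add: tendsto_cong)
qed

section \<open>Uniform integrability of the tilts\<close>

text \<open>The tilt for \<open>2 * m\<close> differs from the square of that for \<open>m\<close>
  only by having \<open>f (m + i)\<close> in place of \<open>f i\<close> in the second block. Each
  factor loses a relative amount of order \<open>m / n\<close>, together \<open>exp\<close> of order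
  \<open>m\<^sup>2 / n\<close>. This requires \<open>n - k\<close> of order \<open>n\<close>, hence
  \<open>k \<le> \<theta> * n\<close>.\<close>

lemma G_square_bound_below:
  fixes n m k :: nat
  defines "c \<equiv> 1 - \<theta>"
  assumes k: "1 \<le> k" "real k \<le> \<theta> * real n" and m: "real m \<le> c / 8 * real n" and n: "n \<ge> 4"
  shows "(G n m k)\<^sup>2 \<le> exp (8 * (real m)\<^sup>2 / (c * real n)) * G n (2 * m) k"
proof -
  have c: "0 < c" "c < 1" using theta_less_1 theta_pos by (auto simp: c_def)
  have n0: "real n \<ge> 4" using n by simp
  have cn: "c * real n \<le> 1 * real n" using c by (intro mult_right_mono) auto
  have m8: "real m \<le> real n / 8" using m cn by simp
  have kn: "k \<le> n" using k theta_less_1 mult_right_mono[of \<theta> 1 "real n"] by linarith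
  have mn: "m < n" "2 * m < n" using m8 n0 by linarith+
  define f where "f = (\<lambda>i. (real n - real k - real i) / (real n - 1 - real i))"
  \<comment> \<open>The exact quotient of \<open>f (m + i)\<close> by \<open>f i\<close> is
    \<open>1 - m * (B - A) / (A * (B - m))\<close> in the notation of \<open>step\<close>;
    \<open>\<rho>\<close> results from \<open>B - A \<le> n\<close>,
    \<open>A \<ge> c * n / 2\<close> and \<open>B - m \<ge> n / 2\<close>.\<close>
  define \<rho> where "\<rho> = 1 - 4 * real m / (c * real n)"
  have x: "4 * real m / (c * real n) \<le> 1 / 2" "0 \<le> 4 * real m / (c * real n)"
    using m c n0 by (auto simp: field_simps)
  have \<rho>: "\<rho> \<ge> 0" using x by (simp add: \<rho>_def)
  have bounds: "real n - real k - real i \<ge> c * real n / 2" "real n - 1 - real i - real m \<ge> real n / 2" if "i < m" for i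
  proof -
    have "c * real n = real n - \<theta> * real n" by (simp add: c_def algebra_simps)
    then show "real n - real k - real i \<ge> c * real n / 2" "real n - 1 - real i - real m \<ge> real n / 2"
      using that m m8 k n0 cn mult_nonneg_nonneg[of c "real n"] c by linarith+
  qed
  have f0: "f i \<ge> 0" if "i < m" for i
    using bounds[OF that] c n0 mult_nonneg_nonneg[of c "real n"] unfolding f_def
    by (intro divide_nonneg_nonneg) linarith+
  have step: "\<rho> * f i \<le> f (m + i)" if i: "i < m" for i
  proof -
    define A where "A = real n - real k - real i"
    define B where "B = real n - 1 - real i"
    have A: "A \<ge> c * real n / 2" and B: "B - real m \<ge> real n / 2" using bounds[OF i] by (auto simp: A_def B_def)
    have pos: "c * real n / 2 > 0" using c n0 by simp
    have Bp: "B - real m > 0" "B > 0" using B n0 by linarith+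
    have "real m * (B - A) \<le> real m * real n"
      using k kn by (intro mult_left_mono) (auto simp: A_def B_def)
    also have "\<dots> = 4 * real m / (c * real n) * (c * real n / 2 * (real n / 2))" using c n0 by (simp add: field_simps)
    also have "\<dots> \<le> 4 * real m / (c * real n) * (A * (B - real m))"
      using x A B pos n0 by (intro mult_left_mono mult_mono) auto
    also have "\<dots> = (1 - \<rho>) * (A * (B - real m))" by (simp add: \<rho>_def)
    finally have "\<rho> * (A * (B - real m)) \<le> (A - real m) * B" by (simp add: algebra_simps)
    then have "\<rho> * (A / B) \<le> (A - real m) / (B - real m)"
      using Bp by (simp add: field_simps)
    then show ?thesis by (simp add: f_def A_def B_def algebra_simps)
  qed
  define E where "E = exp (t * real m * real k / real n)"
  have E2: "exp (t * real (2 * m) * real k / real n) = E * E"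
    by (simp add: E_def exp_add [symmetric])
  have Gm: "G n m k = E * (\<Prod>i<m. f i)"
    unfolding E_def f_def by (rule G_eq_prod'[OF mn(1) k(1) kn])
  have G2m: "G n (2 * m) k = E * E * ((\<Prod>i<m. f i) * (\<Prod>i<m. f (m + i)))"
  proof -
    have "(\<Prod>i<m + m. f i) = (\<Prod>i<m. f i) * (\<Prod>i<m. f (m + i))"
      by (rule prod_lessThan_add)
    then show ?thesis
      using G_eq_prod'[OF mn(2) k(1) kn] unfolding E2 f_def by (simp add: mult_2)
  qed
  have rho_pow: "exp (- (8 * (real m)\<^sup>2 / (c * real n))) \<le> \<rho> ^ m"
  proof -
    have "exp (- (8 * (real m)\<^sup>2 / (c * real n))) = exp (- 2 * (4 * real m / (c * real n))) ^ m"
      by (simp add: exp_of_nat_mult [symmetric] power2_eq_square mult_ac)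
    also have "\<dots> \<le> \<rho> ^ m"
      unfolding \<rho>_def using x by (intro power_mono one_minus_ge_exp) auto
    finally show ?thesis .
  qed
  have P0: "(\<Prod>i<m. f i) \<ge> 0" using f0 by (intro prod_nonneg) auto
  have "\<rho> ^ m * (\<Prod>i<m. f i) = (\<Prod>i<m. \<rho> * f i)" by (simp add: prod.distrib)
  also have "\<dots> \<le> (\<Prod>i<m. f (m + i))" using step f0 \<rho> by (intro prod_mono) auto
  finally have "exp (- (8 * (real m)\<^sup>2 / (c * real n))) * (\<Prod>i<m. f i) \<le> (\<Prod>i<m. f (m + i))"
    using rho_pow P0 by (meson mult_right_mono order_trans)
  then have le: "(\<Prod>i<m. f i) \<le> exp (8 * (real m)\<^sup>2 / (c * real n)) * (\<Prod>i<m. f (m + i))"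
    by (simp add: exp_minus field_simps)
  have "(G n m k)\<^sup>2 = E * E * (\<Prod>i<m. f i) * (\<Prod>i<m. f i)" by (simp add: Gm power2_eq_square)
  also have "\<dots> \<le> E * E * (\<Prod>i<m. f i) * (exp (8 * (real m)\<^sup>2 / (c * real n)) * (\<Prod>i<m. f (m + i)))"
    using le P0 by (intro mult_left_mono) (auto simp: E_def)
  finally show ?thesis unfolding G2m by (simp add: mult_ac)
qed

lemma G_bound_above:
  fixes n m k :: nat
  assumes k: "k \<le> n" "\<theta> * real n \<le> real k" and m: "m < n"
  shows "G n m k \<le> exp 1"
proof -
  have n0: "n > 0" using m by simp
  have k1: "1 \<le> k"
  proof -
    have "0 < \<theta> * real n" using theta_pos n0 by simp
    then show ?thesis using k by linarith
  qed
  show ?thesis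
  proof (cases "k > n - m")
    case True
    then show ?thesis using G_eq_0[OF m k1] by simp
  next
    case False
    then have km: "real k + real m \<le> real n" using m by linarith
    show ?thesis
    proof (cases "m = 0")
      case True
      then show ?thesis using k1 k m by (simp add: G_eq_prod')
    next
      case m0: False
      then have n1: "real n - 1 > 0" using m by linarith
      have fac: "0 \<le> (real n - real k - real i) / (real n - 1 - real i) \<and>
        (real n - real k - real i) / (real n - 1 - real i) \<le> (real n - real k) / (real n - 1)" if "i < m" for i
      proof -
        have p: "real n - 1 - real i > 0" "real n - real k - real i \<ge> 0" using that m km k1 by linarith+
        have "real i * (real k - 1) \<ge> 0" using k1 by simp
        then have "(real n - real k - real i) * (real n - 1) \<le> (real n - real k) * (real n - 1 - real i)"
          by (simp add: algebra_simps)
        then show ?thesis using p n1 by (simp add: field_simps)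
      qed
      have "(\<Prod>i<m. (real n - real k - real i) / (real n - 1 - real i)) \<le> (\<Prod>i<m. (real n - real k) / (real n - 1))"
        using fac by (intro prod_mono) auto
      then have "G n m k \<le> exp (t * real m * real k / real n) * ((real n - real k) / (real n - 1)) ^ m"
        unfolding G_eq_prod'[OF m k1 k(1)] by (intro mult_left_mono) auto
      also have "exp (t * real m * real k / real n) = exp (t * (real k / real n)) ^ m"
        by (simp add: exp_of_nat_mult [symmetric] mult_ac)
      also have "exp (t * (real k / real n)) ^ m * ((real n - real k) / (real n - 1)) ^ m
         = (h (real k / real n) * (1 + 1 / (real n - 1))) ^ m"
      proof -
        have "(real n - real k) / (real n - 1) = (1 - real k / real n) * (1 + 1 / (real n - 1))"
          using n1 n0 by (simp add: field_simps)
        then show ?thesis by (simp add: h_def power_mult_distrib mult.assoc)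
      qed
      also have "\<dots> \<le> (1 * exp (1 / (real n - 1))) ^ m"
      proof (intro power_mono mult_mono)
        have "\<theta> \<le> real k / real n" "real k / real n \<le> 1" using k n0 by (auto simp: field_simps)
        then show "h (real k / real n) \<le> 1" "0 \<le> h (real k / real n) * (1 + 1 / (real n - 1))"
          using h_less_1[of "real k / real n"] h_theta n1 by (cases "\<theta> = real k / real n"; auto simp: h_def)+
      qed (use n1 exp_ge_add_one_self[of "1 / (real n - 1)"] in auto)
      also have "\<dots> = exp (real m / (real n - 1))" by (simp add: exp_of_nat_mult [symmetric])
      also have "\<dots> \<le> exp 1" using m n1 by (simp add: field_simps)
      finally show ?thesis .
    qed
  qed
qed

lemma G_square_bound:
  assumes "\<kappa> \<ge> 0"
  obtains C where "C \<ge> 0" "eventually (\<lambda>n. \<forall>k\<in>{1..n}. (G n (ms \<kappa> n) k)\<^sup>2 \<le> C * G n (2 * ms \<kappa> n) k + (exp 1)\<^sup>2) sequentially"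
proof -
  define c where "c = 1 - \<theta>"
  have c: "c > 0" using theta_less_1 by (simp add: c_def)
  then have c8: "c / 8 > 0" by simp
  define C where "C = exp (8 * \<kappa>\<^sup>2 / c)"
  have "eventually (\<lambda>n. \<forall>k\<in>{1..n}. (G n (ms \<kappa> n) k)\<^sup>2 \<le> C * G n (2 * ms \<kappa> n) k + (exp 1)\<^sup>2) sequentially"
    using ms_le_eventually[OF assms c8] ms_less_eventually[OF assms] eventually_ge_at_top[of 4]
  proof eventually_elim
    case (elim n)
    show ?case
    proof
      fix k assume k: "k \<in> {1..n}"
      show "(G n (ms \<kappa> n) k)\<^sup>2 \<le> C * G n (2 * ms \<kappa> n) k + (exp 1)\<^sup>2"
      proof (cases "real k \<le> \<theta> * real n")
        case True
        have "(G n (ms \<kappa> n) k)\<^sup>2 \<le> exp (8 * (real (ms \<kappa> n))\<^sup>2 / (c * real n)) * G n (2 * ms \<kappa> n) k"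
          unfolding c_def by (rule G_square_bound_below) (use k elim True in \<open>auto simp: c_def\<close>)
        also have "\<dots> \<le> C * G n (2 * ms \<kappa> n) k"
        proof (intro mult_right_mono G_nonneg)
          have "8 * (real (ms \<kappa> n))\<^sup>2 / (c * real n) \<le> 8 * (\<kappa>\<^sup>2 * real n) / (c * real n)"
            using ms_square_le[OF assms, of n] c by (intro divide_right_mono) auto
          also have "\<dots> = 8 * \<kappa>\<^sup>2 / c" using elim by simp
          finally show "exp (8 * (real (ms \<kappa> n))\<^sup>2 / (c * real n)) \<le> C" by (simp add: C_def)
        qed
        finally show ?thesis by (rule add_increasing2[rotated]) simp
      next
        case False
        have "(G n (ms \<kappa> n) k)\<^sup>2 \<le> (exp 1)\<^sup>2"
          using G_bound_above[of k n "ms \<kappa> n"] k False elim by (intro power_mono G_nonneg) auto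
        then show ?thesis by (rule add_increasing[rotated]) (auto simp: C_def intro!: mult_nonneg_nonneg G_nonneg)
      qed
    qed
  qed
  then show ?thesis by (intro that[of C]) (auto simp: C_def)
qed

text \<open>Uniform integrability: the second moment of \<open>G n m\<close> is controlled by the first moment of \<open>G n (2 * m)\<close>.\<close>

lemma negligible_G_tendsto:
  assumes "\<kappa> \<ge> 0" and A: "\<And>n. A n \<subseteq> {1..n}" and lim: "(\<lambda>n. \<Sum>k\<in>A n. mu n k) \<longlonglongrightarrow> 0"
  shows "(\<lambda>n. \<Sum>k\<in>A n. mu n k * G n (ms \<kappa> n) k) \<longlonglongrightarrow> 0"
proof (rule order_tendstoI)
  fix y :: real assume "y < 0"
  moreover have "(\<Sum>k\<in>A n. mu n k * G n (ms \<kappa> n) k) \<ge> 0" for n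
    by (intro sum_nonneg mult_nonneg_nonneg mu_nonneg G_nonneg)
  ultimately show "eventually (\<lambda>n. y < (\<Sum>k\<in>A n. mu n k * G n (ms \<kappa> n) k)) sequentially"
    by (intro always_eventually allI) (rule less_le_trans)
next
  fix y :: real assume y: "0 < y"
  obtain C where C: "C \<ge> 0" "eventually (\<lambda>n. \<forall>k\<in>{1..n}. (G n (ms \<kappa> n) k)\<^sup>2 \<le> C * G n (2 * ms \<kappa> n) k + (exp 1)\<^sup>2) sequentially"
    using G_square_bound[OF assms(1)] by blast
  define D where "D = C + (exp 1)\<^sup>2"
  have D: "D > 0" using C(1) by (simp add: D_def add_nonneg_pos)
  \<comment> \<open>Truncation level for \<open>tr\<close>: the square part costs at most
    \<open>D / L = y / 2\<close> on any set, and the part bounded by \<open>L\<close> vanishes with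
    the mass.\<close>
  define L where "L = 2 * D / y"
  have L: "L > 0" using D y by (simp add: L_def)
  have "(\<lambda>n. L * (\<Sum>k\<in>A n. mu n k)) \<longlonglongrightarrow> L * 0" by (intro tendsto_intros lim)
  then have e1: "eventually (\<lambda>n. L * (\<Sum>k\<in>A n. mu n k) < y / 2) sequentially"
    by (rule order_tendstoD(2)) (use y in simp)
  have e2: "eventually (\<lambda>n. 2 * ms \<kappa> n < n) sequentially"
    using ms_le_eventually[OF assms(1), of "1/4", simplified] eventually_gt_at_top[of 0]
    by eventually_elim linarith
  show "eventually (\<lambda>n. (\<Sum>k\<in>A n. mu n k * G n (ms \<kappa> n) k) < y) sequentially"
    using C(2) e1 e2
  proof eventually_elim
    case (elim n)
    let ?g = "\<lambda>k. G n (ms \<kappa> n) k"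
    have tr: "?g k \<le> (?g k)\<^sup>2 / L + L" for k
    proof (cases "?g k \<le> L")
      case True
      then show ?thesis using L by (simp add: add_increasing)
    next
      case False
      then have "L * ?g k \<le> (?g k)\<^sup>2" using L by (simp add: power2_eq_square)
      then have "?g k \<le> (?g k)\<^sup>2 / L" using L by (simp add: field_simps)
      then show ?thesis using L by linarith
    qed
    have "(\<Sum>k\<in>A n. mu n k * ?g k) \<le> (\<Sum>k\<in>A n. mu n k * ((C * G n (2 * ms \<kappa> n) k + (exp 1)\<^sup>2) / L + L))"
    proof (intro sum_mono mult_left_mono mu_nonneg)
      fix k assume "k \<in> A n"
      then have "(?g k)\<^sup>2 / L \<le> (C * G n (2 * ms \<kappa> n) k + (exp 1)\<^sup>2) / L"
        using elim(1) A L by (intro divide_right_mono) auto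
      then show "?g k \<le> (C * G n (2 * ms \<kappa> n) k + (exp 1)\<^sup>2) / L + L" using tr[of k] by linarith
    qed
    also have "\<dots> = C / L * (\<Sum>k\<in>A n. mu n k * G n (2 * ms \<kappa> n) k) + (exp 1)\<^sup>2 / L * (\<Sum>k\<in>A n. mu n k) + L * (\<Sum>k\<in>A n. mu n k)"
      by (rule sum_linear_combination)
    also have "\<dots> \<le> C / L * 1 + (exp 1)\<^sup>2 / L * 1 + L * (\<Sum>k\<in>A n. mu n k)"
      using C(1) L by (intro add_mono mult_left_mono sum_mu_G_le_1 sum_mu_le_1 A elim(3)) auto
    also have "\<dots> = y / 2 + L * (\<Sum>k\<in>A n. mu n k)"
    proof -
      have "C / L * 1 + (exp 1)\<^sup>2 / L * 1 = D / L" by (simp add: D_def add_divide_distrib)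
      also have "\<dots> = y / 2" using D y by (simp add: L_def)
      finally show ?thesis by simp
    qed
    also have "\<dots> < y" using elim(2) by simp
    finally show ?case .
  qed
qed

end

lemma abs_ln_one_minus_le:
  fixes u :: real
  assumes "0 \<le> u" "u \<le> 1 / 2" shows "\<bar>ln (1 - u) + u\<bar> \<le> 2 * u\<^sup>2"
  using abs_ln_one_plus_x_minus_x_bound[of "- u"] assms by simp

lemma sum_lessThan_linear:
  fixes b c :: real
  shows "(\<Sum>i<m. real i * b - real (Suc i) * c) =
    (real m)\<^sup>2 / 2 * (b - c) - real m / 2 * (b + c)"
  by (induction m) (auto simp: power2_eq_square field_simps)

section \<open>Expansion of the tilt near the giant size\<close>

context supercritical_cut
begin

text \<open>The window shrinks, so that \<open>phi t X\<close> tends to 0 uniformly in it, but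
  slowly enough: \<open>n * (n powr (- (1/4)))\<^sup>2\<close> is \<open>sqrt n\<close>, so the
  Chebyshev bound still makes its complement among the large sizes negligible.\<close>

definition bulk :: "nat \<Rightarrow> nat set" where
  "bulk n = {k \<in> large \<delta> n. \<bar>h (real k / real n) - 1\<bar> \<le> real n powr (- (1 / 4))}"

lemma bulk_subset: "bulk n \<subseteq> large \<delta> n" "bulk n \<subseteq> {1..n}" "finite (bulk n)"
  using small_large[of \<delta> n] by (auto simp: bulk_def intro: finite_subset)

lemma outside_bulk_tendsto: "(\<lambda>n. \<Sum>k\<in>large \<delta> n - bulk n. mu n k) \<longlonglongrightarrow> 0"
proof (rule tendsto_sandwich[of "\<lambda>_. 0" _ _ "\<lambda>n. exp (2 * t) / (real n * (real n powr (- (1 / 4)))\<^sup>2)"])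
  show "eventually (\<lambda>n. (\<Sum>k\<in>large \<delta> n - bulk n. mu n k) \<le> exp (2 * t) / (real n * (real n powr (- (1 / 4)))\<^sup>2)) sequentially"
    using eventually_ge_at_top[of 3]
  proof eventually_elim
    case (elim n)
    have "(\<Sum>k\<in>large \<delta> n - bulk n. mu n k) \<le> (\<Sum>k | k \<in> {1..n} \<and> \<bar>h (real k / real n) - 1\<bar> > real n powr (- (1 / 4)). mu n k)"
      by (intro sum_mono2 mu_nonneg) (auto simp: bulk_def large_def)
    also have "\<dots> \<le> exp (2 * t) / (real n * (real n powr (- (1 / 4)))\<^sup>2)"
      using elim by (intro sum_mu_h_deviation) auto
    finally show ?case .
  qed
  show "(\<lambda>n. exp (2 * t) / (real n * (real n powr (- (1 / 4)))\<^sup>2)) \<longlonglongrightarrow> 0" by real_asymp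
qed (auto intro!: always_eventually sum_nonneg mu_nonneg)

lemma bulk_G_tendsto:
  assumes "\<kappa> \<ge> 0"
  shows "(\<lambda>n. \<Sum>k\<in>bulk n. mu n k * G n (ms \<kappa> n) k) \<longlonglongrightarrow> \<theta>"
proof -
  have "(\<lambda>n. (\<Sum>k\<in>large \<delta> n. mu n k * G n (ms \<kappa> n) k) - (\<Sum>k\<in>large \<delta> n - bulk n. mu n k * G n (ms \<kappa> n) k)) \<longlonglongrightarrow> \<theta> - 0"
    using small_large(6) by (intro tendsto_diff large_G_tendsto negligible_G_tendsto outside_bulk_tendsto assms) blast+
  moreover have "(\<Sum>k\<in>large \<delta> n. mu n k * G n (ms \<kappa> n) k) - (\<Sum>k\<in>large \<delta> n - bulk n. mu n k * G n (ms \<kappa> n) k)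
     = (\<Sum>k\<in>bulk n. mu n k * G n (ms \<kappa> n) k)" for n
    using sum.subset_diff[OF bulk_subset(1) small_large(4), of "\<lambda>k. mu n k * G n (ms \<kappa> n) k"] by simp
  ultimately show ?thesis by simp
qed

lemma bulk_near:
  assumes "\<epsilon> > 0"
  shows "eventually (\<lambda>n. \<forall>k\<in>bulk n. \<bar>real k / real n - \<theta>\<bar> < \<epsilon>) sequentially"
proof -
  obtain \<eta> where \<eta>: "\<eta> > 0" "\<And>x. min \<epsilon> \<delta> \<le> x \<Longrightarrow> x \<le> 1 \<Longrightarrow> \<bar>h x - 1\<bar> \<le> \<eta> \<Longrightarrow> \<bar>x - \<theta>\<bar> < min \<epsilon> \<delta>"
    using h_close_1_imp[of "min \<epsilon> \<delta>"] assms \<delta>_pos by (metis min_less_iff_conj)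
  have "(\<lambda>n. real n powr (- (1 / 4))) \<longlonglongrightarrow> 0" by real_asymp
  from order_tendstoD(2)[OF this \<eta>(1)] eventually_gt_at_top[of 0]
  show ?thesis
  proof eventually_elim
    case (elim n)
    show ?case
    proof
      fix k assume k: "k \<in> bulk n"
      then have "\<delta> \<le> real k / real n" "real k / real n \<le> 1"
        using elim by (auto simp: bulk_def large_def field_simps)
      moreover have "\<bar>h (real k / real n) - 1\<bar> \<le> \<eta>" using k elim by (auto simp: bulk_def)
      ultimately show "\<bar>real k / real n - \<theta>\<bar> < \<epsilon>" using \<eta>(2)[of "real k / real n"] by auto
    qed
  qed
qed

text \<open>Each factor is \<open>(1 - X) * (1 - u i) / (1 - w i)\<close>. The constants
  \<open>1 - X\<close> combine with the exponential to \<open>- m * phi t X\<close>; the sum of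
  \<open>w i - u i\<close> yields the quadratic term, since
  \<open>1 / (1 - X) - 1 = X / (1 - X)\<close>; the rest consists of a first order boundary term and
  the Taylor remainders.\<close>

lemma ln_G_approx:
  fixes n m k :: nat
  defines "X \<equiv> real k / real n"
  assumes k: "1 \<le> k" "k \<le> n" and d: "0 < d" "d \<le> 1" "d \<le> 1 - X" and m: "2 * real m \<le> d * real n" and n: "0 < n"
  shows "G n m k > 0"
    and "\<bar>ln (G n m k) + real m * phi t X + (real m)\<^sup>2 / real n / 2 * (X / (1 - X))\<bar>
      \<le> real m / (real n * d) + 4 * real m * (real m / (real n * d))\<^sup>2"
proof -
  have n0: "real n > 0" using n by simp
  define u where "u = (\<lambda>i::nat. real i * (1 / (real n * (1 - X))))"
  \<comment> \<open>\<open>Suc i\<close> here against \<open>i\<close> in \<open>u\<close>, because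
    the denominators are \<open>n - 1 - i\<close>: the fixed vertex is not among those to be
    chosen.\<close>
  define w where "w = (\<lambda>i::nat. real (Suc i) * (1 / real n))"
  define q where "q = real m / (real n * d)"
  have X1: "1 - X > 0" using d by linarith
  have dn: "d * real n \<le> 1 * real n" using d n0 by (intro mult_right_mono) auto
  have mn: "m < n" using m dn n0 by linarith
  have q: "q \<le> 1 / 2" "q \<ge> 0" using m d n0 by (auto simp: q_def field_simps)
  have uw: "0 \<le> u i" "u i \<le> q" "0 \<le> w i" "w i \<le> q" if i: "i < m" for i
  proof -
    have "real i * (1 / (real n * (1 - X))) \<le> real m * (1 / (real n * d))"
      using i d n0 by (intro mult_mono divide_left_mono) auto
    then show "u i \<le> q" by (simp add: u_def q_def)
    have "real (Suc i) * (1 / real n) \<le> real m * (1 / (real n * d))"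
      using i d n0 by (intro mult_mono divide_left_mono) auto
    then show "w i \<le> q" by (simp add: w_def q_def)
  qed (use X1 n0 in \<open>auto simp: u_def w_def\<close>)
  have fac: "(real n - real k - real i) / (real n - 1 - real i) = (1 - X) * ((1 - u i) / (1 - w i))"
    "1 - u i > 0" "1 - w i > 0" if i: "i < m" for i
  proof -
    show p: "1 - u i > 0" "1 - w i > 0" using uw[OF i] q by linarith+
    have "real n * ((1 - X) * (1 - u i)) = real n - real k - real i"
    proof -
      have "(1 - X) * u i = real i / real n" using X1 by (simp add: u_def)
      moreover have "real n * ((1 - X) * (1 - u i)) = real n * (1 - X) - real n * ((1 - X) * u i)"
        by (simp add: algebra_simps)
      ultimately have "real n * ((1 - X) * (1 - u i)) = real n * (1 - X) - real n * (real i / real n)"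
        by (simp only:)
      also have "real n * (1 - X) = real n - real k" using n0 by (simp add: X_def field_simps)
      finally show ?thesis using n0 by simp
    qed
    moreover have "real n * (1 - w i) = real n - 1 - real i" using n0 by (simp add: w_def field_simps)
    ultimately have "(real n - real k - real i) / (real n - 1 - real i) = (real n * ((1 - X) * (1 - u i))) / (real n * (1 - w i))"
      by simp
    then show "(real n - real k - real i) / (real n - 1 - real i) = (1 - X) * ((1 - u i) / (1 - w i))"
      using n0 by simp
  qed
  have G: "G n m k = exp (t * real m * X) * (\<Prod>i<m. (1 - X) * ((1 - u i) / (1 - w i)))"
    unfolding G_eq_prod'[OF mn k] X_def using fac(1) by (simp add: X_def)
  have pp: "(\<Prod>i<m. (1 - X) * ((1 - u i) / (1 - w i))) > 0"
    using fac(2,3) X1 by (intro prod_pos) auto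
  show "G n m k > 0" unfolding G using pp by simp
  have "ln (G n m k) = t * real m * X + ln (\<Prod>i<m. (1 - X) * ((1 - u i) / (1 - w i)))"
    unfolding G using ln_mult_pos[OF exp_gt_zero pp] by simp
  also have "ln (\<Prod>i<m. (1 - X) * ((1 - u i) / (1 - w i))) = (\<Sum>i<m. ln ((1 - X) * ((1 - u i) / (1 - w i))))"
  proof (rule ln_prod)
    fix i assume "i \<in> {..<m}"
    with fac(2,3)[of i] X1 have "(1 - X) * ((1 - u i) / (1 - w i)) > 0" by simp
    then show "(1 - X) * ((1 - u i) / (1 - w i)) \<noteq> 0" by (rule less_imp_neq[THEN not_sym])
  qed auto
  also have "\<dots> = (\<Sum>i<m. ln (1 - X) + (ln (1 - u i) - ln (1 - w i)))"
  proof (intro sum.cong refl)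
    fix i assume "i \<in> {..<m}"
    then have "1 - u i > 0" "1 - w i > 0" using fac(2,3)[of i] by auto
    then show "ln ((1 - X) * ((1 - u i) / (1 - w i))) = ln (1 - X) + (ln (1 - u i) - ln (1 - w i))"
      using ln_mult_pos[OF X1, of "(1 - u i) / (1 - w i)"] ln_divide_pos[of "1 - u i" "1 - w i"] by simp
  qed
  also have "\<dots> = real m * ln (1 - X) + (\<Sum>i<m. ln (1 - u i) - ln (1 - w i))"
    by (simp add: sum.distrib)
  finally have lnG: "ln (G n m k) + real m * phi t X = (\<Sum>i<m. ln (1 - u i) - ln (1 - w i))"
    by (simp add: phi_def algebra_simps)
  define b where "b = 1 / (real n * (1 - X))"
  define c where "c = 1 / real n"
  have suw: "(\<Sum>i<m. u i - w i) = (real m)\<^sup>2 / 2 * (b - c) - real m / 2 * (b + c)"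
    unfolding u_def w_def b_def c_def by (rule sum_lessThan_linear)
  have bc: "b - c = X / (1 - X) / real n" using X1 n0 by (simp add: b_def c_def field_simps)
  have main: "(real m)\<^sup>2 / real n / 2 * (X / (1 - X)) = (\<Sum>i<m. u i - w i) + real m / 2 * (b + c)"
    unfolding suw bc by simp
  have err: "\<bar>\<Sum>i<m. (ln (1 - u i) + u i) - (ln (1 - w i) + w i)\<bar> \<le> (\<Sum>i<m. 4 * q\<^sup>2)"
  proof (intro order_trans[OF sum_abs] sum_mono)
    fix i assume "i \<in> {..<m}"
    then have i: "i < m" by simp
    have "\<bar>ln (1 - u i) + u i\<bar> \<le> 2 * (u i)\<^sup>2" "\<bar>ln (1 - w i) + w i\<bar> \<le> 2 * (w i)\<^sup>2"
      using uw[OF i] q by (intro abs_ln_one_minus_le; linarith)+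
    moreover have "(u i)\<^sup>2 \<le> q\<^sup>2" "(w i)\<^sup>2 \<le> q\<^sup>2" using uw[OF i] by (auto intro: power_mono)
    ultimately show "\<bar>(ln (1 - u i) + u i) - (ln (1 - w i) + w i)\<bar> \<le> 4 * q\<^sup>2" by linarith
  qed
  have bq: "0 \<le> real m / 2 * (b + c)" "real m / 2 * (b + c) \<le> q"
  proof -
    have "b \<le> 1 / (real n * d)" unfolding b_def using d n0 by (intro divide_left_mono) auto
    moreover have "c \<le> 1 / (real n * d)" unfolding c_def using d n0 by (intro divide_left_mono) auto
    ultimately have "b + c \<le> 1 / (real n * d) + 1 / (real n * d)" by (rule add_mono)
    then have "b + c \<le> 2 * (1 / (real n * d))" by (simp add: mult.commute)
    then have "real m / 2 * (b + c) \<le> real m / 2 * (2 * (1 / (real n * d)))"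
      by (intro mult_left_mono) auto
    then show "real m / 2 * (b + c) \<le> q" by (simp add: q_def)
    show "0 \<le> real m / 2 * (b + c)" using X1 n0 by (simp add: b_def c_def)
  qed
  have "ln (G n m k) + real m * phi t X + (real m)\<^sup>2 / real n / 2 * (X / (1 - X)) =
      (\<Sum>i<m. (ln (1 - u i) + u i) - (ln (1 - w i) + w i)) + real m / 2 * (b + c)"
    unfolding lnG main by (simp add: sum.distrib sum_subtractf)
  then show "\<bar>ln (G n m k) + real m * phi t X + (real m)\<^sup>2 / real n / 2 * (X / (1 - X))\<bar>
      \<le> real m / (real n * d) + 4 * real m * (real m / (real n * d))\<^sup>2"
  proof -
    have "(\<Sum>i<m. 4 * q\<^sup>2) = 4 * real m * q\<^sup>2" by simp
    with err bq \<open>ln (G n m k) + _ + _ = _\<close> show ?thesis unfolding q_def [symmetric] by linarith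
  qed
qed

lemma phi_eq_ln_h: "x < 1 \<Longrightarrow> phi t x = - ln (h x)"
  using ln_mult_pos[of "exp (t * x)" "1 - x"] by (simp add: phi_def h_def)

text \<open>The value at \<open>\<theta>\<close> of \<open>X / (1 - X)\<close> from
  \<open>ln_G_approx\<close>, and the limiting variance of \<open>sqrt n * phi t X\<close> in the
  bulk.\<close>

definition v :: real where "v = \<theta> / (1 - \<theta>)"

lemma v_pos: "v > 0"
  using theta_pos theta_less_1 by (simp add: v_def)

text \<open>Four errors of at most \<open>\<epsilon> / 4\<close> each: the expansion of the
  logarithm, the rounding of \<open>m\<close>, the replacement of \<open>m\<^sup>2 / n\<close> by
  \<open>\<kappa>\<^sup>2\<close>, and that of \<open>X / (1 - X)\<close> by
  \<open>v\<close>.\<close>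

lemma ln_G_bulk:
  assumes "\<kappa> \<ge> 0" "\<epsilon> > 0"
  shows "eventually (\<lambda>n. \<forall>k\<in>bulk n. G n (ms \<kappa> n) k > 0 \<and>
    \<bar>ln (G n (ms \<kappa> n) k) + \<kappa> * (sqrt (real n) * phi t (real k / real n)) + \<kappa>\<^sup>2 / 2 * v\<bar> \<le> \<epsilon>) sequentially"
proof -
  define d where "d = (1 - \<theta>) / 2"
  have d: "0 < d" "d \<le> 1" "1 - \<theta> = 2 * d" using theta_less_1 theta_pos by (auto simp: d_def)
  define m where "m = (\<lambda>n. ms \<kappa> n)"
  have msn: "(\<lambda>n. real (m n) / sqrt (real n)) \<longlonglongrightarrow> \<kappa>" unfolding m_def by (rule ms_div_sqrt_tendsto[OF assms(1)])
  have "(\<lambda>n. (real (m n) / sqrt (real n))\<^sup>2) \<longlonglongrightarrow> \<kappa>\<^sup>2" by (intro tendsto_intros msn)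
  then have m2: "(\<lambda>n. (real (m n))\<^sup>2 / real n) \<longlonglongrightarrow> \<kappa>\<^sup>2" by (simp add: power_divide)
  have e1: "eventually (\<lambda>n. real (m n) / (real n * d) + 4 * real (m n) * (real (m n) / (real n * d))\<^sup>2 < \<epsilon> / 4) sequentially"
  proof (rule order_tendstoD(2))
    have "(\<lambda>n. (real (m n) / sqrt (real n)) * (1 / sqrt (real n)) / d + 4 * (real (m n) / sqrt (real n)) ^ 3 * (1 / sqrt (real n)) / d\<^sup>2)
       \<longlonglongrightarrow> \<kappa> * 0 / d + 4 * \<kappa> ^ 3 * 0 / d\<^sup>2"
    proof (intro tendsto_intros msn)
      show "(\<lambda>n. 1 / sqrt (real n)) \<longlonglongrightarrow> 0" by real_asymp
      then show "(\<lambda>n. 1 / sqrt (real n)) \<longlonglongrightarrow> 0" .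
    qed (use d in auto)
    moreover have "(real (m n) / sqrt (real n)) * (1 / sqrt (real n)) / d + 4 * (real (m n) / sqrt (real n)) ^ 3 * (1 / sqrt (real n)) / d\<^sup>2
       = real (m n) / (real n * d) + 4 * real (m n) * (real (m n) / (real n * d))\<^sup>2" for n
    proof -
      have "sqrt (real n) ^ 3 * sqrt (real n) = (sqrt (real n) * sqrt (real n)) * (sqrt (real n) * sqrt (real n))"
        by (simp only: power3_eq_cube mult_ac)
      then have s4: "sqrt (real n) ^ 3 * sqrt (real n) = (real n)\<^sup>2" by (simp add: power2_eq_square)
      have "(real (m n) / sqrt (real n)) * (1 / sqrt (real n)) / d = real (m n) / (real n * d)" by simp
      moreover have "4 * (real (m n) / sqrt (real n)) ^ 3 * (1 / sqrt (real n)) / d\<^sup>2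
          = 4 * real (m n) ^ 3 / (sqrt (real n) ^ 3 * sqrt (real n)) / d\<^sup>2"
        by (simp add: power_divide)
      moreover have "\<dots> = 4 * real (m n) * (real (m n) / (real n * d))\<^sup>2"
        unfolding s4 by (simp add: power_divide power_mult_distrib power2_eq_square power3_eq_cube mult_ac)
      ultimately show ?thesis by simp
    qed
    ultimately show "(\<lambda>n. real (m n) / (real n * d) + 4 * real (m n) * (real (m n) / (real n * d))\<^sup>2) \<longlonglongrightarrow> 0" by simp
  qed (use assms in auto)
  have "(\<lambda>n. real n powr (- (1 / 4))) \<longlonglongrightarrow> 0" by real_asymp
  then have e2: "eventually (\<lambda>n. real n powr (- (1 / 4)) < min (1/2) (\<epsilon> / 8)) sequentially"
    by (rule order_tendstoD(2)) (use assms in auto)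
  have "(\<lambda>n. \<bar>(real (m n))\<^sup>2 / real n - \<kappa>\<^sup>2\<bar> / d) \<longlonglongrightarrow> \<bar>\<kappa>\<^sup>2 - \<kappa>\<^sup>2\<bar> / d"
    by (intro tendsto_intros m2) (use d in auto)
  then have e3: "eventually (\<lambda>n. \<bar>(real (m n))\<^sup>2 / real n - \<kappa>\<^sup>2\<bar> / d < \<epsilon> / 4) sequentially"
    by (rule order_tendstoD(2)) (use assms in auto)
  have "isCont (\<lambda>x. \<kappa>\<^sup>2 / 2 * (x / (1 - x))) \<theta>"
    using theta_less_1 by (intro continuous_intros) auto
  then obtain \<eta> where \<eta>: "\<eta> > 0"
    "\<And>x. dist x \<theta> < \<eta> \<Longrightarrow> dist (\<kappa>\<^sup>2 / 2 * (x / (1 - x))) (\<kappa>\<^sup>2 / 2 * (\<theta> / (1 - \<theta>))) < \<epsilon> / 4"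
    using assms(2) unfolding continuous_at_eps_delta by (metis divide_pos_pos zero_less_numeral)
  have d2: "d / 2 > 0" using d by simp
  show ?thesis
    using e1 e2 e3 ms_le_eventually[OF assms(1) d2] bulk_near[OF \<eta>(1)] bulk_near[OF d(1)] eventually_gt_at_top[of 0]
  proof eventually_elim
    case (elim n)
    have n: "real n > 0" using elim by simp
    have md: "2 * real (m n) \<le> d * real n" using elim by (simp add: m_def)
    show ?case
    proof
      fix k assume kb: "k \<in> bulk n"
      define X where "X = real k / real n"
      have k: "1 \<le> k" "k \<le> n" using subsetD[OF bulk_subset(2) kb] by auto
      have near: "\<bar>X - \<theta>\<bar> < d" "\<bar>X - \<theta>\<bar> < \<eta>" using elim kb by (auto simp: X_def)
      have X: "d \<le> 1 - X" "0 \<le> X" "X < 1" using near d by (auto simp: X_def)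
      have hX: "\<bar>h X - 1\<bar> \<le> min (1/2) (\<epsilon> / 8)" using kb elim by (auto simp: bulk_def X_def)
      have A: "G n (m n) k > 0" "\<bar>ln (G n (m n) k) + real (m n) * phi t X + (real (m n))\<^sup>2 / real n / 2 * (X / (1 - X))\<bar> \<le> \<epsilon> / 4"
      proof -
        have dX: "d \<le> 1 - real k / real n" and n0: "0 < n" using X n by (auto simp: X_def)
        note B = ln_G_approx[OF k d(1,2) dX md n0, folded X_def]
        show "G n (m n) k > 0" by (rule B)
        show "\<bar>ln (G n (m n) k) + real (m n) * phi t X + (real (m n))\<^sup>2 / real n / 2 * (X / (1 - X))\<bar> \<le> \<epsilon> / 4"
          using B(2) elim(1) by linarith
      qed
      \<comment> \<open>\<open>phi t X = - ln (h X)\<close> is small in the bulk, so replacing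
        \<open>m\<close> by \<open>\<kappa> * sqrt n\<close>, a change of at most 1, is
        harmless.\<close>
      have phiX: "\<bar>phi t X\<bar> \<le> \<epsilon> / 4"
      proof -
        have "\<bar>ln (1 + (h X - 1)) - (h X - 1)\<bar> \<le> 2 * (h X - 1)\<^sup>2"
          by (rule abs_ln_one_plus_x_minus_x_bound) (use hX in auto)
        moreover have "2 * (h X - 1)\<^sup>2 \<le> \<bar>h X - 1\<bar>"
        proof -
          have "\<bar>h X - 1\<bar> * \<bar>h X - 1\<bar> \<le> 1/2 * \<bar>h X - 1\<bar>" using hX by (intro mult_right_mono) auto
          then show ?thesis by (simp add: power2_eq_square)
        qed
        moreover have "1 + (h X - 1) = h X" by simp
        moreover have "\<bar>p\<bar> \<le> 2 * \<bar>q\<bar>" if "\<bar>p - q\<bar> \<le> r" "r \<le> \<bar>q\<bar>" for p q r :: real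
          using that by linarith
        ultimately have "\<bar>ln (h X)\<bar> \<le> 2 * \<bar>h X - 1\<bar>" by metis
        then show ?thesis using hX phi_eq_ln_h[OF X(3)] by simp
      qed
      have B: "\<bar>real (m n) * phi t X - \<kappa> * (sqrt (real n) * phi t X)\<bar> \<le> \<epsilon> / 4"
      proof -
        have "real (m n) * phi t X - \<kappa> * (sqrt (real n) * phi t X) = (real (m n) - \<kappa> * sqrt (real n)) * phi t X"
          by (simp add: algebra_simps)
        moreover have "\<bar>real (m n) - \<kappa> * sqrt (real n)\<bar> \<le> 1"
          using ms_bounds[OF assms(1), of n] by (simp add: m_def)
        from mult_right_mono[OF this abs_ge_zero[of "phi t X"]]
        have "\<bar>(real (m n) - \<kappa> * sqrt (real n)) * phi t X\<bar> \<le> 1 * \<bar>phi t X\<bar>" by (simp only: abs_mult)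
        ultimately have "\<bar>real (m n) * phi t X - \<kappa> * (sqrt (real n) * phi t X)\<bar> \<le> 1 * \<bar>phi t X\<bar>"
          by (simp only:)
        then show ?thesis using phiX by simp
      qed
      have C: "\<bar>(real (m n))\<^sup>2 / real n / 2 * (X / (1 - X)) - \<kappa>\<^sup>2 / 2 * (X / (1 - X))\<bar> \<le> \<epsilon> / 4"
      proof -
        have XX: "0 \<le> X / (1 - X)" "X / (1 - X) \<le> 1 / d" using X d by (auto intro: frac_le)
        have "\<bar>(real (m n))\<^sup>2 / real n / 2 * (X / (1 - X)) - \<kappa>\<^sup>2 / 2 * (X / (1 - X))\<bar> =
            \<bar>(real (m n))\<^sup>2 / real n - \<kappa>\<^sup>2\<bar> / 2 * (X / (1 - X))"
        proof -
          have "(real (m n))\<^sup>2 / real n / 2 * (X / (1 - X)) - \<kappa>\<^sup>2 / 2 * (X / (1 - X)) =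
            ((real (m n))\<^sup>2 / real n - \<kappa>\<^sup>2) / 2 * (X / (1 - X))"
            by (simp only: left_diff_distrib diff_divide_distrib)
          then show ?thesis 
            by (simp only: abs_mult abs_of_nonneg[OF XX(1)]) (simp only: abs_divide abs_numeral)
        qed
        also have "\<dots> \<le> \<bar>(real (m n))\<^sup>2 / real n - \<kappa>\<^sup>2\<bar> * (1 / d)"
          using XX by (intro mult_mono) auto
        also have "\<dots> = \<bar>(real (m n))\<^sup>2 / real n - \<kappa>\<^sup>2\<bar> / d" by simp
        finally show ?thesis using elim(3) by linarith
      qed
      have D: "\<bar>\<kappa>\<^sup>2 / 2 * (X / (1 - X)) - \<kappa>\<^sup>2 / 2 * v\<bar> \<le> \<epsilon> / 4"
        using \<eta>(2)[of X] near unfolding dist_real_def v_def by simp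
      have "\<bar>ln (G n (m n) k) + \<kappa> * (sqrt (real n) * phi t X) + \<kappa>\<^sup>2 / 2 * v\<bar> \<le> \<epsilon>"
        using A(2) B C D by linarith
      then show "G n (ms \<kappa> n) k > 0 \<and> \<bar>ln (G n (ms \<kappa> n) k) + \<kappa> * (sqrt (real n) * phi t (real k / real n)) + \<kappa>\<^sup>2 / 2 * v\<bar> \<le> \<epsilon>"
        using A(1) by (simp add: m_def X_def)
    qed
  qed
qed

text \<open>The approximation of the tilt is uniform in relative terms, so its total error is at
  most a small multiple of the mean of the tilt, which is at most 1. The deterministic factor
  \<open>exp (\<kappa>\<^sup>2 / 2 * v)\<close> is moved across afterwards.\<close>

lemma bulk_mgf_tendsto:
  assumes "\<kappa> \<ge> 0"
  shows "(\<lambda>n. \<Sum>k\<in>bulk n. mu n k * exp (- \<kappa> * (sqrt (real n) * phi t (real k / real n)))) \<longlonglongrightarrow> \<theta> * exp (\<kappa>\<^sup>2 / 2 * v)"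
proof -
  define Y where "Y = (\<lambda>n k. sqrt (real n) * phi t (real k / real n))"
  define F where "F = (\<lambda>n. \<Sum>k\<in>bulk n. mu n k * exp (- \<kappa> * Y n k - \<kappa>\<^sup>2 / 2 * v))"
  define g where "g = (\<lambda>n. \<Sum>k\<in>bulk n. mu n k * G n (ms \<kappa> n) k)"
  have diff: "(\<lambda>n. F n - g n) \<longlonglongrightarrow> 0"
    unfolding tendsto_iff
  proof (intro allI impI)
    fix y :: real assume y: "0 < y"
    \<comment> \<open>An error of \<open>\<epsilon>\<close> in the logarithm then means a relative
      error of at most \<open>y / 2\<close> in both directions.\<close>
    define \<epsilon> where "\<epsilon> = ln (1 + y / 2)"
    have \<epsilon>: "\<epsilon> > 0" "exp \<epsilon> = 1 + y / 2" using y by (auto simp: \<epsilon>_def)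
    show "eventually (\<lambda>n. dist (F n - g n) 0 < y) sequentially"
      using ln_G_bulk[OF assms \<epsilon>(1)] ms_less_eventually[OF assms]
    proof eventually_elim
      case (elim n)
      have pt: "\<bar>exp (- \<kappa> * Y n k - \<kappa>\<^sup>2 / 2 * v) - G n (ms \<kappa> n) k\<bar> \<le> y / 2 * G n (ms \<kappa> n) k" if k: "k \<in> bulk n" for k
      proof -
        define r where "r = - \<kappa> * Y n k - \<kappa>\<^sup>2 / 2 * v - ln (G n (ms \<kappa> n) k)"
        have G0: "G n (ms \<kappa> n) k > 0" and r: "\<bar>r\<bar> \<le> \<epsilon>"
          using elim(1) k by (auto simp: r_def Y_def algebra_simps)
        have eq: "exp (- \<kappa> * Y n k - \<kappa>\<^sup>2 / 2 * v) = G n (ms \<kappa> n) k * exp r"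
          using G0 by (simp add: r_def exp_diff)
        have "exp r \<le> exp \<epsilon>" using r by simp
        moreover have "exp (- \<epsilon>) \<le> exp r" using r by simp
        moreover have "1 - y / 2 \<le> exp (- \<epsilon>)"
        proof -
          have "(1 - y / 2) * (1 + y / 2) \<le> 1" using y by (simp add: algebra_simps)
          then show ?thesis using y unfolding exp_minus \<epsilon>(2) by (simp add: field_simps)
        qed
        ultimately have "\<bar>exp r - 1\<bar> \<le> y / 2" using \<epsilon>(2) by linarith
        then have "G n (ms \<kappa> n) k * \<bar>exp r - 1\<bar> \<le> G n (ms \<kappa> n) k * (y / 2)"
          using G0 by (intro mult_left_mono) auto
        moreover have "G n (ms \<kappa> n) k * exp r - G n (ms \<kappa> n) k = G n (ms \<kappa> n) k * (exp r - 1)"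
          by (simp add: algebra_simps)
        ultimately show ?thesis unfolding eq using G0 by (simp add: abs_mult mult_ac)
      qed
      have "F n - g n = (\<Sum>k\<in>bulk n. mu n k * (exp (- \<kappa> * Y n k - \<kappa>\<^sup>2 / 2 * v) - G n (ms \<kappa> n) k))"
        by (simp add: F_def g_def sum_subtractf right_diff_distrib)
      then have "\<bar>F n - g n\<bar> \<le> (\<Sum>k\<in>bulk n. \<bar>mu n k * (exp (- \<kappa> * Y n k - \<kappa>\<^sup>2 / 2 * v) - G n (ms \<kappa> n) k)\<bar>)"
        by simp
      also have "\<dots> \<le> (\<Sum>k\<in>bulk n. y / 2 * (mu n k * G n (ms \<kappa> n) k))"
      proof (intro sum_mono)
        fix k assume k: "k \<in> bulk n"
        have "\<bar>mu n k * (exp (- \<kappa> * Y n k - \<kappa>\<^sup>2 / 2 * v) - G n (ms \<kappa> n) k)\<bar> \<le> mu n k * (y / 2 * G n (ms \<kappa> n) k)"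
          unfolding abs_mult using pt[OF k] mu_nonneg[of n k] by (intro mult_mono) auto
        then show "\<bar>mu n k * (exp (- \<kappa> * Y n k - \<kappa>\<^sup>2 / 2 * v) - G n (ms \<kappa> n) k)\<bar> \<le> y / 2 * (mu n k * G n (ms \<kappa> n) k)"
          by (simp add: mult_ac)
      qed
      also have "\<dots> = y / 2 * g n" by (simp add: g_def sum_distrib_left)
      also have "\<dots> \<le> y / 2 * 1"
        unfolding g_def using y by (intro mult_left_mono sum_mu_G_le_1 bulk_subset elim) auto
      also have "\<dots> < y" using y by simp
      finally show ?case by (simp add: dist_real_def)
    qed
  qed
  have "g \<longlonglongrightarrow> \<theta>" unfolding g_def by (rule bulk_G_tendsto[OF assms])
  from tendsto_mult_right[OF tendsto_add[OF diff this], of "exp (\<kappa>\<^sup>2 / 2 * v)"]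
  have "(\<lambda>n. F n * exp (\<kappa>\<^sup>2 / 2 * v)) \<longlonglongrightarrow> \<theta> * exp (\<kappa>\<^sup>2 / 2 * v)" by simp
  moreover have "F n * exp (\<kappa>\<^sup>2 / 2 * v) = (\<Sum>k\<in>bulk n. mu n k * exp (- \<kappa> * Y n k))" for n
    unfolding F_def sum_distrib_right
    by (intro sum.cong refl) (simp add: exp_diff)
  ultimately have "(\<lambda>n. \<Sum>k\<in>bulk n. mu n k * exp (- \<kappa> * Y n k)) \<longlonglongrightarrow> \<theta> * exp (\<kappa>\<^sup>2 / 2 * v)"
    by (simp only:)
  then show ?thesis unfolding Y_def .
qed

lemma bulk_phi_cdf_tendsto:
  "(\<lambda>n. \<Sum>k | k \<in> bulk n \<and> sqrt (real n) * phi t (real k / real n) / sqrt v \<le> x. mu n k)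
     \<longlonglongrightarrow> \<theta> * cdf std_normal_distribution x"
proof (rule weighted_mgf_limit_imp_normal_limit[OF bulk_subset(3) mu_nonneg theta_pos])
  fix s :: real assume s: "s \<ge> 0"
  have "(s / sqrt v)\<^sup>2 / 2 * v = s\<^sup>2 / 2" using v_pos by (simp add: power_divide)
  then show "(\<lambda>n. \<Sum>k\<in>bulk n. mu n k * exp (- s * (sqrt (real n) * phi t (real k / real n) / sqrt v))) \<longlonglongrightarrow> \<theta> * exp (s\<^sup>2 / 2)"
    using bulk_mgf_tendsto[of "s / sqrt v"] s v_pos by simp
qed

end

section \<open>From the component of a vertex to the largest component\<close>

text \<open>Monotonicity replaces uniform convergence: eventually \<open>y n\<close> lies between
  \<open>x - d / 2\<close> and \<open>x + d / 2\<close>, where pointwise convergence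
  applies.\<close>

lemma tendsto_mono_compose:
  fixes F :: "nat \<Rightarrow> real \<Rightarrow> real"
  assumes mono: "\<And>n x y. x \<le> y \<Longrightarrow> F n x \<le> F n y"
    and lim: "\<And>x. (\<lambda>n. F n x) \<longlonglongrightarrow> L x"
    and cont: "isCont L x" and y: "y \<longlonglongrightarrow> x"
  shows "(\<lambda>n. F n (y n)) \<longlonglongrightarrow> L x"
proof (rule order_tendstoI)
  fix a assume "a < L x"
  then obtain d where d: "d > 0" "\<And>z. dist z x < d \<Longrightarrow> dist (L z) (L x) < L x - a"
    using cont unfolding continuous_at_eps_delta by (metis diff_gt_0_iff_gt)
  have "dist (L (x - d / 2)) (L x) < L x - a" using d by (intro d) (simp add: dist_real_def)
  then have "a < L (x - d / 2)" by (simp add: dist_real_def)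
  from order_tendstoD(1)[OF lim this] order_tendstoD(1)[OF y, of "x - d / 2"] d(1)
  have "eventually (\<lambda>n. a < F n (x - d / 2) \<and> x - d / 2 < y n) sequentially" by (simp add: eventually_conj)
  then show "eventually (\<lambda>n. a < F n (y n)) sequentially"
    by eventually_elim (use mono in \<open>meson less_imp_le less_le_trans\<close>)
next
  fix a assume "L x < a"
  then obtain d where d: "d > 0" "\<And>z. dist z x < d \<Longrightarrow> dist (L z) (L x) < a - L x"
    using cont unfolding continuous_at_eps_delta by (metis diff_gt_0_iff_gt)
  have "dist (L (x + d / 2)) (L x) < a - L x" using d by (intro d) (simp add: dist_real_def)
  then have "L (x + d / 2) < a" by (simp add: dist_real_def)
  from order_tendstoD(2)[OF lim this] order_tendstoD(2)[OF y, of "x + d / 2"] d(1)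
  have "eventually (\<lambda>n. F n (x + d / 2) < a \<and> y n < x + d / 2) sequentially" by (simp add: eventually_conj)
  then show "eventually (\<lambda>n. F n (y n) < a) sequentially"
    by eventually_elim (use mono in \<open>meson less_imp_le le_less_trans\<close>)
qed

lemma DERIV_sqrt_scaling:
  fixes f :: "real \<Rightarrow> real"
  assumes "(f has_real_derivative D) (at a)"
  shows "(\<lambda>n. sqrt (real n) * (f (a + c / sqrt (real n)) - f a)) \<longlonglongrightarrow> c * D"
proof (cases "c = 0")
  case False
  have lim: "((\<lambda>h. (f (a + h) - f a) / h) \<longlongrightarrow> D) (at 0)"
    using assms by (simp add: DERIV_def)
  have "filterlim (\<lambda>n. c / sqrt (real n)) (at 0) sequentially"
    unfolding filterlim_at
  proof
    show "(\<lambda>n. c / sqrt (real n)) \<longlonglongrightarrow> 0" by real_asymp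
    show "eventually (\<lambda>n. c / sqrt (real n) \<in> UNIV \<and> c / sqrt (real n) \<noteq> 0) sequentially"
      using eventually_gt_at_top[of 0] by eventually_elim (use False in auto)
  qed
  from filterlim_compose[OF lim this]
  have "(\<lambda>n. c * ((f (a + c / sqrt (real n)) - f a) / (c / sqrt (real n)))) \<longlonglongrightarrow> c * D"
    by (intro tendsto_intros)
  then show ?thesis using False by (simp add: mult.commute)
qed simp

section \<open>From \<open>phi t X\<close> to component sizes, and removal of the size bias\<close>

context supercritical_cut
begin

lemma phi_has_derivative: "x < 1 \<Longrightarrow> (phi t has_real_derivative - t + 1 / (1 - x)) (at x)"
  unfolding phi_def by (auto intro!: derivative_eq_intros simp: field_simps)

lemma phi_strict_mono:
  assumes "1 - 1 / t \<le> x" "x < y" "y < 1"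
  shows "phi t x < phi t y"
proof (rule DERIV_pos_imp_increasing_open[OF assms(2)])
  fix z assume z: "x < z" "z < y"
  have "t * (1 - z) < t * (1 - x)" using z t_gt_1 by (intro mult_strict_left_mono) auto
  also have "\<dots> \<le> 1" using assms t_gt_1 by (simp add: field_simps)
  finally have "t * (1 - z) < 1" .
  then have "- t + 1 / (1 - z) > 0" using z assms by (simp add: field_simps)
  then show "\<exists>d. (phi t has_real_derivative d) (at z) \<and> 0 < d"
    using phi_has_derivative[of z] z assms by auto
next
  show "continuous_on {x..y} (phi t)"
    using assms by (intro continuous_at_imp_continuous_on ballI DERIV_isCont[OF phi_has_derivative]) auto
qed

lemma phi_theta: "phi t \<theta> = 0"
  using phi_eq_ln_h[OF theta_less_1] h_theta by simp

definition \<sigma> :: real where "\<sigma> = clt_sigma t"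

text \<open>Delta method: \<open>\<sigma>\<close> is the standard deviation \<open>sqrt v\<close>
  divided by the slope of \<open>phi t\<close> at \<open>\<theta>\<close>.\<close>

lemma sigma_pos: "\<sigma> > 0" and sigma_deriv: "\<sigma> * (- t + 1 / (1 - \<theta>)) = sqrt v"
proof -
  have D: "deriv (phi t) \<theta> = - t + 1 / (1 - \<theta>)" by (rule deriv_phi[OF theta_less_1])
  have D0: "- t + 1 / (1 - \<theta>) > 0" using deriv_phi_theta_pos[OF t_gt_1] unfolding D .
  show "\<sigma> > 0" unfolding \<sigma>_def clt_sigma_def D using D0 theta_pos theta_less_1 by simp
  show "\<sigma> * (- t + 1 / (1 - \<theta>)) = sqrt v"
    using D0 unfolding \<sigma>_def clt_sigma_def D v_def real_sqrt_divide by simp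
qed

definition scaled_le :: "real \<Rightarrow> nat \<Rightarrow> nat set" where
  "scaled_le x n = {k. (real k - \<theta> * real n) / (\<sigma> * sqrt (real n)) \<le> x}"

text \<open>Nothing random is linearised. As \<open>phi t\<close> is increasing near
  \<open>\<theta>\<close>, the event is the same as \<open>phi t X\<close> being at most the value
  of \<open>phi t\<close> at \<open>\<theta> + x * \<sigma> / sqrt n\<close>, and only this
  deterministic bound is expanded.\<close>

lemma bulk_cdf_tendsto:
  "(\<lambda>n. \<Sum>k\<in>bulk n \<inter> scaled_le x n. mu n k) \<longlonglongrightarrow> \<theta> * cdf std_normal_distribution x"
proof -
  define F where "F = (\<lambda>n z. \<Sum>k | k \<in> bulk n \<and> sqrt (real n) * phi t (real k / real n) / sqrt v \<le> z. mu n k)"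
  define y where "y = (\<lambda>n. sqrt (real n) * phi t (\<theta> + x * \<sigma> / sqrt (real n)) / sqrt v)"
  have "(\<lambda>n. sqrt (real n) * (phi t (\<theta> + x * \<sigma> / sqrt (real n)) - phi t \<theta>) / sqrt v) \<longlonglongrightarrow> x * \<sigma> * (- t + 1 / (1 - \<theta>)) / sqrt v"
    using v_pos by (intro tendsto_divide tendsto_const DERIV_sqrt_scaling phi_has_derivative theta_less_1) auto
  moreover have "x * \<sigma> * (- t + 1 / (1 - \<theta>)) / sqrt v = x"
    using v_pos unfolding mult.assoc sigma_deriv by simp
  ultimately have y: "y \<longlonglongrightarrow> x" by (simp add: y_def phi_theta)
  have Fy: "(\<lambda>n. F n (y n)) \<longlonglongrightarrow> \<theta> * cdf std_normal_distribution x"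
  proof (rule tendsto_mono_compose[OF _ _ _ y])
    show "F n a \<le> F n b" if "a \<le> b" for n a b
      unfolding F_def using bulk_subset(3)[of n] that by (intro sum_mono2 mu_nonneg) auto
    show "(\<lambda>n. F n z) \<longlonglongrightarrow> \<theta> * cdf std_normal_distribution z" for z
      unfolding F_def by (rule bulk_phi_cdf_tendsto)
    show "isCont (\<lambda>z. \<theta> * cdf std_normal_distribution z) x"
      by (intro continuous_intros isCont_cdf_std_normal)
  qed
  \<comment> \<open>A radius about \<open>\<theta>\<close> within which \<open>phi t\<close> is
    increasing and the argument stays below 1.\<close>
  define e where "e = min (\<theta> - (1 - 1 / t)) (1 - \<theta>)"
  have e: "e > 0" using theta_gt theta_less_1 by (simp add: e_def)
  have e_le: "e \<le> \<theta> - (1 - 1 / t)" "e \<le> 1 - \<theta>" by (auto simp: e_def)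
  have "(\<lambda>n. x * \<sigma> / sqrt (real n)) \<longlonglongrightarrow> 0" by real_asymp
  then have "eventually (\<lambda>n. dist (x * \<sigma> / sqrt (real n)) 0 < e) sequentially"
    using e unfolding tendsto_iff by blast
  then have "eventually (\<lambda>n. F n (y n) = (\<Sum>k\<in>bulk n \<inter> scaled_le x n. mu n k)) sequentially"
    using bulk_near[OF e] eventually_gt_at_top[of 0]
  proof eventually_elim
    case (elim n)
    have n: "real n > 0" using elim by simp
    define z where "z = \<theta> + x * \<sigma> / sqrt (real n)"
    have "\<bar>x * \<sigma> / sqrt (real n)\<bar> < e" using elim(1) unfolding dist_real_def by simp
    moreover have "z = \<theta> + x * \<sigma> / sqrt (real n)" by (fact z_def)
    moreover have "1 - 1 / t < \<theta> + u \<and> \<theta> + u < 1" if "\<bar>u\<bar> < e" for u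
      using that e_le by (simp add: abs_less_iff)
    ultimately have z: "1 - 1 / t < z" "z < 1" by auto
    have "k \<in> scaled_le x n \<longleftrightarrow> sqrt (real n) * phi t (real k / real n) / sqrt v \<le> y n" if k: "k \<in> bulk n" for k
    proof -
      have "\<bar>real k / real n - \<theta>\<bar> < e" using elim(2) k by blast
      then have X: "1 - 1 / t < real k / real n" "real k / real n < 1" using e_le by linarith+
      define w where "w = \<sigma> / sqrt (real n)"
      define q where "q = (real k - \<theta> * real n) / (\<sigma> * sqrt (real n))"
      have w: "w > 0" using n sigma_pos by (simp add: w_def)
      have 1: "real k / real n - \<theta> = q * w"
        using n sigma_pos by (simp add: q_def w_def field_simps)
      have 2: "z - \<theta> = x * w" by (simp add: z_def w_def)
      have "k \<in> scaled_le x n \<longleftrightarrow> real k / real n - \<theta> \<le> z - \<theta>"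
        unfolding 1 2 scaled_le_def mem_Collect_eq q_def [symmetric] mult_le_cancel_right_pos[OF w] ..
      also have "\<dots> \<longleftrightarrow> real k / real n \<le> z" by simp
      also have "\<dots> \<longleftrightarrow> phi t (real k / real n) \<le> phi t z"
        using phi_strict_mono[of "real k / real n" z] phi_strict_mono[of z "real k / real n"] X z
        by (cases "real k / real n" z rule: linorder_cases) auto
      also have "\<dots> \<longleftrightarrow> sqrt (real n) * phi t (real k / real n) / sqrt v \<le> y n"
        using n v_pos by (simp add: y_def z_def divide_le_cancel)
      finally show ?thesis .
    qed
    then have "{k. k \<in> bulk n \<and> sqrt (real n) * phi t (real k / real n) / sqrt v \<le> y n} = bulk n \<inter> scaled_le x n"
      by blast
    then show ?case by (simp add: F_def)
  qed
  with Fy show ?thesis by (simp add: tendsto_cong)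
qed

lemma bulk_mass_tendsto: "(\<lambda>n. \<Sum>k\<in>bulk n. mu n k) \<longlonglongrightarrow> \<theta>"
  using bulk_mgf_tendsto[of 0] by simp

text \<open>In the bulk \<open>n / k\<close> is uniformly close to \<open>1 / \<theta>\<close>,
  cancelling the factor in the hypothesis; on the other large sizes it is at most
  \<open>1 / \<delta>\<close> while their mass vanishes.\<close>

lemma expected_components_tendsto:
  assumes "(\<lambda>n. \<Sum>k\<in>bulk n \<inter> T n. mu n k) \<longlonglongrightarrow> \<theta> * c"
  shows "(\<lambda>n. \<Sum>k\<in>large \<delta> n \<inter> T n. real n / real k * mu n k) \<longlonglongrightarrow> c"
proof -
  let ?f = "\<lambda>n k. real n / real k * mu n k"
  have f0: "?f n k \<ge> 0" for n k using mu_nonneg by simp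
  have split: "(\<Sum>k\<in>large \<delta> n \<inter> T n. ?f n k) = (\<Sum>k\<in>bulk n \<inter> T n. ?f n k) + (\<Sum>k\<in>(large \<delta> n - bulk n) \<inter> T n. ?f n k)" for n
  proof -
    have "large \<delta> n \<inter> T n = (bulk n \<inter> T n) \<union> ((large \<delta> n - bulk n) \<inter> T n)"
      using bulk_subset(1) by auto
    then show ?thesis
      using bulk_subset(3) small_large(4) by (simp only:) (intro sum.union_disjoint; auto)
  qed
  have "(\<lambda>n. \<Sum>k\<in>(large \<delta> n - bulk n) \<inter> T n. ?f n k) \<longlonglongrightarrow> 0"
  proof (rule tendsto_sandwich[of "\<lambda>_. 0" _ _ "\<lambda>n. 1 / \<delta> * (\<Sum>k\<in>large \<delta> n - bulk n. mu n k)"])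
    have "(\<Sum>k\<in>(large \<delta> n - bulk n) \<inter> T n. ?f n k) \<le> 1 / \<delta> * (\<Sum>k\<in>large \<delta> n - bulk n. mu n k)" for n
    proof -
      have "(\<Sum>k\<in>(large \<delta> n - bulk n) \<inter> T n. ?f n k) \<le> (\<Sum>k\<in>large \<delta> n - bulk n. ?f n k)"
        using f0 small_large(4) by (intro sum_mono2) auto
      also have "\<dots> \<le> (\<Sum>k\<in>large \<delta> n - bulk n. 1 / \<delta> * mu n k)"
      proof (intro sum_mono mult_right_mono mu_nonneg)
        fix k assume "k \<in> large \<delta> n - bulk n"
        then have "\<delta> * real n < real k" "0 < real k" by (auto simp: large_def)
        then show "real n / real k \<le> 1 / \<delta>" using \<delta>_pos by (simp add: field_simps)
      qed
      finally show ?thesis by (simp add: sum_distrib_left)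
    qed
    then show "eventually (\<lambda>n. (\<Sum>k\<in>(large \<delta> n - bulk n) \<inter> T n. ?f n k) \<le> 1 / \<delta> * (\<Sum>k\<in>large \<delta> n - bulk n. mu n k)) sequentially"
      by (intro always_eventually allI)
    have "(\<lambda>n. 1 / \<delta> * (\<Sum>k\<in>large \<delta> n - bulk n. mu n k)) \<longlonglongrightarrow> 1 / \<delta> * 0"
      by (intro tendsto_intros outside_bulk_tendsto)
    then show "(\<lambda>n. 1 / \<delta> * (\<Sum>k\<in>large \<delta> n - bulk n. mu n k)) \<longlonglongrightarrow> 0" by simp
  qed (use f0 in \<open>auto intro!: always_eventually sum_nonneg\<close>)
  moreover have "(\<lambda>n. (\<Sum>k\<in>bulk n \<inter> T n. ?f n k) - 1 / \<theta> * (\<Sum>k\<in>bulk n \<inter> T n. mu n k)) \<longlonglongrightarrow> 0"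
    unfolding tendsto_iff
  proof (intro allI impI)
    fix e :: real assume e: "e > 0"
    then have e2: "e / 2 > 0" by simp
    have "isCont (\<lambda>x. 1 / x) \<theta>" using theta_pos by (intro continuous_intros) auto
    then obtain \<eta> where \<eta>: "\<eta> > 0" "\<And>x. dist x \<theta> < \<eta> \<Longrightarrow> dist (1 / x) (1 / \<theta>) < e / 2"
      using e2 unfolding continuous_at_eps_delta by metis
    from bulk_near[OF \<eta>(1)]
    show "eventually (\<lambda>n. dist ((\<Sum>k\<in>bulk n \<inter> T n. ?f n k) - 1 / \<theta> * (\<Sum>k\<in>bulk n \<inter> T n. mu n k)) 0 < e) sequentially"
    proof eventually_elim
      case (elim n)
      have "(\<Sum>k\<in>bulk n \<inter> T n. ?f n k) - 1 / \<theta> * (\<Sum>k\<in>bulk n \<inter> T n. mu n k) = (\<Sum>k\<in>bulk n \<inter> T n. (real n / real k - 1 / \<theta>) * mu n k)"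
        by (simp add: sum_distrib_left sum_subtractf left_diff_distrib)
      then have "\<bar>(\<Sum>k\<in>bulk n \<inter> T n. ?f n k) - 1 / \<theta> * (\<Sum>k\<in>bulk n \<inter> T n. mu n k)\<bar> \<le> (\<Sum>k\<in>bulk n \<inter> T n. \<bar>(real n / real k - 1 / \<theta>) * mu n k\<bar>)"
        by simp
      also have "\<dots> \<le> (\<Sum>k\<in>bulk n \<inter> T n. e / 2 * mu n k)"
      proof (intro sum_mono)
        fix k assume "k \<in> bulk n \<inter> T n"
        then have "dist (real k / real n) \<theta> < \<eta>" using elim by (simp add: dist_real_def)
        from \<eta>(2)[OF this] have "\<bar>real n / real k - 1 / \<theta>\<bar> \<le> e / 2" by (simp add: dist_real_def)
        then show "\<bar>(real n / real k - 1 / \<theta>) * mu n k\<bar> \<le> e / 2 * mu n k"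
          using mu_nonneg[of n k] by (simp only: abs_mult abs_of_nonneg) (rule mult_right_mono)
      qed
      also have "\<dots> = e / 2 * (\<Sum>k\<in>bulk n \<inter> T n. mu n k)" by (simp add: sum_distrib_left)
      also have "\<dots> \<le> e / 2 * 1"
        using e bulk_subset(2) by (intro mult_left_mono sum_mu_le_1) auto
      also have "\<dots> < e" using e by simp
      finally show ?case by (simp add: dist_real_def)
    qed
  qed
  moreover have "(\<lambda>n. 1 / \<theta> * (\<Sum>k\<in>bulk n \<inter> T n. mu n k)) \<longlonglongrightarrow> 1 / \<theta> * (\<theta> * c)"
    by (intro tendsto_intros assms)
  ultimately have "(\<lambda>n. (\<Sum>k\<in>(large \<delta> n - bulk n) \<inter> T n. ?f n k) + ((\<Sum>k\<in>bulk n \<inter> T n. ?f n k) - 1 / \<theta> * (\<Sum>k\<in>bulk n \<inter> T n. mu n k))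
      + 1 / \<theta> * (\<Sum>k\<in>bulk n \<inter> T n. mu n k)) \<longlonglongrightarrow> 0 + 0 + 1 / \<theta> * (\<theta> * c)"
    by (intro tendsto_add)
  then show ?thesis unfolding split using theta_pos by (simp add: add.commute)
qed

section \<open>Uniqueness of the giant component\<close>

text \<open>The identity for \<open>m = 1\<close> suffices: in the subcritical regime the tilt is at most \<open>N / (N - 1)\<close> and bounded away
  from 1 on large components.\<close>

lemma subcritical_large_component_bound:
  assumes N: "2 \<le> N" "N \<le> n" and c: "0 < c" "c \<le> real n / real N - t"
  shows "(\<Sum>l | l \<in> {1..N} \<and> \<delta> * real n < real l. comp_size_prob (edge_prob t n) N l) \<le> 1 / real N / (1 - exp (- (c * \<delta>)))"
proof -
  let ?p = "edge_prob t n"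
  let ?w = "comp_size_prob ?p N"
  let ?L = "{l. l \<in> {1..N} \<and> \<delta> * real n < real l}"
  have n0: "real n > 0" "real N > 0" "real N - 1 > 0" using N by auto
  have w0: "?w l \<ge> 0" for l using edge_prob[of n] by (intro comp_size_prob_nonneg) auto
  have w1: "(\<Sum>l=1..N. ?w l) = 1" using edge_prob[of n] N by (intro sum_comp_size_prob) auto
  \<comment> \<open>\<open>1 - l / N \<le> exp (- (l / N))\<close> turns the tilt into an
    exponential with rate \<open>n / N - t\<close>, which is where subcriticality enters.\<close>
  have tl: "(real N - 1) / real N * tilt ?p N 1 l \<le> exp (- (c * (real l / real n)))" if l: "l \<in> {1..N}" for l
  proof -
    have "tilt ?p N 1 l = (real N - real l) / (real N - 1) * exp (t * real l / real n)"
      using binomial_ratio_prod'[of 1 N l] N l one_minus_edge_prob_power[of n l]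
      by (simp add: tilt_def divide_inverse)
    then have "(real N - 1) / real N * tilt ?p N 1 l = (1 - real l / real N) * exp (t * real l / real n)"
      using n0 by (simp add: field_simps)
    also have "\<dots> \<le> exp (- (real l / real N)) * exp (t * real l / real n)"
      using exp_ge_add_one_self[of "- (real l / real N)"] by (intro mult_right_mono) auto
    also have "\<dots> = exp (- ((real n / real N - t) * (real l / real n)))"
      using n0 by (simp add: exp_add [symmetric] field_simps)
    also have "\<dots> \<le> exp (- (c * (real l / real n)))"
      using c n0 by (simp add: mult_right_mono divide_right_mono)
    finally show ?thesis .
  qed
  \<comment> \<open>The rescaled tilt has mean \<open>1 - 1 / N\<close> and never exceeds 1, so the
    large sizes, each losing at least \<open>1 - exp (- (c * \<delta>))\<close>, share a deficit of
    only \<open>1 / N\<close>.\<close>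
  have "(real N - 1) / real N = (real N - 1) / real N * (\<Sum>l=1..N. ?w l * tilt ?p N 1 l)"
    using edge_prob[of n] N by (subst sum_comp_size_prob_tilt) auto
  also have "\<dots> = (\<Sum>l=1..N. ?w l * ((real N - 1) / real N * tilt ?p N 1 l))"
    by (simp add: sum_distrib_left mult_ac)
  also have "\<dots> \<le> (\<Sum>l=1..N. ?w l * (if l \<in> ?L then exp (- (c * \<delta>)) else 1))"
  proof (intro sum_mono mult_left_mono w0)
    fix l assume l: "l \<in> {1..N}"
    have "exp (- (c * (real l / real n))) \<le> (if l \<in> ?L then exp (- (c * \<delta>)) else 1)"
      using c n0 by (auto simp: field_simps)
    then show "(real N - 1) / real N * tilt ?p N 1 l \<le> (if l \<in> ?L then exp (- (c * \<delta>)) else 1)"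
      using tl[OF l] by linarith
  qed
  also have "\<dots> = (\<Sum>l=1..N. ?w l - (1 - exp (- (c * \<delta>))) * (if l \<in> ?L then ?w l else 0))"
    by (intro sum.cong refl) (simp add: algebra_simps)
  also have "\<dots> = 1 - (1 - exp (- (c * \<delta>))) * (\<Sum>l\<in>?L. ?w l)"
  proof -
    have "(\<Sum>l=1..N. if l \<in> ?L then ?w l else 0) = (\<Sum>l\<in>?L. ?w l)"
      by (intro sum.mono_neutral_cong_right) auto
    then show ?thesis by (simp only: sum_subtractf w1 sum_distrib_left [symmetric])
  qed
  finally have "(1 - exp (- (c * \<delta>))) * (\<Sum>l\<in>?L. ?w l) \<le> 1 / real N"
    using n0 by (simp add: diff_divide_distrib)
  moreover have "1 - exp (- (c * \<delta>)) > 0" using c \<delta>_pos by simp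
  ultimately show ?thesis by (subst pos_le_divide_eq) (simp_all add: mult.commute)
qed

definition threshold :: "nat \<Rightarrow> nat" where "threshold n = nat \<lfloor>\<delta> * real n\<rfloor>"

lemma threshold_less_iff: "threshold n < k \<longleftrightarrow> \<delta> * real n < real k"
  using \<delta>_pos unfolding threshold_def by (simp add: nat_less_iff floor_less_iff)

lemma large_eq: "large \<delta> n = {threshold n<..n}"
  by (auto simp: large_def simp flip: threshold_less_iff)

text \<open>The expected number of ordered pairs of distinct components with more than \<open>threshold n\<close> vertices.\<close>

definition pair_bound :: "nat \<Rightarrow> real" where
  "pair_bound n = (\<Sum>k\<in>{threshold n<..n}. real n / real k * mu n k *
        (\<Sum>l\<in>{threshold n<..n - k}. real (n - k) / real l * comp_size_prob (edge_prob t n) (n - k) l))"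

lemma pair_bound_nonneg: "pair_bound n \<ge> 0"
  unfolding pair_bound_def using edge_prob[of n]
  by (intro sum_nonneg mult_nonneg_nonneg mu_nonneg divide_nonneg_nonneg comp_size_prob_nonneg) auto

text \<open>Removing a component of bulk size leaves about \<open>(1 - \<theta>) * n\<close>
  vertices, with mean degree near \<open>t * (1 - \<theta>) < 1\<close>, so another large component
  has probability of order \<open>1 / n\<close>. For large sizes outside the bulk the trivial bound
  1 suffices. The two inverse size biases cost \<open>1 / \<delta>\<close> each.\<close>

lemma pair_bound_tendsto: "pair_bound \<longlonglongrightarrow> 0"
proof -
  \<comment> \<open>Midpoint of \<open>1 - \<theta>\<close> and \<open>1 / t\<close>: it bounds the
    remaining fraction of vertices from above and still leaves the positive margin
    \<open>c = 1 / \<beta> - t\<close>.\<close>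
  define \<beta> where "\<beta> = ((1 - \<theta>) + 1 / t) / 2"
  have \<beta>: "1 - \<theta> < \<beta>" "\<beta> < 1 / t" "0 < \<beta>" using theta_gt theta_less_1 t_gt_1 by (auto simp: \<beta>_def)
  define c where "c = 1 / \<beta> - t"
  have c: "c > 0" using \<beta> t_gt_1 by (simp add: c_def field_simps)
  define e where "e = min (\<beta> - (1 - \<theta>)) ((1 - \<theta>) / 2)"
  have e: "e > 0" using \<beta> theta_less_1 by (simp add: e_def)
  have e_le: "e \<le> \<beta> - (1 - \<theta>)" "e \<le> (1 - \<theta>) / 2"
    unfolding e_def by (rule min.cobounded1, rule min.cobounded2)
  \<comment> \<open>Arises from the subcritical bound when at least
    \<open>(1 - \<theta>) / 2 * n\<close> vertices remain.\<close>
  define K where "K = 2 / (1 - \<theta>) / (1 - exp (- (c * \<delta>)))"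
  have ex: "1 - exp (- (c * \<delta>)) > 0" using c \<delta>_pos by simp
  have K: "K > 0" using ex theta_less_1 by (simp add: K_def)
  let ?w = "\<lambda>n k l. comp_size_prob (edge_prob t n) (n - k) l"
  have w0: "?w n k l \<ge> 0" for n k l using edge_prob[of n] by (intro comp_size_prob_nonneg) auto
  have "eventually (\<lambda>n. pair_bound n \<le> 1 / \<delta> * (1 / \<delta>) * ((\<Sum>k\<in>large \<delta> n - bulk n. mu n k) + K / real n)) sequentially"
    using bulk_near[OF e] sequentially_real_ge[of "4 / (1 - \<theta>)"] eventually_gt_at_top[of 0]
  proof eventually_elim
    case (elim n)
    have n: "real n > 0" using elim by simp
    define S where "S = (\<lambda>k. \<Sum>l\<in>{threshold n<..n - k}. ?w n k l)"
    have S: "S k \<le> 1" for k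
    proof (cases "n - k \<ge> 1")
      case True
      have "S k \<le> (\<Sum>l=1..n - k. ?w n k l)" unfolding S_def using w0 by (intro sum_mono2) auto
      also have "\<dots> = 1" using edge_prob[of n] True by (intro sum_comp_size_prob) auto
      finally show ?thesis .
    qed (simp add: S_def)
    have Sb: "S k \<le> K / real n" if k: "k \<in> bulk n" for k
    proof -
      have kn: "k \<le> n" using subsetD[OF bulk_subset(2) k] by simp
      have N: "real (n - k) / real n = 1 - real k / real n" using kn n by (simp add: of_nat_diff field_simps)
      have "\<bar>real k / real n - \<theta>\<bar> < e" using elim k by blast
      then have N1: "real (n - k) / real n \<le> \<beta>" "(1 - \<theta>) / 2 \<le> real (n - k) / real n"
        unfolding N using e_le unfolding abs_less_iff by argo+
      have N2: "(1 - \<theta>) / 2 * real n \<le> real (n - k)" using N1(2) n by (simp add: field_simps)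
      have "4 \<le> (1 - \<theta>) * real n" using elim(2) theta_less_1 by (simp add: field_simps)
      then have N3: "2 \<le> real (n - k)" using N2 by linarith
      have N4: "c \<le> real n / real (n - k) - t"
      proof -
        have "real (n - k) / real n > 0" using N3 n by simp
        from frac_le[OF _ order_refl this N1(1), of 1]
        have "1 / \<beta> \<le> 1 / (real (n - k) / real n)" by simp
        then show ?thesis by (simp add: c_def)
      qed
      have "S k = (\<Sum>l | l \<in> {1..n - k} \<and> \<delta> * real n < real l. ?w n k l)"
        unfolding S_def by (intro sum.cong) (auto simp flip: threshold_less_iff)
      also have "\<dots> \<le> 1 / real (n - k) / (1 - exp (- (c * \<delta>)))"
        by (rule subcritical_large_component_bound) (use N3 N4 c in auto)
      also have "\<dots> \<le> 1 / ((1 - \<theta>) / 2 * real n) / (1 - exp (- (c * \<delta>)))"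
        using ex N2 N3 n theta_less_1 by (intro divide_right_mono divide_left_mono) auto
      also have "\<dots> = K / real n" by (simp add: K_def)
      finally show ?thesis .
    qed
    have "pair_bound n \<le> (\<Sum>k\<in>large \<delta> n. 1 / \<delta> * mu n k * (1 / \<delta> * S k))"
      unfolding pair_bound_def large_eq [symmetric]
    proof (intro sum_mono mult_mono mu_nonneg)
      fix k assume k: "k \<in> large \<delta> n"
      then have "\<delta> * real n < real k" "0 < real k" by (auto simp: large_def)
      then show "real n / real k \<le> 1 / \<delta>" using \<delta>_pos by (simp add: field_simps)
      show "(\<Sum>l\<in>{threshold n<..n - k}. real (n - k) / real l * ?w n k l) \<le> 1 / \<delta> * S k"
        unfolding S_def sum_distrib_left
      proof (intro sum_mono mult_right_mono w0)
        fix l assume "l \<in> {threshold n<..n - k}"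
        then have "threshold n < l" by simp
        then have l: "\<delta> * real n < real l" "0 < real l" unfolding threshold_less_iff [symmetric] by auto
        have "\<delta> * real (n - k) \<le> \<delta> * real n" using \<delta>_pos by (intro mult_left_mono) auto
        then have "\<delta> * real (n - k) \<le> real l" using l(1) by linarith
        then show "real (n - k) / real l \<le> 1 / \<delta>" using l(2) \<delta>_pos
          by (subst frac_le_eq) (auto simp: divide_le_0_iff mult.commute)
      qed
    qed (use mu_nonneg w0 \<delta>_pos in \<open>auto intro!: sum_nonneg mult_nonneg_nonneg\<close>)
    also have "\<dots> = 1 / \<delta> * (1 / \<delta>) * (\<Sum>k\<in>large \<delta> n. mu n k * S k)"
      by (simp add: sum_distrib_left mult_ac)
    also have "\<dots> \<le> 1 / \<delta> * (1 / \<delta>) * ((\<Sum>k\<in>large \<delta> n - bulk n. mu n k) + K / real n)"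
    proof (intro mult_left_mono)
      have "(\<Sum>k\<in>large \<delta> n. mu n k * S k) = (\<Sum>k\<in>large \<delta> n - bulk n. mu n k * S k) + (\<Sum>k\<in>bulk n. mu n k * S k)"
        by (rule sum.subset_diff[OF bulk_subset(1) small_large(4)])
      also have "\<dots> \<le> (\<Sum>k\<in>large \<delta> n - bulk n. mu n k * 1) + (\<Sum>k\<in>bulk n. mu n k * (K / real n))"
        using S Sb by (intro add_mono sum_mono mult_left_mono mu_nonneg) auto
      also have "(\<Sum>k\<in>bulk n. mu n k * (K / real n)) = (\<Sum>k\<in>bulk n. mu n k) * (K / real n)"
        by (rule sum_distrib_right [symmetric])
      also have "\<dots> \<le> 1 * (K / real n)"
        using K n by (intro mult_right_mono sum_mu_le_1 bulk_subset) auto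
      finally show "(\<Sum>k\<in>large \<delta> n. mu n k * S k) \<le> (\<Sum>k\<in>large \<delta> n - bulk n. mu n k) + K / real n" by simp
    qed (use \<delta>_pos in auto)
    finally show ?case .
  qed
  moreover have "(\<lambda>n. 1 / \<delta> * (1 / \<delta>) * ((\<Sum>k\<in>large \<delta> n - bulk n. mu n k) + K / real n)) \<longlonglongrightarrow> 1 / \<delta> * (1 / \<delta>) * (0 + 0)"
  proof -
    have "(\<lambda>n. K / real n) \<longlonglongrightarrow> 0" by real_asymp
    then show ?thesis by (intro tendsto_add tendsto_mult tendsto_const outside_bulk_tendsto)
  qed
  ultimately show ?thesis
    using pair_bound_nonneg by (intro tendsto_sandwich[of "\<lambda>_. 0" pair_bound]) (auto intro: always_eventually)
qed

lemma prob_max_component_in_tendsto: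
  assumes "(\<lambda>n. \<Sum>k\<in>bulk n \<inter> T n. mu n k) \<longlonglongrightarrow> \<theta> * c"
  shows "(\<lambda>n. measure_pmf.prob (erdos_renyi n (edge_prob t n)) {E. max_component_size {1..n} E \<in> {threshold n<..} \<inter> T n}) \<longlonglongrightarrow> c"
proof -
  let ?P = "\<lambda>n. measure_pmf.prob (erdos_renyi n (edge_prob t n)) {E. max_component_size {1..n} E \<in> {threshold n<..} \<inter> T n}"
  let ?s = "\<lambda>n. \<Sum>k\<in>large \<delta> n \<inter> T n. real n / real k * mu n k"
  have "(\<lambda>n. ?P n - ?s n) \<longlonglongrightarrow> 0"
  proof (rule Lim_null_comparison[OF _ pair_bound_tendsto])
    show "eventually (\<lambda>n. norm (?P n - ?s n) \<le> pair_bound n) sequentially"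
      using eventually_ge_at_top[of 1]
    proof eventually_elim
      case (elim n)
      have "({threshold n<..} \<inter> T n) \<inter> {1..n} = large \<delta> n \<inter> T n" unfolding large_eq by auto
      then show ?case
        using prob_max_component_size_approx[OF elim, of "{threshold n<..} \<inter> T n" "threshold n" "edge_prob t n"] edge_prob[of n]
        unfolding pair_bound_def mu_def by simp
    qed
  qed
  from tendsto_add[OF this expected_components_tendsto[OF assms]] show ?thesis by simp
qed

text \<open>The restriction to sizes above the threshold costs nothing in the limit: with
  \<open>UNIV\<close> in place of \<open>scaled_le x n\<close> the same result shows that such a
  component exists with probability tending to 1.\<close>

lemma max_component_clt:
  "(\<lambda>n. measure_pmf.prob (erdos_renyi n (edge_prob t n)) {E. max_component_size {1..n} E \<in> scaled_le x n})
     \<longlonglongrightarrow> cdf std_normal_distribution x"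
proof -
  let ?M = "\<lambda>n. erdos_renyi n (edge_prob t n)"
  let ?P = "\<lambda>n. measure_pmf.prob (?M n) {E. max_component_size {1..n} E \<in> scaled_le x n}"
  let ?A = "\<lambda>n. measure_pmf.prob (?M n) {E. max_component_size {1..n} E \<in> {threshold n<..} \<inter> scaled_le x n}"
  let ?B = "\<lambda>n. measure_pmf.prob (?M n) {E. max_component_size {1..n} E \<in> {threshold n<..} \<inter> UNIV}"
  have A: "?A \<longlonglongrightarrow> cdf std_normal_distribution x"
    by (rule prob_max_component_in_tendsto[OF bulk_cdf_tendsto])
  have B: "?B \<longlonglongrightarrow> 1"
    by (rule prob_max_component_in_tendsto) (use bulk_mass_tendsto in simp)
  have le: "?A n \<le> ?P n" "?P n \<le> ?A n + (1 - ?B n)" for n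
  proof -
    show "?A n \<le> ?P n" by (intro measure_pmf.finite_measure_mono) auto
    have "?P n \<le> measure_pmf.prob (?M n) ({E. max_component_size {1..n} E \<in> {threshold n<..} \<inter> scaled_le x n} \<union>
        (UNIV - {E. max_component_size {1..n} E \<in> {threshold n<..} \<inter> UNIV}))"
      by (intro measure_pmf.finite_measure_mono) auto
    also have "\<dots> \<le> ?A n + measure_pmf.prob (?M n) (UNIV - {E. max_component_size {1..n} E \<in> {threshold n<..} \<inter> UNIV})"
      by (rule measure_Un_le) auto
    also have "measure_pmf.prob (?M n) (UNIV - {E. max_component_size {1..n} E \<in> {threshold n<..} \<inter> UNIV}) = 1 - ?B n"
      using measure_pmf.prob_compl[of "{E. max_component_size {1..n} E \<in> {threshold n<..} \<inter> UNIV}" "?M n"] by simp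
    finally show "?P n \<le> ?A n + (1 - ?B n)" .
  qed
  have "(\<lambda>n. ?A n + (1 - ?B n)) \<longlonglongrightarrow> cdf std_normal_distribution x + (1 - 1)"
    by (intro tendsto_intros A B)
  then have lim: "(\<lambda>n. ?A n + (1 - ?B n)) \<longlonglongrightarrow> cdf std_normal_distribution x"
    by (simp only: diff_self add_0_right)
  show ?thesis
    by (rule tendsto_sandwich[OF _ _ A lim]; intro always_eventually allI le)
qed

end

theorem theorem1p6:
  fixes t x :: real
  assumes "t > 1"
  shows "(\<lambda>n. measure_pmf.prob (erdos_renyi n (edge_prob t n))
            {E. (real (max_component_size {1..n} E) - theta t * real n) / (clt_sigma t * sqrt (real n)) \<le> x})
         \<longlonglongrightarrow> cdf std_normal_distribution x"
proof -
  interpret supercritical t by unfold_locales (rule assms)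
  obtain \<delta> a where "supercritical_cut t \<delta> a" using ex_supercritical_cut by blast
  then interpret supercritical_cut t \<delta> a .
  show ?thesis using max_component_clt[of x] by (simp add: scaled_le_def \<sigma>_def)
qed

end
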